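(* Let $\mathcal{V}$ be $\mathsf{CPO}$ or $\mathsf{DCPO}$ and let $F$ be an (enriched, i.e. locally continuous) endofunctor of $\mathcal{V}$. Then $F$ is strongly finitary if and only if it preserves directed colimits and reflexive coinserters; and likewise, $F$ is strongly finitary if and only if it preserves directed colimits and reflexive surjective coinserters.
   Context: $\mathsf{CPO}$ is the category of posets with joins of $\omega$-chains (no least element required) and continuous maps (monotone maps preserving joins of $\omega$-chains). $\mathsf{DCPO}$ is the category of posets with joins of (nonempty) directed subsets and continuous maps (maps preserving directed joins). In both, hom-sets are ordered pointwise. An endofunctor is locally continuous if it is monotone on hom-sets and preserves joins of $\omega$-chains (for $\mathsf{DCPO}$: directed joins) in hom-sets. Strong finitarity: let $K:\mathsf{Set}_{\mathrm{fin}}\to\mathcal{V}$ send a finite set to the discretely ordered object on it. $F$ is strongly finitary if $F=\mathrm{Lan}_K(F\cdot K)$ (enriched left Kan extension): for every enriched endofunctor $G$ of $\mathcal V$ and every natural transformation $\sigma:FK\to GK$ there is a unique natural transformation $\bar\sigma:F\to G$ with $\bar\sigma K=\sigma$. Directed colimits are colimits of diagrams indexed by directed posets. A coinserter of an ordered parallel pair $f_0,f_1:A\to B$ is a morphism $c:B\to C$ with $c\cdot f_0\sqsubseteq c\cdot f_1$ such that (a) every morphism $c'$ with $c'\cdot f_0\sqsubseteq c'\cdot f_1$ factorizes through $c$, and (b) for all $u,v:C\to D$, $u\cdot c\sqsubseteq v\cdot c$ implies $u\sqsubseteq v$. It is reflexive if there is $d:B\to A$ with $f_0\cdot d=f_1\cdot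 d=\mathrm{id}$, and surjective if $c$ is a surjective map. $F$ preserves the coinserter $c$ if $Fc$ is a coinserter of $Ff_0,Ff_1$. *)

theory Defs
  imports Main "HOL-Library.FuncSet" "HOL-Library.Equipollence"
begin

section \<open>Smallness\<close>

text \<open>
  HOL has no type of all sets. The categories below therefore consist of the posets on small
  subsets of a type \<open>'u\<close> whose cardinality is that of a Grothendieck universe (uncountable,
  strong limit, regular); small means of smaller cardinality than \<open>'u\<close>. In ZFC, if \<open>'u\<close> is
  \<open>V\<^sub>\<kappa>\<close> with \<open>\<kappa>\<close> inaccessible, the small subsets of \<open>'u\<close> are precisely the elements of \<open>V\<^sub>\<kappa>\<close>.
\<close>

definition small :: "'u set \<Rightarrow> bool" where
  "small A \<longleftrightarrow> A \<prec> (UNIV :: 'u set)"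

definition universe :: "'u itself \<Rightarrow> bool" where
  "universe _ \<longleftrightarrow>
     (UNIV :: nat set) \<prec> (UNIV :: 'u set) \<and>
     (\<forall>A :: 'u set. small A \<longrightarrow> Pow A \<prec> (UNIV :: 'u set)) \<and>
     (\<forall>(A :: 'u set) (B :: 'u \<Rightarrow> 'u set).
        small A \<and> (\<forall>a\<in>A. small (B a)) \<longrightarrow> small (\<Union>a\<in>A. B a))"

section \<open>The categories CPO and DCPO\<close>

text \<open>
  A poset is given by its (reflexive) order relation \<open>r\<close>; its carrier is \<open>Field r\<close>.
  Both categories are treated at once; they differ only in the sets whose joins are considered.
\<close>

datatype kind = CPO | DCPO

definition is_join :: "'a rel \<Rightarrow> 'a set \<Rightarrow> 'a \<Rightarrow> bool" where
  "is_join r S x \<longleftrightarrow> x \<in> Field r \<and> (\<forall>s\<in>S. (s, x) \<in> r) \<and>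
     (\<forall>y\<in>Field r. (\<forall>s\<in>S. (s, y) \<in> r) \<longrightarrow> (x, y) \<in> r)"

definition directed_in :: "'a rel \<Rightarrow> 'a set \<Rightarrow> bool" where
  "directed_in r S \<longleftrightarrow> S \<subseteq> Field r \<and> S \<noteq> {} \<and>
     (\<forall>x\<in>S. \<forall>y\<in>S. \<exists>z\<in>S. (x, z) \<in> r \<and> (y, z) \<in> r)"

definition omega_chain_in :: "'a rel \<Rightarrow> 'a set \<Rightarrow> bool" where
  "omega_chain_in r S \<longleftrightarrow> (\<exists>c :: nat \<Rightarrow> 'a. (\<forall>n. (c n, c (Suc n)) \<in> r) \<and> S = range c)"

fun joinable :: "kind \<Rightarrow> 'a rel \<Rightarrow> 'a set \<Rightarrow> bool" where
  "joinable CPO r S = omega_chain_in r S"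
| "joinable DCPO r S = directed_in r S"

definition complete_poset :: "kind \<Rightarrow> 'a rel \<Rightarrow> bool" where
  "complete_poset k r \<longleftrightarrow> Partial_order r \<and> (\<forall>S. joinable k r S \<longrightarrow> (\<exists>x. is_join r S x))"

definition continuous_map :: "kind \<Rightarrow> 'a rel \<Rightarrow> 'b rel \<Rightarrow> ('a \<Rightarrow> 'b) \<Rightarrow> bool" where
  "continuous_map k r s f \<longleftrightarrow> f \<in> Field r \<rightarrow> Field s \<and>
     (\<forall>x y. (x, y) \<in> r \<longrightarrow> (f x, f y) \<in> s) \<and>
     (\<forall>S x. joinable k r S \<and> is_join r S x \<longrightarrow> is_join s (f ` S) (f x))"

definition obj :: "kind \<Rightarrow> 'u rel set" where
  "obj k = {A. complete_poset k A \<and> small (Field A)}"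

text \<open>
  Morphisms are extensional functions, so that HOL equality is equality of morphisms.
  Composition is \<^const>\<open>compose\<close>.
\<close>

definition hom :: "kind \<Rightarrow> 'u rel \<Rightarrow> 'u rel \<Rightarrow> ('u \<Rightarrow> 'u) set" where
  "hom k A B = {f \<in> extensional (Field A). continuous_map k A B f}"

definition hom_order :: "kind \<Rightarrow> 'u rel \<Rightarrow> 'u rel \<Rightarrow> ('u \<Rightarrow> 'u) rel" where
  "hom_order k A B =
     {(f, g). f \<in> hom k A B \<and> g \<in> hom k A B \<and> (\<forall>x\<in>Field A. (f x, g x) \<in> B)}"

definition ident :: "'u rel \<Rightarrow> 'u \<Rightarrow> 'u" where
  "ident A = restrict (\<lambda>x. x) (Field A)"

section \<open>Enriched endofunctors and natural transformations\<close>

record 'u endo =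
  on_obj :: "'u rel \<Rightarrow> 'u rel"
  on_hom :: "'u rel \<Rightarrow> 'u rel \<Rightarrow> ('u \<Rightarrow> 'u) \<Rightarrow> 'u \<Rightarrow> 'u"

definition enriched_endofunctor :: "kind \<Rightarrow> 'u endo \<Rightarrow> bool" where
  "enriched_endofunctor k F \<longleftrightarrow>
     (\<forall>A\<in>obj k. on_obj F A \<in> obj k) \<and>
     (\<forall>A\<in>obj k. \<forall>B\<in>obj k.
        continuous_map k (hom_order k A B) (hom_order k (on_obj F A) (on_obj F B))
          (on_hom F A B)) \<and>
     (\<forall>A\<in>obj k. on_hom F A A (ident A) = ident (on_obj F A)) \<and>
     (\<forall>A\<in>obj k. \<forall>B\<in>obj k. \<forall>C\<in>obj k. \<forall>f\<in>hom k A B. \<forall>g\<in>hom k B C.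
        on_hom F A C (compose (Field A) g f) =
          compose (Field (on_obj F A)) (on_hom F B C g) (on_hom F A B f))"

definition nat_trans :: "kind \<Rightarrow> 'u endo \<Rightarrow> 'u endo \<Rightarrow> ('u rel \<Rightarrow> 'u \<Rightarrow> 'u) \<Rightarrow> bool" where
  "nat_trans k F G \<tau> \<longleftrightarrow>
     \<tau> \<in> (\<Pi>\<^sub>E A\<in>obj k. hom k (on_obj F A) (on_obj G A)) \<and>
     (\<forall>A\<in>obj k. \<forall>B\<in>obj k. \<forall>f\<in>hom k A B.
        compose (Field (on_obj F A)) (on_hom G A B f) (\<tau> A) =
          compose (Field (on_obj F A)) (\<tau> B) (on_hom F A B f))"

section \<open>Strong finitarity\<close>

text \<open>
  The functor \<open>K\<close> sends a finite set \<open>n\<close> to the discrete poset \<open>Id_on n\<close> and a function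
  \<open>f \<in> n \<rightarrow>\<^sub>E m\<close> to itself.
\<close>

definition K_nat_trans :: "kind \<Rightarrow> 'u endo \<Rightarrow> 'u endo \<Rightarrow> ('u set \<Rightarrow> 'u \<Rightarrow> 'u) \<Rightarrow> bool" where
  "K_nat_trans k F G \<sigma> \<longleftrightarrow>
     \<sigma> \<in> (\<Pi>\<^sub>E n\<in>{n. finite n}. hom k (on_obj F (Id_on n)) (on_obj G (Id_on n))) \<and>
     (\<forall>n m. finite n \<and> finite m \<longrightarrow> (\<forall>f \<in> n \<rightarrow>\<^sub>E m.
        compose (Field (on_obj F (Id_on n))) (on_hom G (Id_on n) (Id_on m) f) (\<sigma> n) =
          compose (Field (on_obj F (Id_on n))) (\<sigma> m) (on_hom F (Id_on n) (Id_on m) f)))"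

definition strongly_finitary :: "kind \<Rightarrow> 'u endo \<Rightarrow> bool" where
  "strongly_finitary k F \<longleftrightarrow>
     (\<forall>G. enriched_endofunctor k G \<longrightarrow> (\<forall>\<sigma>. K_nat_trans k F G \<sigma> \<longrightarrow>
        (\<exists>!\<tau>. nat_trans k F G \<tau> \<and> (\<forall>n. finite n \<longrightarrow> \<tau> (Id_on n) = \<sigma> n))))"

section \<open>Directed colimits\<close>

definition directed_diagram ::
    "kind \<Rightarrow> 'u rel \<Rightarrow> ('u \<Rightarrow> 'u rel) \<Rightarrow> ('u \<Rightarrow> 'u \<Rightarrow> 'u \<Rightarrow> 'u) \<Rightarrow> bool" where
  "directed_diagram k I D d \<longleftrightarrow>
     Partial_order I \<and> directed_in I (Field I) \<and> small (Field I) \<and>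
     (\<forall>i\<in>Field I. D i \<in> obj k) \<and>
     (\<forall>i j. (i, j) \<in> I \<longrightarrow> d i j \<in> hom k (D i) (D j)) \<and>
     (\<forall>i\<in>Field I. d i i = ident (D i)) \<and>
     (\<forall>i j l. (i, j) \<in> I \<and> (j, l) \<in> I \<longrightarrow> compose (Field (D i)) (d j l) (d i j) = d i l)"

definition cocone ::
    "kind \<Rightarrow> 'u rel \<Rightarrow> ('u \<Rightarrow> 'u rel) \<Rightarrow> ('u \<Rightarrow> 'u \<Rightarrow> 'u \<Rightarrow> 'u) \<Rightarrow>
      'u rel \<Rightarrow> ('u \<Rightarrow> 'u \<Rightarrow> 'u) \<Rightarrow> bool" where
  "cocone k I D d C c \<longleftrightarrow>
     C \<in> obj k \<and> (\<forall>i\<in>Field I. c i \<in> hom k (D i) C) \<and>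
     (\<forall>i j. (i, j) \<in> I \<longrightarrow> compose (Field (D i)) (c j) (d i j) = c i)"

definition is_colimit ::
    "kind \<Rightarrow> 'u rel \<Rightarrow> ('u \<Rightarrow> 'u rel) \<Rightarrow> ('u \<Rightarrow> 'u \<Rightarrow> 'u \<Rightarrow> 'u) \<Rightarrow>
      'u rel \<Rightarrow> ('u \<Rightarrow> 'u \<Rightarrow> 'u) \<Rightarrow> bool" where
  "is_colimit k I D d C c \<longleftrightarrow>
     cocone k I D d C c \<and>
     (\<forall>E e. cocone k I D d E e \<longrightarrow>
        (\<exists>!h. h \<in> hom k C E \<and> (\<forall>i\<in>Field I. compose (Field (D i)) h (c i) = e i)))"

definition preserves_directed_colimits :: "kind \<Rightarrow> 'u endo \<Rightarrow> bool" where
  "preserves_directed_colimits k F \<longleftrightarrow>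
     (\<forall>I D d C c. directed_diagram k I D d \<and> is_colimit k I D d C c \<longrightarrow>
        is_colimit k I (\<lambda>i. on_obj F (D i)) (\<lambda>i j. on_hom F (D i) (D j) (d i j))
          (on_obj F C) (\<lambda>i. on_hom F (D i) C (c i)))"

section \<open>Coinserters\<close>

definition is_coinserter ::
    "kind \<Rightarrow> 'u rel \<Rightarrow> 'u rel \<Rightarrow> ('u \<Rightarrow> 'u) \<Rightarrow> ('u \<Rightarrow> 'u) \<Rightarrow> 'u rel \<Rightarrow> ('u \<Rightarrow> 'u) \<Rightarrow> bool" where
  "is_coinserter k A B f0 f1 C c \<longleftrightarrow>
     A \<in> obj k \<and> B \<in> obj k \<and> C \<in> obj k \<and>
     f0 \<in> hom k A B \<and> f1 \<in> hom k A B \<and> c \<in> hom k B C \<and>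
     (compose (Field A) c f0, compose (Field A) c f1) \<in> hom_order k A C \<and>
     (\<forall>D\<in>obj k. \<forall>c'\<in>hom k B D.
        (compose (Field A) c' f0, compose (Field A) c' f1) \<in> hom_order k A D \<longrightarrow>
        (\<exists>h\<in>hom k C D. c' = compose (Field B) h c)) \<and>
     (\<forall>D\<in>obj k. \<forall>u\<in>hom k C D. \<forall>v\<in>hom k C D.
        (compose (Field B) u c, compose (Field B) v c) \<in> hom_order k B D \<longrightarrow>
        (u, v) \<in> hom_order k C D)"

definition reflexive_pair ::
    "kind \<Rightarrow> 'u rel \<Rightarrow> 'u rel \<Rightarrow> ('u \<Rightarrow> 'u) \<Rightarrow> ('u \<Rightarrow> 'u) \<Rightarrow> bool" where
  "reflexive_pair k A B f0 f1 \<longleftrightarrow>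
     (\<exists>d\<in>hom k B A. compose (Field B) f0 d = ident B \<and> compose (Field B) f1 d = ident B)"

definition preserves_coinserter ::
    "kind \<Rightarrow> 'u endo \<Rightarrow> 'u rel \<Rightarrow> 'u rel \<Rightarrow> ('u \<Rightarrow> 'u) \<Rightarrow> ('u \<Rightarrow> 'u) \<Rightarrow>
      'u rel \<Rightarrow> ('u \<Rightarrow> 'u) \<Rightarrow> bool" where
  "preserves_coinserter k F A B f0 f1 C c \<longleftrightarrow>
     is_coinserter k (on_obj F A) (on_obj F B) (on_hom F A B f0) (on_hom F A B f1)
       (on_obj F C) (on_hom F B C c)"

definition preserves_reflexive_coinserters :: "kind \<Rightarrow> 'u endo \<Rightarrow> bool" where
  "preserves_reflexive_coinserters k F \<longleftrightarrow>
     (\<forall>A B f0 f1 C c.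
        is_coinserter k A B f0 f1 C c \<and> reflexive_pair k A B f0 f1 \<longrightarrow>
        preserves_coinserter k F A B f0 f1 C c)"

definition preserves_reflexive_surjective_coinserters :: "kind \<Rightarrow> 'u endo \<Rightarrow> bool" where
  "preserves_reflexive_surjective_coinserters k F \<longleftrightarrow>
     (\<forall>A B f0 f1 C c.
        is_coinserter k A B f0 f1 C c \<and> reflexive_pair k A B f0 f1 \<and> c ` Field B = Field C \<longrightarrow>
        preserves_coinserter k F A B f0 f1 C c)"

end

theory Submission
  imports Defs
begin

text \<open>
  Both conditions are equivalent to the coend formula: for every \<open>C\<close>, morphisms \<open>F C \<rightarrow> X\<close> correspond
  to families \<open>\<theta> n : F n \<times> C\<^sup>n \<rightarrow> X\<close>, natural in the finite set \<open>n\<close>, via \<open>\<theta> n t f = h (F f t)\<close>.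
  Strong finitarity yields the formula by testing the universal property of \<open>F\<close> against the right Kan
  extensions \<open>A \<mapsto> [[A, C], X]\<close>; conversely \<open>\<sigma> : F K \<rightarrow> G K\<close> gives the family \<open>G f (\<sigma> n t)\<close> in \<open>G C\<close>.

  Directed colimits and reflexive coinserters are preserved by \<open>C \<mapsto> C\<^sup>n\<close>, hence by coends of
  \<open>F n \<times> C\<^sup>n\<close>. Conversely, suppose that \<open>F\<close> preserves directed colimits and reflexive surjective
  coinserters. The formula is trivial for finite discrete \<open>C\<close>. A finite poset \<open>P\<close> is the coinserter
  of its order relation on the discrete set \<open>P\<close>. The free completion of the underlying poset of \<open>C\<close>
  (its ideals generated by \<open>\<omega>\<close>-chains, resp. all its ideals) is the directed colimit of the finite
  subposets of \<open>C\<close>. Finally \<open>C\<close> is a reflexive coinserter of its free completion, because every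
  joinable subset of \<open>C\<close> lifts to principal ideals. The formula passes along each of these steps.
\<close>

section \<open>Joins\<close>

text \<open>The obstacle in the last step is that the comma object \<open>A\<close> of the quotient
  \<open>q : B -> C\<close> is an arbitrary object, for which the coend formula is not yet
  available. To factor a map \<open>e\<close> on \<open>F B\<close> through \<open>F q\<close>, the
  composites of \<open>e\<close> with both projections must be compared on \<open>F A\<close>; for
  this it suffices that \<open>F A\<close> is generated under joins by the points
  \<open>F f t\<close> with \<open>f\<close> a finite tuple. This half of the formula is inherited
  along every preserved coinserter without any knowledge of \<open>A\<close>. So it is obtained for
  all objects first and then fed back into the other half. Surjectivity of \<open>q\<close> serves
  to lift finite tuples from \<open>C\<close> to \<open>B\<close>. A general coinserter is merely
  dense (its image generates), which is why uniqueness is argued on generators throughout.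
  Reflexivity is used in the opposite direction. The inequations presenting a power of
  \<open>C\<close> change one coordinate at a time, and the common splitting supplies the
  coordinates that stay fixed. The closure of the universe under power sets makes
  \<open>[[A, C], X]\<close> and the set of ideals of \<open>C\<close> small again.\<close>

lemma Partial_orderI:
  assumes "\<And>x. x \<in> Field r \<Longrightarrow> (x, x) \<in> r"
    and "\<And>x y z. (x, y) \<in> r \<Longrightarrow> (y, z) \<in> r \<Longrightarrow> (x, z) \<in> r"
    and "\<And>x y. (x, y) \<in> r \<Longrightarrow> (y, x) \<in> r \<Longrightarrow> x = y"
  shows "Partial_order r"
  using assms unfolding partial_order_on_def preorder_on_def refl_on_def trans_def antisym_def
  by (auto intro: FieldI1 FieldI2)

lemma Partial_orderD:
  assumes "Partial_order r"
  shows po_refl: "x \<in> Field r \<Longrightarrow> (x, x) \<in> r"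
    and po_trans: "(x, y) \<in> r \<Longrightarrow> (y, z) \<in> r \<Longrightarrow> (x, z) \<in> r"
    and po_antisym: "(x, y) \<in> r \<Longrightarrow> (y, x) \<in> r \<Longrightarrow> x = y"
  using assms unfolding partial_order_on_def preorder_on_def refl_on_def trans_def antisym_def
  by blast+

lemma is_joinI:
  assumes "x \<in> Field r" "\<And>s. s \<in> S \<Longrightarrow> (s, x) \<in> r"
    and "\<And>y. y \<in> Field r \<Longrightarrow> (\<And>s. s \<in> S \<Longrightarrow> (s, y) \<in> r) \<Longrightarrow> (x, y) \<in> r"
  shows "is_join r S x"
  using assms unfolding is_join_def by blast

lemma is_joinD:
  assumes "is_join r S x"
  shows is_join_Field: "x \<in> Field r"
    and is_join_upper: "s \<in> S \<Longrightarrow> (s, x) \<in> r"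
    and is_join_least: "y \<in> Field r \<Longrightarrow> (\<And>s. s \<in> S \<Longrightarrow> (s, y) \<in> r) \<Longrightarrow> (x, y) \<in> r"
  using assms unfolding is_join_def by blast+

lemma is_join_unique: "Partial_order r \<Longrightarrow> is_join r S x \<Longrightarrow> is_join r S y \<Longrightarrow> x = y"
  by (meson is_join_def po_antisym)

lemma is_join_singleton: "Partial_order r \<Longrightarrow> x \<in> Field r \<Longrightarrow> is_join r {x} x"
  by (simp add: is_join_def po_refl)

lemma omega_chain_mono:
  assumes "Partial_order r" "\<And>n. (c n, c (Suc n)) \<in> r" "m \<le> n"
  shows "(c m, c n) \<in> r"
  using assms(3)
proof (induction n)
  case 0
  then show ?case using assms(1,2) po_refl by (metis FieldI1 le_zero_eq)
next
  case (Suc n)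
  then show ?case using assms(1,2) po_refl po_trans
    by (metis FieldI1 le_Suc_eq)
qed

text \<open>Most arguments use directedness alone and so treat both kinds at once; the kind matters
  again only where a set has to be shown joinable.\<close>

lemma joinable_directed:
  assumes "Partial_order r" "joinable k r S"
  shows "directed_in r S"
proof (cases k)
  case CPO
  with assms(2) obtain c where c: "\<And>n. (c n, c (Suc n)) \<in> r" "S = range c"
    by (auto simp: omega_chain_in_def)
  show ?thesis unfolding directed_in_def
  proof (intro conjI ballI)
    show "S \<subseteq> Field r" using c by (auto intro: FieldI1)
    show "S \<noteq> {}" using c by auto
    fix x y assume "x \<in> S" "y \<in> S"
    then obtain m n where "x = c m" "y = c n" using c by auto
    then show "\<exists>z\<in>S. (x, z) \<in> r \<and> (y, z) \<in> r"
      using omega_chain_mono[of r c, OF assms(1) c(1)] c(2)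
      by (intro bexI[of _ "c (max m n)"]) auto
  qed
qed (use assms in simp)

lemma directed_inD:
  assumes "directed_in r S"
  shows "S \<subseteq> Field r" "S \<noteq> {}" "x \<in> S \<Longrightarrow> y \<in> S \<Longrightarrow> \<exists>z\<in>S. (x, z) \<in> r \<and> (y, z) \<in> r"
  using assms unfolding directed_in_def by blast+

lemma joinable_image:
  assumes "\<And>x y. x \<in> S \<Longrightarrow> y \<in> S \<Longrightarrow> (x, y) \<in> r \<Longrightarrow> (f x, f y) \<in> s" "joinable k r S"
  shows "joinable k s (f ` S)"
proof (cases k)
  case CPO
  with assms(2) obtain c where c: "\<And>n. (c n, c (Suc n)) \<in> r" "S = range c"
    by (auto simp: omega_chain_in_def)
  have "\<forall>n. ((f \<circ> c) n, (f \<circ> c) (Suc n)) \<in> s" "f ` S = range (f \<circ> c)"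
    using assms(1) c by auto
  then show ?thesis unfolding CPO by (auto simp: omega_chain_in_def)
next
  case DCPO
  with assms(2) have d: "directed_in r S" by simp
  have "f ` S \<subseteq> Field s"
  proof
    fix y assume "y \<in> f ` S"
    then obtain x where x: "x \<in> S" "y = f x" by auto
    with d obtain z where "z \<in> S" "(x, z) \<in> r" unfolding directed_in_def by blast
    with x assms(1) show "y \<in> Field s" by (auto intro: FieldI1)
  qed
  with d show ?thesis unfolding DCPO using assms(1)
    by (auto simp: directed_in_def) (metis (no_types, lifting) subset_iff)
qed

lemma joinable_subset: "Partial_order r \<Longrightarrow> joinable k r S \<Longrightarrow> S \<subseteq> Field r"
  using joinable_directed directed_inD by blast

lemma joinable_nonempty: "Partial_order r \<Longrightarrow> joinable k r S \<Longrightarrow> S \<noteq> {}"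
  using joinable_directed directed_inD by blast

lemma joinable_singleton: "(x, x) \<in> r \<Longrightarrow> joinable k r {x}"
  by (cases k) (auto simp: omega_chain_in_def directed_in_def intro: FieldI1)

lemma directed_finite_upper:
  assumes "Partial_order r" "directed_in r S" "finite M" "M \<subseteq> S"
  shows "\<exists>z\<in>S. \<forall>x\<in>M. (x, z) \<in> r"
  using assms(3,4)
proof induction
  case empty
  then show ?case using assms(2) by (auto simp: directed_in_def)
next
  case (insert x M)
  then obtain z where z: "z \<in> S" "\<forall>x\<in>M. (x, z) \<in> r" by auto
  obtain w where "w \<in> S" "(x, w) \<in> r" "(z, w) \<in> r"
    using directed_inD(3)[OF assms(2)] z insert.prems by blast
  with z show ?case using po_trans[OF assms(1)] by blast
qed

text \<open>A finite directed set contains an upper bound of itself, so its join is attained. Hence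
  continuity on finite posets is just monotonicity.\<close>

lemma joinable_finite_max:
  assumes "Partial_order r" "joinable k r S" "finite S" "is_join r S x"
  shows "x \<in> S"
proof -
  from directed_finite_upper[OF assms(1) joinable_directed[OF assms(1,2)] assms(3) order_refl]
  obtain z where z: "z \<in> S" "\<forall>y\<in>S. (y, z) \<in> r" by blast
  then have "is_join r S z"
    using joinable_subset[OF assms(1,2)] by (intro is_joinI) auto
  with z assms show ?thesis using is_join_unique by metis
qed

lemma complete_posetD:
  assumes "complete_poset k r"
  shows complete_poset_po: "Partial_order r"
    and complete_poset_join: "joinable k r S \<Longrightarrow> \<exists>x. is_join r S x"
  using assms unfolding complete_poset_def by auto

lemma finite_complete_poset:
  assumes "Partial_order r" "finite (Field r)"
  shows "complete_poset k r"
  unfolding complete_poset_def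
proof (intro conjI allI impI)
  fix S assume S: "joinable k r S"
  have sub: "S \<subseteq> Field r" using joinable_subset[OF assms(1) S] .
  with assms(2) have "finite S" by (rule rev_finite_subset)
  from directed_finite_upper[OF assms(1) joinable_directed[OF assms(1) S] this order_refl]
  obtain z where z: "z \<in> S" "\<forall>y\<in>S. (y, z) \<in> r" by blast
  then have "is_join r S z"
    using sub by (intro is_joinI) auto
  then show "\<exists>x. is_join r S x" ..
qed (rule assms)

section \<open>Continuous maps\<close>

text \<open>Monotonicity already makes \<open>f x\<close> an upper bound of the image of
  \<open>S\<close>, so leastness is all that remains of the preservation of joins.\<close>

lemma continuous_mapI:
  assumes "\<And>x y. (x, y) \<in> r \<Longrightarrow> (f x, f y) \<in> s" "\<And>x. x \<in> Field r \<Longrightarrow> f x \<in> Field s"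
    and "\<And>S x y. joinable k r S \<Longrightarrow> is_join r S x \<Longrightarrow> y \<in> Field s \<Longrightarrow>
      (\<And>z. z \<in> S \<Longrightarrow> (f z, y) \<in> s) \<Longrightarrow> (f x, y) \<in> s"
  shows "continuous_map k r s f"
  unfolding continuous_map_def
proof (intro conjI allI impI; (elim conjE)?)
  fix S x assume Sx: "joinable k r S" "is_join r S x"
  show "is_join s (f ` S) (f x)"
    using Sx assms(1) assms(2) assms(3)[OF Sx]
    by (intro is_joinI) (auto dest: is_joinD)
qed (use assms in auto)

lemma continuous_mapD:
  assumes "continuous_map k r s f"
  shows continuous_map_Field: "x \<in> Field r \<Longrightarrow> f x \<in> Field s"
    and continuous_map_mono: "(x, y) \<in> r \<Longrightarrow> (f x, f y) \<in> s"
    and continuous_map_join: "joinable k r S \<Longrightarrow> is_join r S x \<Longrightarrow> is_join s (f ` S) (f x)"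
    and continuous_map_joinable: "joinable k r S \<Longrightarrow> joinable k s (f ` S)"
  using assms joinable_image[of S r f s k] unfolding continuous_map_def by auto

lemma continuous_map_compose:
  assumes "continuous_map k r s f" "continuous_map k s t g"
  shows "continuous_map k r t (\<lambda>x. g (f x))"
  unfolding continuous_map_def
proof (intro conjI allI impI; (elim conjE)?)
  fix S x assume Sx: "joinable k r S" "is_join r S x"
  show "is_join t ((\<lambda>x. g (f x)) ` S) (g (f x))"
    using continuous_map_join[OF assms(2) continuous_map_joinable[OF assms(1) Sx(1)]
        continuous_map_join[OF assms(1) Sx]]
    by (simp add: image_image)
qed (use assms in \<open>auto dest: continuous_mapD\<close>)

lemma continuous_map_cong:
  assumes "Partial_order r" "\<And>x. x \<in> Field r \<Longrightarrow> f x = g x"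
  shows "continuous_map k r s f \<longleftrightarrow> continuous_map k r s g"
proof -
  have *: "continuous_map k r s g" if c: "continuous_map k r s f"
    and eq: "\<And>x. x \<in> Field r \<Longrightarrow> f x = g x" for f g
    unfolding continuous_map_def
  proof (intro conjI allI impI; (elim conjE)?)
    fix S x assume Sx: "joinable k r S" "is_join r S x"
    have "g ` S = f ` S" using joinable_subset[OF assms(1) Sx(1)] eq by force
    then show "is_join s (g ` S) (g x)"
      using continuous_map_join[OF c Sx] eq[OF is_join_Field[OF Sx(2)]] by simp
  next
    fix x y assume "(x, y) \<in> r"
    then show "(g x, g y) \<in> s"
      using continuous_map_mono[OF c, of x y] eq[of x] eq[of y] FieldI1[of x y r] FieldI2[of x y r]
      by simp
  qed (use continuous_map_Field[OF c] eq in auto)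
  show ?thesis using *[of f g] *[of g f] assms(2) by auto
qed

lemma continuous_map_id: "continuous_map k r r (\<lambda>x. x)"
  by (auto simp: continuous_map_def)

lemma continuous_map_const:
  assumes "Partial_order r" "Partial_order s" "y \<in> Field s"
  shows "continuous_map k r s (\<lambda>_. y)"
  using assms by (intro continuous_mapI) (auto dest: po_refl joinable_nonempty)

lemma continuous_map_discrete:
  assumes "f \<in> n \<rightarrow> Field r" "Partial_order r"
  shows "continuous_map k (Id_on n) r f"
proof -
  have F: "Field (Id_on n) = n" by (auto simp: Field_def)
  have "Partial_order (Id_on n)" by (rule Partial_orderI) (auto simp: F)
  note j = joinable_directed[OF this]
  show ?thesis
  proof (rule continuous_mapI)
    fix S x y assume "joinable k (Id_on n) S" and x: "is_join (Id_on n) S x"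
      and y: "\<And>z. z \<in> S \<Longrightarrow> (f z, y) \<in> r"
    then obtain z where "z \<in> S" using j by (fastforce simp: directed_in_def)
    with x have "z = x" by (auto simp: is_join_def)
    with y \<open>z \<in> S\<close> show "(f x, y) \<in> r" by auto
  qed (use assms F po_refl[OF assms(2)] in auto)
qed

text \<open>
  That the image of a map generates its codomain takes the place of the map being an epimorphism.
\<close>

definition join_closed :: "kind \<Rightarrow> 'a rel \<Rightarrow> 'a set \<Rightarrow> bool" where
  "join_closed k r T \<longleftrightarrow> (\<forall>S x. S \<subseteq> T \<and> joinable k r S \<and> is_join r S x \<longrightarrow> x \<in> T)"

definition generates :: "kind \<Rightarrow> 'a rel \<Rightarrow> 'a set \<Rightarrow> bool" where
  "generates k r G \<longleftrightarrow> G \<subseteq> Field r \<and> (\<forall>T. G \<subseteq> T \<and> join_closed k r T \<longrightarrow> Field r \<subseteq> T)"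

lemma generates_induct [consumes 2, case_names gen join]:
  assumes "generates k r G" "x \<in> Field r"
    and "\<And>g. g \<in> G \<Longrightarrow> P g"
    and "\<And>S x. joinable k r S \<Longrightarrow> is_join r S x \<Longrightarrow> (\<And>s. s \<in> S \<Longrightarrow> P s) \<Longrightarrow> P x"
  shows "P x"
proof -
  have "join_closed k r {x. P x}" using assms(4) unfolding join_closed_def by blast
  then have "Field r \<subseteq> {x. P x}" using assms(1,3) unfolding generates_def by blast
  with assms(2) show ?thesis by auto
qed

lemma generatesI:
  assumes "G \<subseteq> Field r" "\<And>T x. G \<subseteq> T \<Longrightarrow> join_closed k r T \<Longrightarrow> x \<in> Field r \<Longrightarrow> x \<in> T"
  shows "generates k r G"
  using assms unfolding generates_def by blast

lemma generatesD: "generates k r G \<Longrightarrow> G \<subseteq> T \<Longrightarrow> join_closed k r T \<Longrightarrow> Field r \<subseteq> T"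
  by (simp add: generates_def)

lemma generates_subset: "generates k r G \<Longrightarrow> G \<subseteq> Field r"
  by (simp add: generates_def)

lemma generates_mono:
  assumes "generates k r G" "G \<subseteq> H" "H \<subseteq> Field r"
  shows "generates k r H"
  using assms unfolding generates_def by blast

lemma generates_UNIV: "generates k r (Field r)"
  by (simp add: generates_def)

lemma join_closedD: "join_closed k r T \<Longrightarrow> joinable k r S \<Longrightarrow> is_join r S x \<Longrightarrow> S \<subseteq> T \<Longrightarrow> x \<in> T"
  unfolding join_closed_def by blast

text \<open>The points with \<open>f x \<le> g x\<close> are closed under joins: \<open>f\<close>
  preserves the join, and \<open>g x\<close> lies above all values of \<open>g\<close> on the joined
  set. The inequational form is the one required by condition (b) of a coinserter.\<close>

lemma continuous_le_on_generators:
  assumes "generates k r G" "Partial_order s" "continuous_map k r s f" "continuous_map k r s g"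
    and "\<And>x. x \<in> G \<Longrightarrow> (f x, g x) \<in> s" "x \<in> Field r"
  shows "(f x, g x) \<in> s"
  using assms(1,6)
proof (induction rule: generates_induct)
  case (join S x)
  show ?case
  proof (rule is_join_least[OF continuous_map_join[OF assms(3) join(1,2)]])
    show "g x \<in> Field s" using is_join_Field[OF join(2)] assms(4) by (rule continuous_map_Field[rotated])
    fix y assume "y \<in> f ` S"
    then obtain z where z: "z \<in> S" "y = f z" by auto
    have "(g z, g x) \<in> s" using assms(4) join(2) z by (meson continuous_map_mono is_join_upper)
    with z join(3) show "(y, g x) \<in> s" using po_trans[OF assms(2)] by blast
  qed
qed (use assms in auto)

lemma continuous_eq_on_generators:
  assumes "generates k r G" "Partial_order s" "continuous_map k r s f" "continuous_map k r s g"
    and "\<And>x. x \<in> G \<Longrightarrow> f x = g x" "x \<in> Field r"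
  shows "f x = g x"
proof -
  have refl: "(f x, f x) \<in> s" if "x \<in> G" for x
    using po_refl[OF assms(2)] continuous_map_Field[OF assms(3)] generates_subset[OF assms(1)] that
    by blast
  have "(f x, g x) \<in> s"
    by (rule continuous_le_on_generators[OF assms(1,2,3,4) _ assms(6)]) (metis refl assms(5))
  moreover have "(g x, f x) \<in> s"
    by (rule continuous_le_on_generators[OF assms(1,2,4,3) _ assms(6)]) (metis refl assms(5))
  ultimately
  show ?thesis using po_antisym[OF assms(2)] by blast
qed

lemma join_closed_vimage:
  assumes "continuous_map k r s f" "join_closed k s T"
  shows "join_closed k r {x. f x \<in> T}"
  unfolding join_closed_def
  using join_closedD[OF assms(2) continuous_map_joinable[OF assms(1)] continuous_map_join[OF assms(1)]]
  by (auto simp: subset_iff)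

text \<open>Dense maps carry generating sets to generating sets, because preimages of join-closed
  sets are join-closed.\<close>

lemma generates_image:
  assumes "generates k r G" "continuous_map k r s f" "generates k s (f ` Field r)"
  shows "generates k s (f ` G)"
proof (rule generatesI)
  show "f ` G \<subseteq> Field s"
    using generates_subset[OF assms(1)] assms(2) by (auto intro: continuous_map_Field)
  fix T x assume T: "f ` G \<subseteq> T" "join_closed k s T" and x: "x \<in> Field s"
  have "Field r \<subseteq> {x. f x \<in> T}"
    using T(1) by (intro generatesD[OF assms(1) _ join_closed_vimage[OF assms(2) T(2)]]) auto
  then have "f ` Field r \<subseteq> T" by auto
  with generatesD[OF assms(3) _ T(2)] x show "x \<in> T" by auto
qed

section \<open>Function spaces\<close>

text \<open>Hom-posets between posets on possibly different types, as needed for iterated ones \<open>[[A, C], X]\<close>.\<close>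

definition cmaps :: "kind \<Rightarrow> 'a rel \<Rightarrow> 'b rel \<Rightarrow> ('a \<Rightarrow> 'b) set" where
  "cmaps k r s = {f \<in> extensional (Field r). continuous_map k r s f}"

definition cmaps_order :: "kind \<Rightarrow> 'a rel \<Rightarrow> 'b rel \<Rightarrow> ('a \<Rightarrow> 'b) rel" where
  "cmaps_order k r s = {(f, g). f \<in> cmaps k r s \<and> g \<in> cmaps k r s \<and> (\<forall>x\<in>Field r. (f x, g x) \<in> s)}"

lemma hom_eq_cmaps: "hom k A B = cmaps k A B"
  by (simp add: hom_def cmaps_def)

lemma hom_order_eq_cmaps_order: "hom_order k A B = cmaps_order k A B"
  by (simp add: hom_order_def cmaps_order_def hom_eq_cmaps)

lemma cmapsD:
  assumes "f \<in> cmaps k r s"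
  shows cmaps_continuous: "continuous_map k r s f" and cmaps_extensional: "f \<in> extensional (Field r)"
    and cmaps_Field: "x \<in> Field r \<Longrightarrow> f x \<in> Field s"
  using assms by (auto simp: cmaps_def continuous_map_def)

lemma cmaps_eqI:
  assumes "f \<in> cmaps k r s" "g \<in> cmaps k r s'" "\<And>x. x \<in> Field r \<Longrightarrow> f x = g x"
  shows "f = g"
  using assms by (meson cmaps_extensional extensionalityI)

lemma restrict_cmaps:
  assumes "Partial_order r" "continuous_map k r s f"
  shows "restrict f (Field r) \<in> cmaps k r s"
  using continuous_map_cong[OF assms(1), of f "restrict f (Field r)"] assms(2) by (simp add: cmaps_def)

lemma Field_cmaps_order [simp]:
  assumes "Partial_order s"
  shows "Field (cmaps_order k r s) = cmaps k r s"
proof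
  show "cmaps k r s \<subseteq> Field (cmaps_order k r s)"
  proof
    fix f assume f: "f \<in> cmaps k r s"
    then have "(f, f) \<in> cmaps_order k r s"
      using po_refl[OF assms] by (auto simp: cmaps_order_def dest: cmaps_Field)
    then show "f \<in> Field (cmaps_order k r s)" by (rule FieldI1)
  qed
qed (auto simp: cmaps_order_def Field_def)

lemma cmaps_order_Partial_order:
  assumes "Partial_order s"
  shows "Partial_order (cmaps_order k r s)"
proof (rule Partial_orderI)
  fix f assume "f \<in> Field (cmaps_order k r s)"
  then have "f \<in> cmaps k r s" using assms by simp
  then show "(f, f) \<in> cmaps_order k r s"
    using assms by (auto simp: cmaps_order_def intro: po_refl cmaps_Field)
next
  fix f g h assume "(f, g) \<in> cmaps_order k r s" "(g, h) \<in> cmaps_order k r s"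
  then show "(f, h) \<in> cmaps_order k r s"
    using po_trans[OF assms] unfolding cmaps_order_def by blast
next
  fix f g assume "(f, g) \<in> cmaps_order k r s" "(g, f) \<in> cmaps_order k r s"
  then show "f = g"
    using po_antisym[OF assms] unfolding cmaps_order_def by (auto intro: cmaps_eqI)
qed

lemma cmaps_order_joinI:
  assumes "S \<subseteq> cmaps k r s" "g \<in> cmaps k r s" "Partial_order s"
    and "\<And>x. x \<in> Field r \<Longrightarrow> is_join s ((\<lambda>f. f x) ` S) (g x)"
  shows "is_join (cmaps_order k r s) S g"
proof (rule is_joinI)
  show "g \<in> Field (cmaps_order k r s)" using assms by simp
  show "(f, g) \<in> cmaps_order k r s" if "f \<in> S" for f
    using that assms(1,2) is_join_upper[OF assms(4)] by (auto simp: cmaps_order_def)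
  fix h assume "h \<in> Field (cmaps_order k r s)" and h2: "\<And>f. f \<in> S \<Longrightarrow> (f, h) \<in> cmaps_order k r s"
  then have h: "h \<in> cmaps k r s" using assms(3) by simp
  have "(g x, h x) \<in> s" if "x \<in> Field r" for x
    using that h h2 by (intro is_join_least[OF assms(4)]) (auto simp: cmaps_order_def dest: cmaps_Field)
  with h assms(2) show "(g, h) \<in> cmaps_order k r s" by (auto simp: cmaps_order_def)
qed

lemma cmaps_order_joinable_eval:
  assumes "joinable k' (cmaps_order k r s) S" "x \<in> Field r"
  shows "joinable k' s ((\<lambda>f. f x) ` S)"
  using assms by (auto intro!: joinable_image[OF _ assms(1)] simp: cmaps_order_def)

text \<open>The pointwise join is continuous because two joins commute: both iterated joins have the
  same upper bounds.\<close>

lemma cmaps_order_join_exists: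
  assumes s: "complete_poset k s" and r: "Partial_order r" and S: "joinable k (cmaps_order k r s) S"
  shows "\<exists>g\<in>cmaps k r s. \<forall>x\<in>Field r. is_join s ((\<lambda>f. f x) ` S) (g x)"
proof -
  note po = complete_poset_po[OF s]
  have sub: "S \<subseteq> cmaps k r s"
    using joinable_subset[OF cmaps_order_Partial_order[OF po] S] po by simp
  have "\<forall>x\<in>Field r. \<exists>y. is_join s ((\<lambda>f. f x) ` S) y"
    using complete_poset_join[OF s cmaps_order_joinable_eval[OF S]] by blast
  then obtain g where g: "\<And>x. x \<in> Field r \<Longrightarrow> is_join s ((\<lambda>f. f x) ` S) (g x)" by metis
  have "continuous_map k r s g"
  proof (rule continuous_mapI)
    fix x y assume xy: "(x, y) \<in> r"
    then have F: "x \<in> Field r" "y \<in> Field r" by (auto intro: FieldI1 FieldI2)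
    show "(g x, g y) \<in> s"
    proof (rule is_join_least[OF g[OF F(1)] is_join_Field[OF g[OF F(2)]]])
      fix z assume "z \<in> (\<lambda>f. f x) ` S"
      then obtain f where f: "f \<in> S" "z = f x" by auto
      then have "(f x, f y) \<in> s" "(f y, g y) \<in> s"
        using sub xy by (auto intro: continuous_map_mono[OF cmaps_continuous] is_join_upper[OF g[OF F(2)]])
      then show "(z, g y) \<in> s" using f po_trans[OF po] by blast
    qed
  next
    fix x assume "x \<in> Field r" then show "g x \<in> Field s" using is_join_Field[OF g] by blast
  next
    fix S' x y assume S': "joinable k r S'" "is_join r S' x" and y: "y \<in> Field s"
      and le: "\<And>z. z \<in> S' \<Longrightarrow> (g z, y) \<in> s"
    show "(g x, y) \<in> s"
    proof (rule is_join_least[OF g[OF is_join_Field[OF S'(2)]] y])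
      fix w assume "w \<in> (\<lambda>f. f x) ` S"
      then obtain f where f: "f \<in> S" "w = f x" by auto
      then have c: "continuous_map k r s f" using sub by (auto intro: cmaps_continuous)
      have "(f x, y) \<in> s"
      proof (rule is_join_least[OF continuous_map_join[OF c S'] y])
        fix v assume "v \<in> f ` S'"
        then obtain z where z: "z \<in> S'" "v = f z" by auto
        then have "z \<in> Field r" using joinable_subset[OF r S'(1)] by auto
        from is_join_upper[OF g[OF this]] f have "(f z, g z) \<in> s" by auto
        with le z show "(v, y) \<in> s" using po_trans[OF po] by blast
      qed
      with f show "(w, y) \<in> s" by simp
    qed
  qed
  from restrict_cmaps[OF r this] g show ?thesis
    by (intro bexI[of _ "restrict g (Field r)"]) auto
qed

text \<open>The pointwise join is a join, and joins are unique. So nothing but pointwise joins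
  occurs in a hom-poset, and evaluation at a point is continuous.\<close>

lemma cmaps_order_joinD:
  assumes s: "complete_poset k s" and r: "Partial_order r" and S: "joinable k (cmaps_order k r s) S"
    and g: "is_join (cmaps_order k r s) S g" and x: "x \<in> Field r"
  shows "is_join s ((\<lambda>f. f x) ` S) (g x)"
proof -
  note po = complete_poset_po[OF s]
  obtain h where h: "h \<in> cmaps k r s" "\<And>x. x \<in> Field r \<Longrightarrow> is_join s ((\<lambda>f. f x) ` S) (h x)"
    using cmaps_order_join_exists[OF s r S] by blast
  have "is_join (cmaps_order k r s) S h"
    using joinable_subset[OF cmaps_order_Partial_order[OF po] S] po h by (intro cmaps_order_joinI) auto
  with g have "g = h" using is_join_unique[OF cmaps_order_Partial_order[OF po]] by blast
  with h x show ?thesis by simp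
qed

lemma cmaps_order_complete:
  assumes "complete_poset k s" "Partial_order r"
  shows "complete_poset k (cmaps_order k r s)"
  unfolding complete_poset_def
proof (intro conjI allI impI)
  note po = complete_poset_po[OF assms(1)]
  show "Partial_order (cmaps_order k r s)" by (rule cmaps_order_Partial_order[OF po])
  fix S assume S: "joinable k (cmaps_order k r s) S"
  from cmaps_order_join_exists[OF assms S] obtain g
    where "g \<in> cmaps k r s" "\<forall>x\<in>Field r. is_join s ((\<lambda>f. f x) ` S) (g x)" by blast
  then have "is_join (cmaps_order k r s) S g"
    using joinable_subset[OF cmaps_order_Partial_order[OF po] S] po by (intro cmaps_order_joinI) auto
  then show "\<exists>g. is_join (cmaps_order k r s) S g" by blast
qed

lemma cmaps_order_eval_continuous:
  assumes "complete_poset k s" "Partial_order r" "x \<in> Field r"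
  shows "continuous_map k (cmaps_order k r s) s (\<lambda>f. f x)"
  unfolding continuous_map_def
proof (intro conjI allI impI; (elim conjE)?)
  show "(\<lambda>f. f x) \<in> Field (cmaps_order k r s) \<rightarrow> Field s"
    using complete_poset_po[OF assms(1)] assms(3) by (auto dest: cmaps_Field)
  show "(f x, g x) \<in> s" if "(f, g) \<in> cmaps_order k r s" for f g
    using that assms(3) by (auto simp: cmaps_order_def)
qed (rule cmaps_order_joinD[OF assms(1,2) _ _ assms(3)])

text \<open>Currying: a map into a function space is continuous as soon as it is continuous in each
  of its two arguments.\<close>

lemma continuous_into_cmaps_orderI:
  assumes "complete_poset k s" "Partial_order r" "Partial_order q"
    and "\<And>z. z \<in> Field q \<Longrightarrow> f z \<in> cmaps k r s"
    and "\<And>x. x \<in> Field r \<Longrightarrow> continuous_map k q s (\<lambda>z. f z x)"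
  shows "continuous_map k q (cmaps_order k r s) f"
  unfolding continuous_map_def
proof (intro conjI allI impI; (elim conjE)?)
  note po = complete_poset_po[OF assms(1)]
  show "f \<in> Field q \<rightarrow> Field (cmaps_order k r s)" using assms(4) po by simp
  show "(f x, f y) \<in> cmaps_order k r s" if "(x, y) \<in> q" for x y
    using that assms(4) continuous_map_mono[OF assms(5)]
    by (auto simp: cmaps_order_def intro: FieldI1 FieldI2)
  fix S z assume S: "joinable k q S" "is_join q S z"
  show "is_join (cmaps_order k r s) (f ` S) (f z)"
  proof (rule cmaps_order_joinI)
    show "f ` S \<subseteq> cmaps k r s" "f z \<in> cmaps k r s"
      using assms(4) joinable_subset[OF assms(3) S(1)] is_join_Field[OF S(2)] by auto
    fix x assume "x \<in> Field r"
    from continuous_map_join[OF assms(5)[OF this] S]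
    show "is_join s ((\<lambda>f. f x) ` f ` S) (f z x)" by (simp add: image_image)
  qed (rule po)
qed

section \<open>Small posets\<close>

lemma universe_infinite:
  assumes "universe TYPE('u)"
  shows "infinite (UNIV :: 'u set)"
  using assms unfolding universe_def
  by (meson infinite_le_lepoll lesspoll_imp_lepoll)

lemma finite_lesspoll_universe:
  assumes "universe TYPE('u)" "finite A"
  shows "A \<prec> (UNIV :: 'u set)"
  using finite_lesspoll_infinite[OF universe_infinite[OF assms(1)] assms(2)] .

lemma lesspoll_subset: "A \<prec> C \<Longrightarrow> B \<subseteq> A \<Longrightarrow> B \<prec> C"
  by (meson lesspoll_trans1 subset_imp_lepoll)

lemma lesspoll_image: "A \<prec> C \<Longrightarrow> f ` A \<prec> C"
  by (meson image_lepoll lesspoll_trans1)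

lemma lesspoll_universe_Pow:
  assumes "universe TYPE('u)" "A \<prec> (UNIV :: 'u set)"
  shows "Pow A \<prec> (UNIV :: 'u set)"
proof -
  obtain f :: "_ \<Rightarrow> 'u" where f: "inj_on f A"
    using lesspoll_imp_lepoll[OF assms(2)] unfolding lepoll_def by blast
  have "small (f ` A)" using lesspoll_image[OF assms(2)] by (simp add: small_def)
  then have "Pow (f ` A) \<prec> (UNIV :: 'u set)" using assms(1) by (simp add: universe_def)
  moreover have "Pow A \<lesssim> Pow (f ` A)"
    unfolding lepoll_def using inj_on_image_Pow[OF f] by blast
  ultimately show ?thesis by (rule lesspoll_trans1[rotated])
qed

lemma lepoll_linear: "A \<lesssim> B \<or> B \<lesssim> A"
  unfolding lepoll_def card_of_ordLeq by (rule ordLeq_total) (simp_all add: card_of_Well_order)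

text \<open>A product is dominated by the square of its larger factor; an infinite set dominates its
  own square, and finite sets are small because the universe is infinite.\<close>

lemma lesspoll_universe_Times:
  assumes "universe TYPE('u)" "A \<prec> (UNIV :: 'u set)" "B \<prec> (UNIV :: 'u set)"
  shows "A \<times> B \<prec> (UNIV :: 'u set)"
proof -
  have *: "M \<times> N \<prec> (UNIV :: 'u set)" if M: "M \<prec> (UNIV :: 'u set)" and N: "N \<lesssim> M"
    for M :: "'x set" and N :: "'y set"
  proof (cases "finite M")
    case True
    with N have "finite N" using finite_lepoll_infinite lepoll_antisym eqpoll_finite_iff by metis
    with True show ?thesis by (intro finite_lesspoll_universe[OF assms(1)]) simp
  next
    case False
    have "M \<times> N \<lesssim> M \<times> M" using N by (intro times_lepoll_mono lepoll_refl)
    also have "M \<times> M \<lesssim> M"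
      using card_of_Times_same_infinite[OF False] unfolding lepoll_def card_of_ordLeq
      by (rule ordIso_imp_ordLeq)
    finally show ?thesis using M by (rule lesspoll_trans1)
  qed
  show ?thesis
  proof (cases "B \<lesssim> A")
    case True
    then show ?thesis using *[OF assms(2)] by blast
  next
    case False
    then have "B \<times> A \<prec> (UNIV :: 'u set)" using *[OF assms(3)] lepoll_linear by blast
    moreover have "A \<times> B = prod.swap ` (B \<times> A)" by auto
    ultimately show ?thesis by (simp only: lesspoll_image)
  qed
qed

text \<open>Functions are coded by their graphs, which are subsets of the product; this reduces
  function sets to the strong limit property.\<close>

lemma lesspoll_universe_PiE:
  assumes "universe TYPE('u)" "A \<prec> (UNIV :: 'u set)" "B \<prec> (UNIV :: 'u set)"
  shows "(A \<rightarrow>\<^sub>E B) \<prec> (UNIV :: 'u set)"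
proof -
  have "inj_on (\<lambda>f. (\<lambda>x. (x, f x)) ` A) (A \<rightarrow>\<^sub>E B)"
  proof (rule inj_onI)
    fix f g assume fg: "f \<in> A \<rightarrow>\<^sub>E B" "g \<in> A \<rightarrow>\<^sub>E B" "(\<lambda>x. (x, f x)) ` A = (\<lambda>x. (x, g x)) ` A"
    show "f = g"
    proof (rule PiE_ext[OF fg(1,2)])
      fix x assume "x \<in> A"
      then have "(x, f x) \<in> (\<lambda>x. (x, g x)) ` A" unfolding fg(3)[symmetric] by blast
      then show "f x = g x" by auto
    qed
  qed
  moreover have "(\<lambda>f. (\<lambda>x. (x, f x)) ` A) ` (A \<rightarrow>\<^sub>E B) \<subseteq> Pow (A \<times> B)" by auto
  ultimately have "(A \<rightarrow>\<^sub>E B) \<lesssim> Pow (A \<times> B)" unfolding lepoll_def by blast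
  then show ?thesis
    using lesspoll_universe_Pow[OF assms(1) lesspoll_universe_Times[OF assms]]
    by (rule lesspoll_trans1)
qed

lemma cmaps_lesspoll:
  assumes "universe TYPE('u)" "Field r \<prec> (UNIV :: 'u set)" "Field s \<prec> (UNIV :: 'u set)"
  shows "cmaps k r s \<prec> (UNIV :: 'u set)"
proof (rule lesspoll_subset[OF lesspoll_universe_PiE[OF assms]])
  show "cmaps k r s \<subseteq> (Field r \<rightarrow>\<^sub>E Field s)"
    by (auto simp: PiE_def dest: cmaps_Field cmaps_extensional)
qed

lemma objD:
  fixes A :: "'u rel"
  assumes "A \<in> obj k"
  shows obj_complete: "complete_poset k A" and obj_po: "Partial_order A"
    and obj_small: "Field A \<prec> (UNIV :: 'u set)"
  using assms complete_poset_po[of k A] unfolding obj_def small_def by auto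

lemma objI: "complete_poset k A \<Longrightarrow> Field A \<prec> (UNIV :: 'u set) \<Longrightarrow> A \<in> obj k" for A :: "'u rel"
  by (simp add: obj_def small_def)

text \<open>An order isomorphism preserves every existing join, since upper bounds can be pulled
  back along the inverse. Applied to the coding in both directions.\<close>

lemma order_iso_continuous:
  assumes "\<And>x y. (x, y) \<in> r \<Longrightarrow> (f x, f y) \<in> s" "\<And>x y. (x, y) \<in> s \<Longrightarrow> (g x, g y) \<in> r"
    and "\<And>x. x \<in> Field r \<Longrightarrow> g (f x) = x" "\<And>y. y \<in> Field s \<Longrightarrow> f (g y) = y"
    and "Partial_order r"
  shows "continuous_map k r s f"
proof (rule continuous_mapI[OF assms(1)])
  have F: "x \<in> Field r \<Longrightarrow> f x \<in> Field s" for x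
    using po_refl[OF assms(5)] assms(1) by (metis FieldI1)
  then show "x \<in> Field r \<Longrightarrow> f x \<in> Field s" for x .
  fix S x y assume S: "joinable k r S" "is_join r S x" "y \<in> Field s" "\<And>z. z \<in> S \<Longrightarrow> (f z, y) \<in> s"
  have "(x, g y) \<in> r"
  proof (rule is_join_least[OF S(2)])
    show "(z, g y) \<in> r" if "z \<in> S" for z
      using assms(2)[OF S(4)[OF that]] assms(3) joinable_subset[OF assms(5) S(1)] that by auto
    \<comment> \<open>\<open>g\<close> is only known to be monotone, so \<open>g y\<close> is placed
      in the field by lying above some element of the nonempty \<open>S\<close>.\<close>
    then show "g y \<in> Field r" using joinable_nonempty[OF assms(5) S(1)] by (auto intro: FieldI2)
  qed
  then show "(f x, y) \<in> s" using assms(1)[of x "g y"] assms(4)[OF S(3)] by simp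
qed

section \<open>Copies of small posets inside the universe\<close>

definition encode :: "'b rel \<Rightarrow> 'b \<Rightarrow> 'u" where
  "encode r = (SOME f. inj_on f (Field r))"

definition decode :: "'b rel \<Rightarrow> 'u \<Rightarrow> 'b" where
  "decode r = inv_into (Field r) (encode r)"

definition coded :: "'b rel \<Rightarrow> 'u rel" where
  "coded r = {(encode r x, encode r y) |x y. (x, y) \<in> r}"

context
  fixes r :: "'b rel"
  assumes small: "Field r \<prec> (UNIV :: 'u set)"
begin

lemma encode_inj: "inj_on (encode r :: 'b \<Rightarrow> 'u) (Field r)"
proof -
  have "\<exists>f :: 'b \<Rightarrow> 'u. inj_on f (Field r)"
    using lesspoll_imp_lepoll[OF small] unfolding lepoll_def by blast
  then show ?thesis unfolding encode_def by (rule someI_ex)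
qed

lemma decode_encode [simp]: "x \<in> Field r \<Longrightarrow> decode r (encode r x :: 'u) = x"
  unfolding decode_def by (rule inv_into_f_f[OF encode_inj])

lemma Field_coded: "Field (coded r :: 'u rel) = encode r ` Field r"
  unfolding coded_def Field_def by blast

lemma coded_decode: "(x, y :: 'u) \<in> coded r \<Longrightarrow> (decode r x, decode r y) \<in> r"
  unfolding coded_def by (auto simp: FieldI1 FieldI2)

lemma decode_Field: "x \<in> Field (coded r :: 'u rel) \<Longrightarrow> decode r x \<in> Field r"
  unfolding Field_coded by auto

lemma encode_decode [simp]: "x \<in> Field (coded r :: 'u rel) \<Longrightarrow> encode r (decode r x) = x"
  unfolding Field_coded by auto

lemma encode_Field: "x \<in> Field r \<Longrightarrow> encode r x \<in> Field (coded r :: 'u rel)"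
  unfolding Field_coded by auto

lemma encode_mono: "(x, y) \<in> r \<Longrightarrow> (encode r x, encode r y :: 'u) \<in> coded r"
  unfolding coded_def by blast

lemma coded_Partial_order:
  assumes "Partial_order r"
  shows "Partial_order (coded r :: 'u rel)"
proof (rule Partial_orderI)
  fix x y z :: 'u
  show "(x, x) \<in> coded r" if "x \<in> Field (coded r)"
    using that po_refl[OF assms] unfolding Field_coded by (auto intro: encode_mono)
  show "(x, z) \<in> coded r" if "(x, y) \<in> coded r" "(y, z) \<in> coded r"
  proof -
    have "(encode r (decode r x), encode r (decode r z) :: 'u) \<in> coded r"
      using coded_decode that by (blast intro: encode_mono po_trans[OF assms])
    with that show ?thesis by (simp add: FieldI1 FieldI2)
  qed
  show "x = y" if "(x, y) \<in> coded r" "(y, x) \<in> coded r"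
  proof -
    have "decode r x = decode r y" using coded_decode that by (blast intro: po_antisym[OF assms])
    then have "encode r (decode r x) = (encode r (decode r y) :: 'u)" by simp
    with that show ?thesis by (simp only: encode_decode FieldI1 FieldI2)
  qed
qed

lemma encode_continuous:
  assumes "Partial_order r"
  shows "continuous_map k r (coded r :: 'u rel) (encode r)"
  by (rule order_iso_continuous[where g = "decode r"])
    (use assms in \<open>auto intro: encode_mono coded_decode\<close>)

lemma decode_continuous:
  assumes "Partial_order r"
  shows "continuous_map k (coded r :: 'u rel) r (decode r)"
  by (rule order_iso_continuous[where g = "encode r"])
    (use coded_Partial_order[OF assms] in \<open>auto intro: encode_mono coded_decode\<close>)

text \<open>Joins are computed by decoding, joining in \<open>r\<close> and encoding again. This
  makes posets of pairs, ideals and iterated function spaces available as objects.\<close>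

lemma coded_obj:
  assumes "complete_poset k r"
  shows "(coded r :: 'u rel) \<in> obj k"
proof (rule objI)
  note po = complete_poset_po[OF assms]
  show "complete_poset k (coded r :: 'u rel)"
    unfolding complete_poset_def
  proof (intro conjI allI impI)
    show po': "Partial_order (coded r :: 'u rel)" by (rule coded_Partial_order[OF po])
    fix S :: "'u set" assume S: "joinable k (coded r) S"
    from complete_poset_join[OF assms continuous_map_joinable[OF decode_continuous[OF po] S]]
    obtain x where x: "is_join r (decode r ` S) x" by blast
    have "encode r ` decode r ` S = S"
      using joinable_subset[OF po' S] by (force simp: image_image)
    with continuous_map_join[OF encode_continuous[OF po]
        continuous_map_joinable[OF decode_continuous[OF po] S] x]
    show "\<exists>x. is_join (coded r) S x" by auto
  qed
  show "Field (coded r :: 'u rel) \<prec> (UNIV :: 'u set)"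
    unfolding Field_coded by (rule lesspoll_image[OF small])
qed

end

section \<open>Join-closed subposets\<close>

lemma Field_Restr:
  assumes "Partial_order r" "T \<subseteq> Field r"
  shows "Field (Restr r T) = T"
  using assms po_refl[OF assms(1)] by (fastforce simp: Field_def)

lemma Restr_Partial_order:
  assumes "Partial_order r"
  shows "Partial_order (Restr r T)"
proof (rule Partial_orderI)
  fix x assume "x \<in> Field (Restr r T)"
  then have "x \<in> Field r" "x \<in> T" by (auto simp: Field_def)
  then show "(x, x) \<in> Restr r T" using po_refl[OF assms] by simp
next
  show "(x, z) \<in> Restr r T" if "(x, y) \<in> Restr r T" "(y, z) \<in> Restr r T" for x y z
    using that po_trans[OF assms, of x y z] by simp
  show "x = y" if "(x, y) \<in> Restr r T" "(y, x) \<in> Restr r T" for x y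
    using that po_antisym[OF assms] by simp
qed

lemma Restr_join:
  assumes "Partial_order r" "T \<subseteq> Field r" "S \<subseteq> T" "x \<in> T" "is_join r S x"
  shows "is_join (Restr r T) S x"
  using assms Field_Restr[OF assms(1,2)] unfolding is_join_def by blast

lemma Restr_joinable: "joinable k (Restr r T) S \<Longrightarrow> joinable k r S"
  using joinable_image[of S "Restr r T" "\<lambda>x. x" r k] by simp

lemma Restr_obj:
  fixes A :: "'u rel"
  assumes "A \<in> obj k" "join_closed k A T" "T \<subseteq> Field A"
  shows "Restr A T \<in> obj k"
proof (rule objI)
  note po = obj_po[OF assms(1)]
  show "complete_poset k (Restr A T)"
    unfolding complete_poset_def
  proof (intro conjI allI impI)
    show "Partial_order (Restr A T)" by (rule Restr_Partial_order[OF po])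
    fix S assume S: "joinable k (Restr A T) S"
    then have ST: "S \<subseteq> T"
      using joinable_subset[OF Restr_Partial_order[OF po]] Field_Restr[OF po assms(3)] by blast
    obtain x where x: "is_join A S x"
      using complete_poset_join[OF obj_complete[OF assms(1)] Restr_joinable[OF S]] by blast
    with join_closedD[OF assms(2) Restr_joinable[OF S] _ ST] have "x \<in> T" by blast
    with Restr_join[OF po assms(3) ST _ x] show "\<exists>x. is_join (Restr A T) S x" by blast
  qed
  show "Field (Restr A T) \<prec> (UNIV :: 'u set)"
    using Field_Restr[OF po assms(3)] lesspoll_subset[OF obj_small[OF assms(1)] assms(3)] by simp
qed

text \<open>The join taken in \<open>A\<close> falls into \<open>T\<close>, hence it is also the
  join in the subposet; by uniqueness the two joins coincide.\<close>

lemma Restr_inclusion_continuous: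
  assumes "A \<in> obj k" "join_closed k A T" "T \<subseteq> Field A"
  shows "continuous_map k (Restr A T) A (\<lambda>x. x)"
proof (rule continuous_mapI)
  note po = obj_po[OF assms(1)] and F = Field_Restr[OF obj_po[OF assms(1)] assms(3)]
  fix S x y assume S: "joinable k (Restr A T) S" "is_join (Restr A T) S x" "y \<in> Field A"
    and y: "\<And>z. z \<in> S \<Longrightarrow> (z, y) \<in> A"
  have ST: "S \<subseteq> T" using joinable_subset[OF Restr_Partial_order[OF po] S(1)] F by blast
  obtain z where z: "is_join A S z"
    using complete_poset_join[OF obj_complete[OF assms(1)] Restr_joinable[OF S(1)]] by blast
  have "z \<in> T" using join_closedD[OF assms(2) Restr_joinable[OF S(1)] z ST] .
  then have "x = z"
    using is_join_unique[OF Restr_Partial_order[OF po] S(2) Restr_join[OF po assms(3) ST _ z]] by blast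
  then show "(x, y) \<in> A" using is_join_least[OF z S(3) y] by simp
qed (use Field_Restr[OF obj_po[OF assms(1)] assms(3)] assms(3) in auto)

lemma Restr_corestrict_continuous:
  assumes "continuous_map k q r f" "Partial_order q" "Partial_order r" "T \<subseteq> Field r"
    and "\<And>x. x \<in> Field q \<Longrightarrow> f x \<in> T"
  shows "continuous_map k q (Restr r T) f"
  unfolding continuous_map_def
proof (intro conjI allI impI; (elim conjE)?)
  show "f \<in> Field q \<rightarrow> Field (Restr r T)" using Field_Restr[OF assms(3,4)] assms(5) by auto
  show "(f x, f y) \<in> Restr r T" if "(x, y) \<in> q" for x y
    using continuous_map_mono[OF assms(1) that] that assms(5) by (auto intro: FieldI1 FieldI2)
  fix S x assume S: "joinable k q S" "is_join q S x"
  show "is_join (Restr r T) (f ` S) (f x)"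
    using joinable_subset[OF assms(2) S(1)] is_join_Field[OF S(2)] assms(5)
    by (intro Restr_join[OF assms(3,4) _ _ continuous_map_join[OF assms(1) S]]) auto
qed

text \<open>In applications \<open>h\<close> comes from a universal property of \<open>A\<close>, applied to the subobject \<open>T\<close>.\<close>

lemma generatesI_subobject:
  assumes "A \<in> obj k" "G \<subseteq> Field A"
    and "\<And>T. G \<subseteq> T \<Longrightarrow> T \<subseteq> Field A \<Longrightarrow> Restr A T \<in> obj k \<Longrightarrow>
      continuous_map k (Restr A T) A (\<lambda>x. x) \<Longrightarrow> Field (Restr A T) = T \<Longrightarrow>
      \<exists>h. continuous_map k A (Restr A T) h \<and> (\<forall>x\<in>Field A. h x = x)"
  shows "generates k A G"
proof (rule generatesI[OF assms(2)])
  fix T x assume T: "G \<subseteq> T" "join_closed k A T" and x: "x \<in> Field A"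
  \<comment> \<open>Join-closed sets may contain elements outside the carrier, while a subobject
    must lie inside it.\<close>
  let ?T = "T \<inter> Field A"
  have "join_closed k A ?T"
    using T(2) unfolding join_closed_def by (auto dest: is_join_Field)
  note c = this Int_lower2[of T "Field A"]
  obtain h where "continuous_map k A (Restr A ?T) h" "\<And>x. x \<in> Field A \<Longrightarrow> h x = x"
    using assms(3)[OF _ _ Restr_obj[OF assms(1) c] Restr_inclusion_continuous[OF assms(1) c]]
      Field_Restr[OF obj_po[OF assms(1)] c(2)] T(1) assms(2) by blast
  with x Field_Restr[OF obj_po[OF assms(1)] c(2)] show "x \<in> T"
    using continuous_map_Field[of k A "Restr A ?T" h x] by auto
qed

lemma ident_hom: "Partial_order A \<Longrightarrow> ident A \<in> hom k A A"
  unfolding ident_def hom_eq_cmaps by (rule restrict_cmaps[OF _ continuous_map_id])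

lemma compose_hom:
  assumes "f \<in> hom k A B" "g \<in> hom k B C" "Partial_order A"
  shows "compose (Field A) g f \<in> hom k A C"
  unfolding hom_eq_cmaps compose_def
  using assms by (intro restrict_cmaps continuous_map_compose[OF cmaps_continuous cmaps_continuous])
    (auto simp: hom_eq_cmaps)

section \<open>Comma objects\<close>

text \<open>The pairs \<open>(x, y)\<close> with \<open>q x \<le> q y\<close>, ordered componentwise
  and then coded into the universe; the diagonal is the common splitting of the projections. The
  last clause says that the projections jointly reflect the order, from which the comma object of a
  discrete poset will be seen to be discrete.\<close>

lemma comma_object:
  fixes B C :: "'u rel"
  assumes U: "universe TYPE('u)" and B: "B \<in> obj k" and C: "C \<in> obj k" and q: "q \<in> hom k B C"
  shows "\<exists>A\<in>(obj k :: 'u rel set). \<exists>p0\<in>hom k A B. \<exists>p1\<in>hom k A B. reflexive_pair k A B p0 p1 \<and>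
    (\<forall>a\<in>Field A. (q (p0 a), q (p1 a)) \<in> C) \<and>
    (\<forall>x\<in>Field B. \<forall>y\<in>Field B. (q x, q y) \<in> C \<longrightarrow> (\<exists>a\<in>Field A. p0 a = x \<and> p1 a = y)) \<and>
    (\<forall>a\<in>Field A. \<forall>a'\<in>Field A. (p0 a, p0 a') \<in> B \<and> (p1 a, p1 a') \<in> B \<longrightarrow> (a, a') \<in> A)"
proof -
  define M where "M = {(x, y). x \<in> Field B \<and> y \<in> Field B \<and> (q x, q y) \<in> C}"
  define R where "R = {(p, p'). p \<in> M \<and> p' \<in> M \<and> (fst p, fst p') \<in> B \<and> (snd p, snd p') \<in> B}"
  note pB = obj_po[OF B] and cB = obj_complete[OF B]
  have cq: "continuous_map k B C q" using q by (simp add: hom_eq_cmaps cmaps_continuous)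
  have refl: "(p, p) \<in> R" if "p \<in> M" for p
    using that po_refl[OF pB] by (auto simp: R_def M_def)
  have F: "Field R = M"
  proof
    show "M \<subseteq> Field R" using refl by (blast intro: FieldI1)
  qed (auto simp: R_def Field_def)
  have pR: "Partial_order R"
  proof (rule Partial_orderI)
    show "(x, z) \<in> R" if "(x, y) \<in> R" "(y, z) \<in> R" for x y z
      using that po_trans[OF pB] unfolding R_def by blast
    show "x = y" if "(x, y) \<in> R" "(y, x) \<in> R" for x y
      using that po_antisym[OF pB] unfolding R_def by (auto simp: prod_eq_iff)
  qed (use refl F in auto)
  have proj: "joinable k B (fst ` S)" "joinable k B (snd ` S)" if "joinable k R S" for S
    using joinable_image[of S R fst B k] joinable_image[of S R snd B k] that by (auto simp: R_def)
  have join: "is_join R S (x, y)" if S: "joinable k R S" and x: "is_join B (fst ` S) x"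
    and y: "is_join B (snd ` S) y" for S x y
  proof -
    have SM: "S \<subseteq> M" using joinable_subset[OF pR S] F by simp
    \<comment> \<open>The componentwise join stays in \<open>M\<close>: \<open>q\<close> preserves
      the join of the first components, all of whose images lie below \<open>q y\<close>.\<close>
    have "(q x, q y) \<in> C"
    proof (rule is_join_least[OF continuous_map_join[OF cq proj(1)[OF S] x]])
      show "q y \<in> Field C" using continuous_map_Field[OF cq is_join_Field[OF y]] .
      fix z assume "z \<in> q ` fst ` S"
      then obtain p where p: "p \<in> S" "z = q (fst p)" by auto
      have "(q (fst p), q (snd p)) \<in> C" using p SM by (auto simp: M_def)
      moreover have "(q (snd p), q y) \<in> C"
        using is_join_upper[OF continuous_map_join[OF cq proj(2)[OF S] y]] p by auto
      ultimately show "(z, q y) \<in> C" using p po_trans[OF obj_po[OF C]] by blast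
    qed
    then have m: "(x, y) \<in> M" using is_join_Field x y by (auto simp: M_def)
    show ?thesis
    proof (rule is_joinI)
      show "(p, (x, y)) \<in> R" if "p \<in> S" for p
        using that SM m is_join_upper[OF x] is_join_upper[OF y] by (auto simp: R_def)
      fix p assume p: "p \<in> Field R" "\<And>s. s \<in> S \<Longrightarrow> (s, p) \<in> R"
      have "(x, fst p) \<in> B" "(y, snd p) \<in> B"
        using p F by (intro is_join_least[OF x] is_join_least[OF y]; auto simp: R_def M_def)+
      with p m F show "((x, y), p) \<in> R" by (auto simp: R_def)
    qed (use m F in simp)
  qed
  have cR: "complete_poset k R"
    unfolding complete_poset_def
    using pR join complete_poset_join[OF cB proj(1)] complete_poset_join[OF cB proj(2)] by blast
  \<comment> \<open>Componentwise joins exist and are joins in \<open>R\<close>; by uniqueness every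
    join of a joinable set in \<open>R\<close> is of this form.\<close>
  have cont: "continuous_map k R B fst" "continuous_map k R B snd"
  proof -
    have *: "is_join B (fst ` S) (fst p) \<and> is_join B (snd ` S) (snd p)"
      if S: "joinable k R S" and p: "is_join R S p" for S p
    proof -
      obtain x y where xy: "is_join B (fst ` S) x" "is_join B (snd ` S) y"
        using complete_poset_join[OF cB proj(1)[OF S]] complete_poset_join[OF cB proj(2)[OF S]] by blast
      then have "p = (x, y)" using is_join_unique[OF pR p join[OF S]] by blast
      with xy show ?thesis by simp
    qed
    show "continuous_map k R B fst" "continuous_map k R B snd"
      using * unfolding continuous_map_def F by (auto simp: M_def R_def)
  qed
  have "M \<subseteq> Field B \<times> Field B" by (auto simp: M_def)
  then have small: "Field R \<prec> (UNIV :: 'u set)"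
    using lesspoll_subset[OF lesspoll_universe_Times[OF U obj_small[OF B] obj_small[OF B]]] F by simp
  define A where "A = (coded R :: 'u rel)"
  have A: "A \<in> obj k" unfolding A_def by (rule coded_obj[OF small cR])
  note pA = obj_po[OF A]
  define p0 where "p0 = restrict (\<lambda>a. fst (decode R a)) (Field A)"
  define p1 where "p1 = restrict (\<lambda>a. snd (decode R a)) (Field A)"
  note dec = decode_continuous[OF small pR, of k, folded A_def]
  have p: "p0 \<in> hom k A B" "p1 \<in> hom k A B"
    unfolding p0_def p1_def hom_eq_cmaps
    using continuous_map_compose[OF dec cont(1)] continuous_map_compose[OF dec cont(2)]
    by (auto intro: restrict_cmaps[OF pA])
  have M: "decode R a \<in> M" if "a \<in> Field A" for a
    using decode_Field[OF small] that F unfolding A_def by blast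
  have enc: "encode R m \<in> Field A \<and> p0 (encode R m) = fst m \<and> p1 (encode R m) = snd m" if "m \<in> M" for m
    using that encode_Field[OF small] decode_encode[OF small] F unfolding A_def p0_def p1_def by auto
  define d where "d = restrict (\<lambda>x. encode R (x, x) :: 'u) (Field B)"
  have diag: "(x, x) \<in> M" if "x \<in> Field B" for x
    using that po_refl[OF obj_po[OF C]] continuous_map_Field[OF cq] by (auto simp: M_def)
  have "continuous_map k B R (\<lambda>x. (x, x))"
    unfolding continuous_map_def
  proof (intro conjI allI impI; (elim conjE)?)
    show "(\<lambda>x. (x, x)) \<in> Field B \<rightarrow> Field R" using diag F by auto
    show *: "((x, x), (y, y)) \<in> R" if "(x, y) \<in> B" for x y
      using that diag by (auto simp: R_def intro: FieldI1 FieldI2)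
    fix S x assume S: "joinable k B S" "is_join B S x"
    show "is_join R ((\<lambda>x. (x, x)) ` S) (x, x)"
      using S * by (intro join joinable_image[OF _ S(1)]) (auto simp: image_image)
  qed
  from continuous_map_compose[OF this encode_continuous[OF small pR]]
  have d: "d \<in> hom k B A"
    unfolding d_def hom_eq_cmaps A_def by (rule restrict_cmaps[OF pB])
  have "compose (Field B) p0 d = ident B" "compose (Field B) p1 d = ident B"
    unfolding compose_def ident_def
    by (rule restrict_ext; simp add: d_def enc[OF diag])+
  with d have "reflexive_pair k A B p0 p1" unfolding reflexive_pair_def by blast
  moreover have "\<forall>a\<in>Field A. (q (p0 a), q (p1 a)) \<in> C"
    using M by (auto simp: p0_def p1_def M_def case_prod_beta)
  moreover have "\<forall>x\<in>Field B. \<forall>y\<in>Field B. (q x, q y) \<in> C \<longrightarrow> (\<exists>a\<in>Field A. p0 a = x \<and> p1 a = y)"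
    using enc unfolding M_def by force
  moreover have "(a, a') \<in> A"
    if a: "a \<in> Field A" "a' \<in> Field A" and le: "(p0 a, p0 a') \<in> B" "(p1 a, p1 a') \<in> B" for a a'
  proof -
    have "(decode R a, decode R a') \<in> R" using le a M by (auto simp: R_def p0_def p1_def)
    from encode_mono[OF small this, folded A_def] a show ?thesis
      using encode_decode[OF small, folded A_def] by simp
  qed
  ultimately show ?thesis using A p by blast
qed

section \<open>Continuity in several variables\<close>

lemma precompose_continuous:
  assumes "complete_poset k t" "Partial_order r" "Partial_order s" "continuous_map k r s e"
  shows "continuous_map k (cmaps_order k s t) (cmaps_order k r t) (\<lambda>f. compose (Field r) f e)"
proof (rule continuous_into_cmaps_orderI[OF assms(1,2)])
  note po = complete_poset_po[OF assms(1)]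
  show "Partial_order (cmaps_order k s t)" by (rule cmaps_order_Partial_order[OF po])
  show "compose (Field r) f e \<in> cmaps k r t" if "f \<in> Field (cmaps_order k s t)" for f
    unfolding compose_def using that po
    by (intro restrict_cmaps[OF assms(2)] continuous_map_compose[OF assms(4)] cmaps_continuous) simp
  show "continuous_map k (cmaps_order k s t) t (\<lambda>f. compose (Field r) f e x)" if "x \<in> Field r" for x
    using cmaps_order_eval_continuous[OF assms(1,3) continuous_map_Field[OF assms(4) that]] that
    by (simp add: compose_eq)
qed

lemma postcompose_continuous:
  assumes "complete_poset k s" "complete_poset k t" "Partial_order r" "continuous_map k s t g"
  shows "continuous_map k (cmaps_order k r s) (cmaps_order k r t) (compose (Field r) g)"
proof (rule continuous_into_cmaps_orderI[OF assms(2,3)])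
  note po = complete_poset_po[OF assms(1)]
  show "Partial_order (cmaps_order k r s)" by (rule cmaps_order_Partial_order[OF po])
  show "compose (Field r) g f \<in> cmaps k r t" if "f \<in> Field (cmaps_order k r s)" for f
    unfolding compose_def using that po
    by (intro restrict_cmaps[OF assms(3)] continuous_map_compose[OF _ assms(4)] cmaps_continuous) simp
  show "continuous_map k (cmaps_order k r s) t (\<lambda>f. compose (Field r) g f x)" if "x \<in> Field r" for x
    using continuous_map_compose[OF cmaps_order_eval_continuous[OF assms(1,3) that] assms(4)] that
    by (simp add: compose_eq)
qed

text \<open>Separate continuity implies joint continuity: by directedness of \<open>S\<close> every
  mixed value \<open>h (u w) (v w')\<close> lies below a diagonal one, and then the two joins are
  taken one after the other.\<close>

lemma continuous_map2:
  assumes Z: "Partial_order z" and X: "Partial_order x"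
    and u: "continuous_map k z p u" and v: "continuous_map k z q v"
    and h1: "\<And>b. b \<in> Field q \<Longrightarrow> continuous_map k p x (\<lambda>a. h a b)"
    and h2: "\<And>a. a \<in> Field p \<Longrightarrow> continuous_map k q x (h a)"
  shows "continuous_map k z x (\<lambda>c. h (u c) (v c))"
proof -
  have mono: "(h (u c) (v c'), h (u d) (v d')) \<in> x" if "(c, d) \<in> z" "(c', d') \<in> z" for c d c' d'
  proof -
    have "v c' \<in> Field q" "u d \<in> Field p"
      using that continuous_map_mono[OF v] continuous_map_mono[OF u] by (blast intro: FieldI1 FieldI2)+
    then have "(h (u c) (v c'), h (u d) (v c')) \<in> x" "(h (u d) (v c'), h (u d) (v d')) \<in> x"
      using that by (auto intro: continuous_map_mono[OF h1] continuous_map_mono[OF h2]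
          continuous_map_mono[OF u] continuous_map_mono[OF v])
    then show ?thesis by (rule po_trans[OF X])
  qed
  show ?thesis
  proof (rule continuous_mapI)
    show "h (u c) (v c) \<in> Field x" if "c \<in> Field z" for c
      using that continuous_map_Field[OF u] continuous_map_Field[OF v] continuous_map_Field[OF h2] by blast
    fix S c y assume S: "joinable k z S" "is_join z S c" and y: "y \<in> Field x"
      and le: "\<And>w. w \<in> S \<Longrightarrow> (h (u w) (v w), y) \<in> x"
    have SF: "S \<subseteq> Field z" by (rule joinable_subset[OF Z S(1)])
    note ju = continuous_map_joinable[OF u S(1)] continuous_map_join[OF u S]
      and jv = continuous_map_joinable[OF v S(1)] continuous_map_join[OF v S]
    have "(h (u w) (v w'), y) \<in> x" if w: "w \<in> S" "w' \<in> S" for w w'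
    proof -
      obtain w'' where "w'' \<in> S" "(w, w'') \<in> z" "(w', w'') \<in> z"
        using directed_inD(3)[OF joinable_directed[OF Z S(1)] w] by blast
      with mono le show ?thesis by (blast intro: po_trans[OF X])
    qed
    then have "(h (u w) (v c), y) \<in> x" if "w \<in> S" for w
      using that SF continuous_map_Field[OF u] is_join_least[OF continuous_map_join[OF h2 jv] y]
      by (smt (verit, best) imageE subset_iff)
    then show "(h (u c) (v c), y) \<in> x"
      using is_join_Field[OF jv(2)] is_join_least[OF continuous_map_join[OF h1 ju] y]
      by (smt (verit, best) imageE)
  qed (use mono in auto)
qed

text \<open>Continuity of \<open>H s\<close> in its argument passes to a parameter \<open>z\<close>
  at which the values are pointwise joins. So continuity for all parameters follows by
  \<open>generates_induct\<close> from continuity for generating ones.\<close>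

lemma continuous_map_pointwise_join:
  assumes X: "Partial_order x" and r: "Partial_order r"
    and H: "\<And>p. p \<in> Field r \<Longrightarrow> is_join x ((\<lambda>s. H s p) ` S) (H z p)"
    and S: "\<And>s. s \<in> S \<Longrightarrow> continuous_map k r x (H s)"
  shows "continuous_map k r x (H z)"
proof (rule continuous_mapI)
  show "H z p \<in> Field x" if "p \<in> Field r" for p using is_join_Field[OF H[OF that]] .
  show "(H z p, H z q) \<in> x" if pq: "(p, q) \<in> r" for p q
  proof -
    have F: "p \<in> Field r" "q \<in> Field r" using pq by (auto intro: FieldI1 FieldI2)
    show ?thesis
    proof (rule is_join_least[OF H[OF F(1)] is_join_Field[OF H[OF F(2)]]])
      fix y assume "y \<in> (\<lambda>s. H s p) ` S"
      then obtain s where s: "s \<in> S" "y = H s p" by auto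
      then have "(H s q, H z q) \<in> x" using is_join_upper[OF H[OF F(2)]] by blast
      with s show "(y, H z q) \<in> x" using continuous_map_mono[OF S pq] po_trans[OF X] by blast
    qed
  qed
  fix W w y assume W: "joinable k r W" "is_join r W w" and y: "y \<in> Field x"
    and le: "\<And>v. v \<in> W \<Longrightarrow> (H z v, y) \<in> x"
  show "(H z w, y) \<in> x"
  proof (rule is_join_least[OF H[OF is_join_Field[OF W(2)]] y])
    fix y' assume "y' \<in> (\<lambda>s. H s w) ` S"
    then obtain s where s: "s \<in> S" "y' = H s w" by auto
    have "(H s w, y) \<in> x"
    proof (rule is_join_least[OF continuous_map_join[OF S[OF s(1)] W] y])
      fix y'' assume "y'' \<in> H s ` W"
      then obtain v where v: "v \<in> W" "y'' = H s v" by auto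
      then have "v \<in> Field r" using joinable_subset[OF r W(1)] by auto
      from is_join_upper[OF H[OF this]] s have "(H s v, H z v) \<in> x" by blast
      with v le show "(y'', y) \<in> x" using po_trans[OF X] by blast
    qed
    with s show "(y', y) \<in> x" by simp
  qed
qed

section \<open>Finite powers\<close>

lemma Field_Id_on [simp]: "Field (Id_on n) = n"
  by (auto simp: Field_def)

lemma Id_on_Partial_order: "Partial_order (Id_on n)"
  by (rule Partial_orderI) auto

lemma partial_order_Id_on [simp]: "partial_order_on n (Id_on n)"
  using Id_on_Partial_order[of n] by simp

lemma cmaps_Id_on:
  assumes "Partial_order C"
  shows "cmaps k (Id_on n) C = n \<rightarrow>\<^sub>E Field C"
proof
  show "cmaps k (Id_on n) C \<subseteq> n \<rightarrow>\<^sub>E Field C"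
    by (auto simp: PiE_def cmaps_def dest: continuous_map_Field)
  show "n \<rightarrow>\<^sub>E Field C \<subseteq> cmaps k (Id_on n) C"
    by (auto simp: PiE_def cmaps_def intro: continuous_map_discrete[OF _ assms])
qed

abbreviation power_order :: "kind \<Rightarrow> 'a set \<Rightarrow> 'b rel \<Rightarrow> ('a \<Rightarrow> 'b) rel" where
  "power_order k n C \<equiv> cmaps_order k (Id_on n) C"

lemma Field_power_order: "Partial_order C \<Longrightarrow> Field (power_order k n C) = n \<rightarrow>\<^sub>E Field C"
  by (simp add: cmaps_Id_on)

lemma power_eval_continuous:
  "complete_poset k C \<Longrightarrow> x \<in> n \<Longrightarrow> continuous_map k (power_order k n C) C (\<lambda>f. f x)"
  by (rule cmaps_order_eval_continuous) auto

lemma power_precompose_continuous: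
  assumes "complete_poset k C" "g \<in> m \<rightarrow> n"
  shows "continuous_map k (power_order k n C) (power_order k m C) (\<lambda>f. compose m f g)"
  using precompose_continuous[OF assms(1) Id_on_Partial_order Id_on_Partial_order
      continuous_map_discrete[of g m "Id_on n"]] assms(2)
  by simp

text \<open>The value \<open>f x\<close> is unconstrained, so \<open>f\<close> may be a tuple
  indexed by \<open>n - {x}\<close> alone.\<close>

lemma power_update_continuous:
  assumes "complete_poset k C" "x \<in> n" "f \<in> extensional n"
    and f: "\<And>y. y \<in> n \<Longrightarrow> y \<noteq> x \<Longrightarrow> f y \<in> Field C"
  shows "continuous_map k C (power_order k n C) (\<lambda>c. f(x := c))"
proof (rule continuous_into_cmaps_orderI[OF assms(1) Id_on_Partial_order])
  note po = complete_poset_po[OF assms(1)]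
  show "Partial_order C" by (rule po)
  show "f(x := c) \<in> cmaps k (Id_on n) C" if "c \<in> Field C" for c
    unfolding cmaps_Id_on[OF po] using that assms by (auto simp: PiE_def extensional_def)
  show "continuous_map k C C (\<lambda>c. (f(x := c)) y)" if "y \<in> Field (Id_on n)" for y
    using that f continuous_map_id[of k C] continuous_map_const[OF po po]
    by (cases "y = x") auto
qed

text \<open>Coordinates are released from \<open>G\<close> one at a time, because inserting an
  element in a single coordinate is a continuous map. Finiteness of \<open>n\<close> makes the
  process end.\<close>

lemma power_generates:
  assumes C: "complete_poset k C" and G: "generates k C G" and n: "finite n"
  shows "generates k (power_order k n C) (n \<rightarrow>\<^sub>E G)"
proof (rule generatesI)
  note po = complete_poset_po[OF C]
  show "(n \<rightarrow>\<^sub>E G) \<subseteq> Field (power_order k n C)"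
    unfolding Field_power_order[OF po] using generates_subset[OF G] by (rule PiE_mono)
  fix T f assume T: "(n \<rightarrow>\<^sub>E G) \<subseteq> T" "join_closed k (power_order k n C) T"
    and f: "f \<in> Field (power_order k n C)"
  \<comment> \<open>\<open>m\<close> is the set of coordinates that may already leave
    \<open>G\<close>; the claim is wanted for \<open>m = n\<close>.\<close>
  have "\<forall>f \<in> n \<rightarrow>\<^sub>E Field C. (\<forall>x\<in>n - m. f x \<in> G) \<longrightarrow> f \<in> T" if "m \<subseteq> n" for m
    using finite_subset[OF that n] that
  proof (induction m)
    case empty
    then show ?case using T(1) by (auto simp: PiE_iff)
  next
    case (insert x m)
    show ?case
    proof (intro ballI impI)
      fix f assume f: "f \<in> n \<rightarrow>\<^sub>E Field C" "\<forall>y\<in>n - insert x m. f y \<in> G"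
      have "G \<subseteq> {c. f(x := c) \<in> T}"
      proof
        fix c assume c: "c \<in> G"
        then have "f(x := c) \<in> n \<rightarrow>\<^sub>E Field C"
          using f insert.prems generates_subset[OF G] by (auto simp: PiE_def extensional_def)
        moreover have "\<forall>y\<in>n - m. (f(x := c)) y \<in> G" using f(2) c by auto
        ultimately show "c \<in> {c. f(x := c) \<in> T}" using insert by auto
      qed
      moreover have "join_closed k C {c. f(x := c) \<in> T}"
        using insert.prems f(1)
        by (intro join_closed_vimage[OF power_update_continuous[OF C] T(2)]) (auto simp: PiE_iff)
      ultimately have "Field C \<subseteq> {c. f(x := c) \<in> T}" by (rule generatesD[OF G])
      moreover have "f x \<in> Field C" using f(1) insert.prems by auto
      ultimately show "f \<in> T" by auto
    qed
  qed
  from this[of n] f show "f \<in> T" by (simp add: Field_power_order[OF po])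
qed

section \<open>Presentations\<close>

text \<open>
  A common form of the universal properties of directed colimits and of coinserters: the poset \<open>C\<close>
  is freely generated by the images under \<open>\<gamma>\<close> of the posets \<open>B j\<close>, subject to the inequations \<open>R\<close>.
\<close>

definition admissible ::
    "kind \<Rightarrow> 'i set \<Rightarrow> ('i \<Rightarrow> 'b rel) \<Rightarrow> (('i \<times> 'b) \<times> ('i \<times> 'b)) set \<Rightarrow> 'x rel \<Rightarrow> ('i \<times> 'b \<Rightarrow> 'x) \<Rightarrow> bool"
  where
  "admissible k J B R X \<phi> \<longleftrightarrow>
     (\<forall>j\<in>J. continuous_map k (B j) X (\<lambda>b. \<phi> (j, b))) \<and> (\<forall>(p, q)\<in>R. (\<phi> p, \<phi> q) \<in> X)"

definition points :: "'i set \<Rightarrow> ('i \<Rightarrow> 'b rel) \<Rightarrow> ('i \<times> 'b) set" where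
  "points J B = Sigma J (\<lambda>j. Field (B j))"

text \<open>Uniqueness of \<open>h\<close> is expressed by generation, which yields it in the
  stronger inequational form.\<close>

definition presents ::
    "kind \<Rightarrow> 'i set \<Rightarrow> ('i \<Rightarrow> 'b rel) \<Rightarrow> (('i \<times> 'b) \<times> ('i \<times> 'b)) set \<Rightarrow> 'u rel \<Rightarrow> ('i \<times> 'b \<Rightarrow> 'u) \<Rightarrow> bool"
  where
  "presents k J B R C \<gamma> \<longleftrightarrow>
     C \<in> obj k \<and> (\<forall>j\<in>J. Partial_order (B j)) \<and> R \<subseteq> points J B \<times> points J B \<and>
     generates k C (\<gamma> ` points J B) \<and>
     (\<forall>X\<in>(obj k :: 'u rel set). \<forall>\<phi>. admissible k J B R X \<phi> \<longrightarrow>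
        (\<exists>h. continuous_map k C X h \<and> (\<forall>p\<in>points J B. h (\<gamma> p) = \<phi> p)))"

lemma presentsD:
  fixes C X :: "'u rel"
  assumes "presents k J B R C \<gamma>"
  shows presents_obj: "C \<in> obj k"
    and presents_po: "j \<in> J \<Longrightarrow> Partial_order (B j)"
    and presents_rel: "(p, q) \<in> R \<Longrightarrow> p \<in> points J B \<and> q \<in> points J B"
    and presents_generates: "generates k C (\<gamma> ` points J B)"
    and presents_extend: "X \<in> obj k \<Longrightarrow> admissible k J B R X \<phi> \<Longrightarrow>
      \<exists>h. continuous_map k C X h \<and> (\<forall>p\<in>points J B. h (\<gamma> p) = \<phi> p)"
  using assms unfolding presents_def by blast+

lemma admissible_cong:
  assumes "\<And>j. j \<in> J \<Longrightarrow> Partial_order (B j)" "R \<subseteq> points J B \<times> points J B"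
    and "\<And>p. p \<in> points J B \<Longrightarrow> \<phi> p = \<psi> p"
  shows "admissible k J B R X \<phi> \<longleftrightarrow> admissible k J B R X \<psi>"
proof -
  have "continuous_map k (B j) X (\<lambda>b. \<phi> (j, b)) \<longleftrightarrow> continuous_map k (B j) X (\<lambda>b. \<psi> (j, b))"
    if "j \<in> J" for j
    using assms(3) that by (intro continuous_map_cong[OF assms(1)[OF that]]) (auto simp: points_def)
  moreover have "(\<phi> p, \<phi> q) \<in> X \<longleftrightarrow> (\<psi> p, \<psi> q) \<in> X" if "(p, q) \<in> R" for p q
  proof -
    have "p \<in> points J B" "q \<in> points J B" using assms(2) that by auto
    then show ?thesis using assms(3) by simp
  qed
  ultimately show ?thesis unfolding admissible_def by auto
qed

text \<open>The counterpart of \<open>continuous_map_pointwise_join\<close> for admissibility: it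
  too needs checking at generating parameters only.\<close>

lemma admissible_join:
  assumes X: "Partial_order X" and B: "\<And>j. j \<in> J \<Longrightarrow> Partial_order (B j)"
    and R: "R \<subseteq> points J B \<times> points J B"
    and H: "\<And>p. p \<in> points J B \<Longrightarrow> is_join X ((\<lambda>s. H s p) ` S) (H z p)"
    and S: "\<And>s. s \<in> S \<Longrightarrow> admissible k J B R X (H s)"
  shows "admissible k J B R X (H z)"
  unfolding admissible_def
proof (intro conjI ballI)
  fix j assume j: "j \<in> J"
  show "continuous_map k (B j) X (\<lambda>b. H z (j, b))"
    by (rule continuous_map_pointwise_join[OF X B[OF j], where H = "\<lambda>s b. H s (j, b)" and S = S])
      (use H S j in \<open>auto simp: points_def admissible_def\<close>)
next
  fix pq assume "pq \<in> R"
  then obtain p q where pq: "pq = (p, q)" "(p, q) \<in> R" by (cases pq) auto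
  then have F: "p \<in> points J B" "q \<in> points J B" using R by auto
  have "(H z p, H z q) \<in> X"
  proof (rule is_join_least[OF H[OF F(1)] is_join_Field[OF H[OF F(2)]]])
    fix y assume "y \<in> (\<lambda>s. H s p) ` S"
    then obtain s where s: "s \<in> S" "y = H s p" by auto
    then have "(H s q, H z q) \<in> X" using is_join_upper[OF H[OF F(2)]] by blast
    moreover have "(H s p, H s q) \<in> X" using S[OF s(1)] pq by (auto simp: admissible_def)
    ultimately show "(y, H z q) \<in> X" using s po_trans[OF X] by blast
  qed
  with pq show "case pq of (p, q) \<Rightarrow> (H z p, H z q) \<in> X" by simp
qed

lemma PiE_image_lift:
  assumes "c \<in> n \<rightarrow>\<^sub>E \<gamma> ` P"
  shows "\<exists>f \<in> n \<rightarrow>\<^sub>E P. c = compose n \<gamma> f"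
proof -
  have "\<forall>x\<in>n. \<exists>p\<in>P. c x = \<gamma> p" using assms by (auto simp: PiE_iff)
  then obtain f where f: "\<And>x. x \<in> n \<Longrightarrow> f x \<in> P \<and> c x = \<gamma> (f x)" by metis
  show ?thesis
    by (rule bexI[of _ "restrict f n"])
      (use f assms in \<open>auto simp: compose_def PiE_iff extensional_def\<close>)
qed

text \<open>
  The power \<open>C\<^sup>n\<close> inherits a presentation from \<open>C\<close>, with inequations in one coordinate at a time. The
  coordinates are treated one after the other; continuity in the coordinates not yet treated is
  checked on generators only.
\<close>

lemma power_extension:
  fixes C X :: "'u rel"
  assumes C: "presents k J B R C \<gamma>" and X: "X \<in> obj k" and n: "finite n"
    and "\<And>f. f \<in> n \<rightarrow>\<^sub>E points J B \<Longrightarrow> \<phi> f \<in> Field X"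
    and "\<And>x f. x \<in> n \<Longrightarrow> f \<in> n - {x} \<rightarrow>\<^sub>E points J B \<Longrightarrow> admissible k J B R X (\<lambda>p. \<phi> (f(x := p)))"
  shows "\<exists>\<Phi>. continuous_map k (power_order k n C) X \<Phi> \<and>
    (\<forall>f \<in> n \<rightarrow>\<^sub>E points J B. \<Phi> (compose n \<gamma> f) = \<phi> f)"
  using n assms(4,5)
proof (induction n arbitrary: \<phi>)
  case empty
  have "continuous_map k (power_order k {} C) X (\<lambda>_. \<phi> (\<lambda>_. undefined))"
    using empty by (intro continuous_map_const cmaps_order_Partial_order obj_po[OF X]
        obj_po[OF presents_obj[OF C]]) auto
  then show ?case by auto
next
  case (insert x m)
  let ?P = "points J B"
  note cC = obj_complete[OF presents_obj[OF C]] and pC = obj_po[OF presents_obj[OF C]]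
    and pX = obj_po[OF X]
  have upd: "f(x := p) \<in> insert x m \<rightarrow>\<^sub>E ?P" if "f \<in> m \<rightarrow>\<^sub>E ?P" "p \<in> ?P" for f p
    using that by (auto simp: PiE_def extensional_def)
  \<comment> \<open>Coordinate \<open>x\<close> is frozen at a point \<open>p\<close> of the
    presentation, and the induction hypothesis extends the assignment in the coordinates from
    \<open>m\<close>.\<close>
  have "\<exists>\<Phi>. continuous_map k (power_order k m C) X \<Phi> \<and>
    (\<forall>f \<in> m \<rightarrow>\<^sub>E ?P. \<Phi> (compose m \<gamma> f) = \<phi> (f(x := p)))" if p: "p \<in> ?P" for p
  proof (rule insert.IH)
    show "\<phi> (f(x := p)) \<in> Field X" if "f \<in> m \<rightarrow>\<^sub>E ?P" for f
      by (rule insert.prems(1)[OF upd[OF that p]])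
    fix y f assume y: "y \<in> m" and f: "f \<in> m - {y} \<rightarrow>\<^sub>E ?P"
    then have "y \<noteq> x" using insert.hyps by auto
    then have twist: "f(y := q, x := p) = f(x := p, y := q)" for q by (rule fun_upd_twist)
    have "f(x := p) \<in> insert x m - {y} \<rightarrow>\<^sub>E ?P"
      using f p \<open>y \<noteq> x\<close> by (auto simp: PiE_iff extensional_def)
    then show "admissible k J B R X (\<lambda>q. \<phi> (f(y := q, x := p)))"
      unfolding twist by (rule insert.prems(2)[rotated]) (use y in simp)
  qed
  then obtain \<Phi> where \<Phi>: "\<And>p. p \<in> ?P \<Longrightarrow> continuous_map k (power_order k m C) X (\<Phi> p)"
    "\<And>p f. p \<in> ?P \<Longrightarrow> f \<in> m \<rightarrow>\<^sub>E ?P \<Longrightarrow> \<Phi> p (compose m \<gamma> f) = \<phi> (f(x := p))"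
    by metis
  have R: "R \<subseteq> ?P \<times> ?P" using presents_rel[OF C] by auto
  \<comment> \<open>Now \<open>c\<close> is fixed and \<open>p\<close> varies. For generating tuples
    \<open>c\<close> this is the given inequation in coordinate \<open>x\<close>; both parts of
    admissibility survive joins of such tuples.\<close>
  have adm: "admissible k J B R X (\<lambda>p. \<Phi> p c)" if "c \<in> Field (power_order k m C)" for c
    using power_generates[OF cC presents_generates[OF C] insert.hyps(1)] that
  proof (induction rule: generates_induct)
    case (gen c)
    then obtain f where f: "f \<in> m \<rightarrow>\<^sub>E ?P" "c = compose m \<gamma> f" using PiE_image_lift by blast
    have "insert x m - {x} = m" using insert.hyps by auto
    then have "admissible k J B R X (\<lambda>p. \<phi> (f(x := p)))"
      by (intro insert.prems(2)) (simp_all add: f)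
    then show ?case
      using admissible_cong[OF presents_po[OF C] R, of "\<lambda>p. \<phi> (f(x := p))" "\<lambda>p. \<Phi> p c"] \<Phi>(2) f by simp
  next
    case (join S c)
    show ?case
      by (rule admissible_join[OF pX presents_po[OF C] R, where H = "\<lambda>c p. \<Phi> p c" and S = S])
        (use continuous_map_join[OF \<Phi>(1) join(1,2)] join(3) in auto)
  qed
  have "\<exists>h. continuous_map k C X h \<and> (\<forall>p\<in>?P. h (\<gamma> p) = \<Phi> p c)"
    if "c \<in> Field (power_order k m C)" for c
    using presents_extend[OF C X adm[OF that]] .
  then obtain h where h: "\<And>c. c \<in> Field (power_order k m C) \<Longrightarrow> continuous_map k C X (h c)"
    "\<And>c p. c \<in> Field (power_order k m C) \<Longrightarrow> p \<in> ?P \<Longrightarrow> h c (\<gamma> p) = \<Phi> p c" by metis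
  have pm: "Partial_order (power_order k m C)" by (rule cmaps_order_Partial_order[OF pC])
  \<comment> \<open>At a generator \<open>z = \<gamma> p\<close> the map is \<open>\<Phi> p\<close>,
    whose continuity is known; other elements \<open>z\<close> are reached by joins.\<close>
  have h': "continuous_map k (power_order k m C) X (\<lambda>c. h c z)" if "z \<in> Field C" for z
    using presents_generates[OF C] that
  proof (induction rule: generates_induct)
    case (gen z)
    then obtain p where p: "p \<in> ?P" "z = \<gamma> p" by auto
    show ?case
      using continuous_map_cong[OF pm, of "\<lambda>c. h c z" "\<Phi> p"] h(2) \<Phi>(1) p by simp
  next
    case (join S z)
    show ?case
      by (rule continuous_map_pointwise_join[OF pX pm, where H = "\<lambda>z c. h c z" and S = S])
        (use continuous_map_join[OF h(1) join(1,2)] join(3) in auto)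
  qed
  \<comment> \<open>\<open>compose m f (\<lambda>y. y)\<close> is the restriction of
    \<open>f\<close> to \<open>m\<close>, written as a reindexing so that its continuity is an
    instance of \<open>power_precompose_continuous\<close>.\<close>
  let ?\<Psi> = "\<lambda>f. h (compose m f (\<lambda>y. y)) (f x)"
  have "continuous_map k (power_order k (insert x m) C) X ?\<Psi>"
    using h(1) h'
    by (intro continuous_map2[OF cmaps_order_Partial_order[OF pC] pX
          power_precompose_continuous[OF cC] power_eval_continuous[OF cC]]) auto
  moreover have "?\<Psi> (compose (insert x m) \<gamma> f) = \<phi> f" if f: "f \<in> insert x m \<rightarrow>\<^sub>E ?P" for f
  proof -
    define g where "g = restrict f m"
    have g: "g \<in> m \<rightarrow>\<^sub>E ?P" and fx: "f x \<in> ?P" using f by (auto simp: g_def)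
    have fg: "f = g(x := f x)"
      using f by (auto simp: g_def fun_eq_iff PiE_def extensional_def)
    have "compose m (compose (insert x m) \<gamma> f) (\<lambda>y. y) = compose m \<gamma> g"
      by (auto simp: compose_def g_def fun_eq_iff)
    moreover have "compose m \<gamma> g \<in> Field (power_order k m C)"
      unfolding Field_power_order[OF pC]
      using g generates_subset[OF presents_generates[OF C]] by (auto simp: compose_def)
    ultimately show ?thesis using h(2) \<Phi>(2)[OF fx g] fx fg by (simp add: compose_eq)
  qed
  ultimately show ?case by blast
qed

section \<open>Free completions\<close>

definition lower :: "'a rel \<Rightarrow> 'a set \<Rightarrow> 'a set" where
  "lower r S = {x. \<exists>s\<in>S. (x, s) \<in> r}"

definition ideals :: "kind \<Rightarrow> 'a rel \<Rightarrow> 'a set set" where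
  "ideals k r = {lower r S |S. joinable k r S}"

definition ideal_order :: "kind \<Rightarrow> 'a rel \<Rightarrow> 'a set rel" where
  "ideal_order k r = {(I, J). I \<in> ideals k r \<and> J \<in> ideals k r \<and> I \<subseteq> J}"

lemma Field_ideal_order [simp]: "Field (ideal_order k r) = ideals k r"
  by (auto simp: Field_def ideal_order_def)

lemma ideal_order_Partial_order: "Partial_order (ideal_order k r)"
  by (rule Partial_orderI) (auto simp: ideal_order_def Field_def)

text \<open>Choose \<open>e (Suc n)\<close> above both \<open>e n\<close> and
  \<open>a (Suc n)\<close>: a countable directed set contains a cofinal chain. This lets
  \<omega>-chains do the work of directed sets in the CPO case below.\<close>

lemma countable_directed_chain:
  fixes a :: "nat \<Rightarrow> 'a"
  assumes "directed_in r (range a)"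
  shows "\<exists>e. (\<forall>n. (e n, e (Suc n)) \<in> r) \<and> (\<forall>n. e n \<in> range a) \<and> (\<forall>n. (a n, e n) \<in> r)"
proof -
  have "\<exists>e. \<forall>n. (e n \<in> range a \<and> (a n, e n) \<in> r) \<and> (e n, e (Suc n)) \<in> r"
  proof (rule dependent_nat_choice)
    show "\<exists>x. x \<in> range a \<and> (a 0, x) \<in> r" using directed_inD(3)[OF assms] by blast
    fix x n assume "x \<in> range a \<and> (a n, x) \<in> r"
    then show "\<exists>y. (y \<in> range a \<and> (a (Suc n), y) \<in> r) \<and> (x, y) \<in> r"
      using directed_inD(3)[OF assms, of x "a (Suc n)"] by blast
  qed
  then show ?thesis by blast
qed

context
  fixes k :: kind and r :: "'a rel"
  assumes po: "Partial_order r"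
begin

lemma subset_lower: "S \<subseteq> Field r \<Longrightarrow> S \<subseteq> lower r S"
  using po_refl[OF po] by (auto simp: lower_def)

lemma lower_ideal: "joinable k r S \<Longrightarrow> lower r S \<in> ideals k r"
  by (auto simp: ideals_def)

lemma ideal_lower_closed: "I \<in> ideals k r \<Longrightarrow> lower r I = I"
proof
  assume I: "I \<in> ideals k r"
  then obtain S where S: "joinable k r S" "I = lower r S" by (auto simp: ideals_def)
  then show "lower r I \<subseteq> I" by (auto simp: lower_def intro: po_trans[OF po])
  have "I \<subseteq> Field r" using S by (auto simp: lower_def intro: FieldI1)
  then show "I \<subseteq> lower r I" by (rule subset_lower)
qed

lemma ideal_directed: "I \<in> ideals k r \<Longrightarrow> directed_in r I"
proof -
  assume "I \<in> ideals k r"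
  then obtain S where S: "joinable k r S" "I = lower r S" by (auto simp: ideals_def)
  note d = joinable_directed[OF po S(1)]
  have "I \<noteq> {}" using subset_lower directed_inD(1,2)[OF d] S by blast
  moreover have "\<exists>z\<in>I. (x, z) \<in> r \<and> (y, z) \<in> r" if xy: "x \<in> I" "y \<in> I" for x y
  proof -
    obtain s t where st: "s \<in> S" "(x, s) \<in> r" "t \<in> S" "(y, t) \<in> r" using xy S by (auto simp: lower_def)
    then obtain u where u: "u \<in> S" "(s, u) \<in> r" "(t, u) \<in> r" using directed_inD(3)[OF d] by blast
    then have "u \<in> I" "(x, u) \<in> r" "(y, u) \<in> r"
      using st subset_lower[OF directed_inD(1)[OF d]] S po_trans[OF po] by blast+
    then show ?thesis by blast
  qed
  ultimately show ?thesis using S by (auto simp: directed_in_def lower_def intro: FieldI1)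
qed

text \<open>For DCPO the union is directed and generates itself. For CPO a chain of ideals, each
  generated by a chain, has a countable set of generators; this set is directed because it is
  cofinal in the union, and so it contains a cofinal chain.\<close>

lemma ideals_Union:
  assumes "joinable k (ideal_order k r) \<S>"
  shows "\<Union>\<S> \<in> ideals k r"
proof -
  have sub: "\<S> \<subseteq> ideals k r" using joinable_subset[OF ideal_order_Partial_order assms] by simp
  have dir: "directed_in (ideal_order k r) \<S>" by (rule joinable_directed[OF ideal_order_Partial_order assms])
  have dU: "directed_in r (\<Union>\<S>)"
    unfolding directed_in_def
  proof (intro conjI ballI)
    show "\<Union>\<S> \<subseteq> Field r" "\<Union>\<S> \<noteq> {}"
      using sub ideal_directed directed_inD(2)[OF dir] unfolding directed_in_def by blast+
    fix x y assume "x \<in> \<Union>\<S>" "y \<in> \<Union>\<S>"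
    then obtain K where "K \<in> \<S>" "x \<in> K" "y \<in> K"
      using directed_inD(3)[OF dir] unfolding ideal_order_def by blast
    then show "\<exists>z\<in>\<Union>\<S>. (x, z) \<in> r \<and> (y, z) \<in> r"
      using directed_inD(3)[OF ideal_directed] sub by blast
  qed
  have low: "lower r (\<Union>\<S>) = \<Union>\<S>"
    using ideal_lower_closed sub unfolding lower_def by blast
  show ?thesis
  proof (cases k)
    case DCPO
    with dU lower_ideal[of "\<Union>\<S>"] low show ?thesis by simp
  next
    case CPO
    with assms obtain I :: "nat \<Rightarrow> 'a set" where I: "\<S> = range I" by (auto simp: omega_chain_in_def)
    have "\<exists>c :: nat \<Rightarrow> 'a. I n = lower r (range c) \<and> range c \<subseteq> I n" for n
    proof -
      have "I n \<in> ideals k r" using sub I by blast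
      then obtain S where S: "joinable k r S" "I n = lower r S" by (auto simp: ideals_def)
      with CPO obtain c :: "nat \<Rightarrow> 'a" where "S = range c" by (auto simp: omega_chain_in_def)
      with S show ?thesis using subset_lower[OF joinable_subset[OF po S(1)]] by auto
    qed
    then obtain c :: "nat \<Rightarrow> nat \<Rightarrow> 'a" where c: "\<And>n. I n = lower r (range (c n))" "\<And>n. range (c n) \<subseteq> I n"
      by metis
    \<comment> \<open>A single enumeration of the double sequence of generators; its range is
      directed, but it need not be increasing.\<close>
    define a where "a n = (case prod_decode n of (i, j) \<Rightarrow> c i j)" for n
    have a: "range a = (\<Union>i. range (c i))"
    proof
      have "a n \<in> range (c (fst (prod_decode n)))" for n by (simp add: a_def case_prod_beta)
      then show "range a \<subseteq> (\<Union>i. range (c i))" by blast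
      have "c i j = a (prod_encode (i, j))" for i j by (simp add: a_def)
      then show "(\<Union>i. range (c i)) \<subseteq> range a" by blast
    qed
    have aU: "range a \<subseteq> \<Union>\<S>" using a c(2) I by blast
    have cof: "\<exists>n. (x, a n) \<in> r" if x: "x \<in> \<Union>\<S>" for x
    proof -
      obtain i where "x \<in> I i" using x I by auto
      then obtain j where "(x, c i j) \<in> r" using c(1)[of i] by (auto simp: lower_def)
      moreover have "c i j \<in> range a" using a by blast
      ultimately show ?thesis by auto
    qed
    have "directed_in r (range a)"
      unfolding directed_in_def
    proof (intro conjI ballI)
      show "range a \<subseteq> Field r" using aU dU by (auto simp: directed_in_def)
      fix x y assume "x \<in> range a" "y \<in> range a"
      then have "x \<in> \<Union>\<S>" "y \<in> \<Union>\<S>" using aU by auto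
      from directed_inD(3)[OF dU this] obtain z where z: "z \<in> \<Union>\<S>" "(x, z) \<in> r" "(y, z) \<in> r"
        by blast
      from cof[OF z(1)] obtain n where "(z, a n) \<in> r" by blast
      then have "(x, a n) \<in> r" "(y, a n) \<in> r" using z by (auto intro: po_trans[OF po])
      then show "\<exists>z\<in>range a. (x, z) \<in> r \<and> (y, z) \<in> r" by blast
    qed simp
    from countable_directed_chain[OF this] obtain e where
      e: "\<And>n. (e n, e (Suc n)) \<in> r" "\<And>n. e n \<in> range a" "\<And>n. (a n, e n) \<in> r" by blast
    have "lower r (range e) = \<Union>\<S>"
    proof
      have "range e \<subseteq> \<Union>\<S>" using e(2) aU by blast
      then show "lower r (range e) \<subseteq> \<Union>\<S>" using low unfolding lower_def by blast
      show "\<Union>\<S> \<subseteq> lower r (range e)"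
      proof
        fix x assume "x \<in> \<Union>\<S>"
        from cof[OF this] obtain n where "(x, a n) \<in> r" by blast
        with e(3)[of n] have "(x, e n) \<in> r" using po_trans[OF po] by blast
        then show "x \<in> lower r (range e)" by (auto simp: lower_def)
      qed
    qed
    moreover have "joinable k r (range e)"
      using e(1) unfolding CPO by (auto simp: omega_chain_in_def)
    ultimately show ?thesis using lower_ideal[of "range e"] by simp
  qed
qed

lemma ideal_order_join:
  assumes "joinable k (ideal_order k r) \<S>"
  shows "is_join (ideal_order k r) \<S> (\<Union>\<S>)"
proof (rule is_joinI)
  note U = ideals_Union[OF assms]
  have sub: "\<S> \<subseteq> ideals k r" using joinable_subset[OF ideal_order_Partial_order assms] by simp
  show "\<Union>\<S> \<in> Field (ideal_order k r)" using U by simp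
  show "(s, \<Union>\<S>) \<in> ideal_order k r" if "s \<in> \<S>" for s
    using that U sub by (auto simp: ideal_order_def)
  show "(\<Union>\<S>, y) \<in> ideal_order k r"
    if "y \<in> Field (ideal_order k r)" "\<And>s. s \<in> \<S> \<Longrightarrow> (s, y) \<in> ideal_order k r" for y
  proof -
    have "y \<in> ideals k r" using that(1) by simp
    with that(2) U show ?thesis by (auto simp: ideal_order_def)
  qed
qed

lemma ideal_order_complete: "complete_poset k (ideal_order k r)"
  unfolding complete_poset_def using ideal_order_Partial_order ideal_order_join by blast

end

text \<open>The completion consists of the ideals, and \<open>\<eta>\<close> sends an element to its
  principal ideal. A monotone \<open>e\<close> extends by sending an ideal to the join of its image,
  and unions of ideals go to joins since both sides have the same upper bounds.\<close>

lemma free_completion: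
  fixes C :: "'u rel"
  assumes U: "universe TYPE('u)" and C: "C \<in> obj k"
  shows "\<exists>(D :: 'u rel) \<eta>. D \<in> obj k \<and> (\<forall>x y. (x, y) \<in> C \<longrightarrow> (\<eta> x, \<eta> y) \<in> D) \<and>
    generates k D (\<eta> ` Field C) \<and>
    (\<forall>X\<in>(obj k :: 'u rel set). \<forall>e. (\<forall>x y. (x, y) \<in> C \<longrightarrow> (e x, e y) \<in> X) \<longrightarrow>
      (\<exists>h. continuous_map k D X h \<and> (\<forall>x\<in>Field C. h (\<eta> x) = e x)))"
proof -
  note po = obj_po[OF C]
  define R where "R = ideal_order k C"
  note cR = ideal_order_complete[OF po, of k, folded R_def]
  note pR = complete_poset_po[OF cR]
  have F: "Field R = ideals k C" by (simp add: R_def)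
  have "ideals k C \<subseteq> Pow (Field C)" by (auto simp: ideals_def lower_def intro: FieldI1)
  then have small: "Field R \<prec> (UNIV :: 'u set)"
    unfolding F by (rule lesspoll_subset[OF lesspoll_universe_Pow[OF U obj_small[OF C]]])
  define D where "D = (coded R :: 'u rel)"
  have D: "D \<in> obj k" unfolding D_def by (rule coded_obj[OF small cR])
  define \<eta> where "\<eta> x = (encode R (lower C {x}) :: 'u)" for x
  have prin: "lower C {x} \<in> ideals k C" if "x \<in> Field C" for x
    using that by (intro lower_ideal[OF po] joinable_singleton po_refl[OF po])
  have mono': "(lower C {x}, lower C {y}) \<in> R" if "(x, y) \<in> C" for x y
    using that prin po_trans[OF po] unfolding R_def ideal_order_def
    by (auto simp: lower_def intro: FieldI1 FieldI2)
  have mono: "(\<eta> x, \<eta> y) \<in> D" if "(x, y) \<in> C" for x y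
    unfolding \<eta>_def D_def by (rule encode_mono[OF small mono'[OF that]])
  have gen: "generates k D (\<eta> ` Field C)"
  proof (rule generatesI)
    show "\<eta> ` Field C \<subseteq> Field D" using mono po_refl[OF po] by (auto intro: FieldI1)
    fix T y assume T: "\<eta> ` Field C \<subseteq> T" "join_closed k D T" and y: "y \<in> Field D"
    have "decode R y \<in> ideals k C" using decode_Field[OF small] y F unfolding D_def by blast
    then obtain S where S: "joinable k C S" "decode R y = lower C S" by (auto simp: ideals_def)
    \<comment> \<open>An ideal is the join of the principal ideals of any joinable set generating
      it, and these again form a joinable set.\<close>
    have j: "joinable k R ((\<lambda>x. lower C {x}) ` S)" using mono' S(1) by (rule joinable_image)
    have "\<Union>((\<lambda>x. lower C {x}) ` S) = lower C S" by (auto simp: lower_def)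
    with ideal_order_join[OF po] j have "is_join R ((\<lambda>x. lower C {x}) ` S) (lower C S)"
      unfolding R_def by metis
    from continuous_map_join[OF encode_continuous[OF small pR] j this]
    have "is_join D (\<eta> ` S) (encode R (decode R y))"
      unfolding S(2) D_def \<eta>_def by (simp add: image_image)
    then have "is_join D (\<eta> ` S) y" using encode_decode[OF small] y unfolding D_def by simp
    moreover have "joinable k D (\<eta> ` S)" using mono S(1) by (rule joinable_image)
    moreover have "\<eta> ` S \<subseteq> T" using T(1) joinable_subset[OF po S(1)] by auto
    ultimately show "y \<in> T" by (intro join_closedD[OF T(2)])
  qed
  have ext: "\<exists>h. continuous_map k D X h \<and> (\<forall>x\<in>Field C. h (\<eta> x) = e x)"
    if X: "X \<in> obj k" and e: "\<And>x y. (x, y) \<in> C \<Longrightarrow> (e x, e y) \<in> X" for X :: "'u rel" and e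
  proof -
    note pX = obj_po[OF X]
    \<comment> \<open>The image of the whole ideal has the same upper bounds as the image of a
      generating joinable set. So the join exists and involves no choice of generators.\<close>
    have "\<exists>v. is_join X (e ` I) v" if I: "I \<in> Field R" for I
    proof -
      obtain S where S: "joinable k C S" "I = lower C S" using I F by (auto simp: ideals_def)
      obtain v where v: "is_join X (e ` S) v"
        using complete_poset_join[OF obj_complete[OF X] joinable_image[of S C e X, OF e S(1)]] by blast
      have "is_join X (e ` I) v"
      proof (rule is_joinI)
        show "v \<in> Field X" by (rule is_join_Field[OF v])
        fix y assume "y \<in> e ` I"
        then obtain x s where xs: "y = e x" "s \<in> S" "(x, s) \<in> C" using S by (auto simp: lower_def)
        then have "(e s, v) \<in> X" using is_join_upper[OF v] by blast
        with xs e show "(y, v) \<in> X" using po_trans[OF pX] by blast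
      next
        fix y assume "y \<in> Field X" "\<And>z. z \<in> e ` I \<Longrightarrow> (z, y) \<in> X"
        with S(2) subset_lower[OF po joinable_subset[OF po S(1)]] show "(v, y) \<in> X"
          by (intro is_join_least[OF v]) auto
      qed
      then show ?thesis ..
    qed
    then obtain h where h: "\<And>I. I \<in> Field R \<Longrightarrow> is_join X (e ` I) (h I)" by metis
    have "continuous_map k R X h"
    proof (rule continuous_mapI)
      show "h I \<in> Field X" if "I \<in> Field R" for I using is_join_Field[OF h[OF that]] .
      show "(h I, h J) \<in> X" if IJ: "(I, J) \<in> R" for I J
      proof -
        have "I \<in> Field R" "J \<in> Field R" "I \<subseteq> J"
          using IJ by (auto simp: R_def ideal_order_def Field_def)
        then show ?thesis using is_join_upper[OF h] by (intro is_join_least[OF h] is_join_Field[OF h]) auto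
      qed
      fix \<S> I y assume S: "joinable k R \<S>" "is_join R \<S> I" and y: "y \<in> Field X"
        and le: "\<And>J. J \<in> \<S> \<Longrightarrow> (h J, y) \<in> X"
      have "I = \<Union>\<S>" using is_join_unique[OF pR S(2)] ideal_order_join[OF po] S(1) unfolding R_def by blast
      show "(h I, y) \<in> X"
      proof (rule is_join_least[OF h[OF is_join_Field[OF S(2)]] y])
        fix z assume "z \<in> e ` I"
        then obtain x J where xJ: "z = e x" "x \<in> J" "J \<in> \<S>" using \<open>I = \<Union>\<S>\<close> by auto
        then have "J \<in> Field R" using joinable_subset[OF pR S(1)] by auto
        then have "(e x, h J) \<in> X" using is_join_upper[OF h] xJ by blast
        with le xJ show "(z, y) \<in> X" using po_trans[OF pX] by blast
      qed
    qed
    from continuous_map_compose[OF decode_continuous[OF small pR] this]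
    have "continuous_map k D X (\<lambda>y. h (decode R y))" unfolding D_def .
    moreover have "h (decode R (\<eta> x)) = e x" if x: "x \<in> Field C" for x
    proof -
      have I: "lower C {x} \<in> Field R" using prin[OF x] F by simp
      have "is_join X (e ` lower C {x}) (e x)"
        using e[OF po_refl[OF po x]] e po_refl[OF po x]
        by (intro is_joinI) (auto simp: lower_def intro: FieldI1)
      then show ?thesis
        unfolding \<eta>_def using is_join_unique[OF pX h[OF I]] decode_encode[OF small I] by simp
    qed
    ultimately show ?thesis by blast
  qed
  show ?thesis
  proof (rule exI[of _ D], rule exI[of _ \<eta>], intro conjI allI ballI impI D)
    fix X :: "'u rel" and e assume "X \<in> obj k" and e: "\<forall>x y. (x, y) \<in> C \<longrightarrow> (e x, e y) \<in> X"
    from e show "\<exists>h. continuous_map k D X h \<and> (\<forall>x\<in>Field C. h (\<eta> x) = e x)"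
      by (intro ext \<open>X \<in> obj k\<close>) blast
  qed (use mono gen in auto)
qed

section \<open>Enriched endofunctors\<close>

lemma discrete_obj: "universe TYPE('u) \<Longrightarrow> finite n \<Longrightarrow> Id_on (n :: 'u set) \<in> obj k"
  by (intro objI finite_complete_poset finite_lesspoll_universe) (auto simp: Id_on_Partial_order)

lemma hom_Id_on: "Partial_order C \<Longrightarrow> hom k (Id_on n) C = n \<rightarrow>\<^sub>E Field C"
  by (simp add: hom_eq_cmaps cmaps_Id_on)

lemma hom_continuous: "f \<in> hom k A B \<Longrightarrow> continuous_map k A B f"
  by (simp add: hom_def)

lemma hom_Field: "f \<in> hom k A B \<Longrightarrow> x \<in> Field A \<Longrightarrow> f x \<in> Field B"
  by (rule continuous_map_Field[OF hom_continuous])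

lemma restrict_hom: "continuous_map k A B f \<Longrightarrow> Partial_order A \<Longrightarrow> restrict f (Field A) \<in> hom k A B"
  unfolding hom_eq_cmaps by (rule restrict_cmaps)

lemma hom_eqI: "f \<in> hom k A B \<Longrightarrow> g \<in> hom k A B' \<Longrightarrow> (\<And>x. x \<in> Field A \<Longrightarrow> f x = g x) \<Longrightarrow> f = g"
  unfolding hom_eq_cmaps by (rule cmaps_eqI)

lemma hom_orderI:
  "f \<in> hom k A B \<Longrightarrow> g \<in> hom k A B \<Longrightarrow> (\<And>x. x \<in> Field A \<Longrightarrow> (f x, g x) \<in> B) \<Longrightarrow>
    (f, g) \<in> hom_order k A B"
  by (simp add: hom_order_def)

lemma hom_orderD: "(f, g) \<in> hom_order k A B \<Longrightarrow> x \<in> Field A \<Longrightarrow> (f x, g x) \<in> B"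
  by (simp add: hom_order_def)

lemma compose_ident_right: "f \<in> hom k A B \<Longrightarrow> compose (Field A) f (ident A) = f"
  unfolding ident_def
  by (rule compose_Id) (auto simp: hom_Field hom_eq_cmaps cmaps_extensional intro: cmaps_Field)

lemma compose_ident_left: "f \<in> hom k A B \<Longrightarrow> compose (Field A) (ident B) f = f"
  unfolding ident_def
  by (rule Id_compose) (auto simp: hom_Field hom_eq_cmaps cmaps_extensional intro: cmaps_Field)

locale endofunctor =
  fixes k :: kind and F :: "'u endo"
  assumes universe: "universe TYPE('u)" and enriched: "enriched_endofunctor k F"
begin

abbreviation F_obj :: "'u rel \<Rightarrow> 'u rel" where
  "F_obj \<equiv> on_obj F"

abbreviation F_fin :: "'u set \<Rightarrow> 'u rel" where
  "F_fin n \<equiv> on_obj F (Id_on n)"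

lemma F_obj: "A \<in> obj k \<Longrightarrow> F_obj A \<in> obj k"
  using enriched by (simp add: enriched_endofunctor_def)

lemma F_po: "A \<in> obj k \<Longrightarrow> Partial_order (F_obj A)"
  by (rule obj_po[OF F_obj])

lemma F_hom_continuous:
  "A \<in> obj k \<Longrightarrow> B \<in> obj k \<Longrightarrow>
    continuous_map k (hom_order k A B) (hom_order k (F_obj A) (F_obj B)) (on_hom F A B)"
  using enriched by (simp add: enriched_endofunctor_def)

lemma F_hom:
  assumes "A \<in> obj k" "B \<in> obj k" "f \<in> hom k A B"
  shows "on_hom F A B f \<in> hom k (F_obj A) (F_obj B)"
  using continuous_map_Field[OF F_hom_continuous[OF assms(1,2)], of f] assms(3)
    obj_po[OF assms(2)] F_po[OF assms(2)]
  by (simp add: hom_order_eq_cmaps_order hom_eq_cmaps)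

lemma F_continuous:
  "A \<in> obj k \<Longrightarrow> B \<in> obj k \<Longrightarrow> f \<in> hom k A B \<Longrightarrow>
    continuous_map k (F_obj A) (F_obj B) (on_hom F A B f)"
  by (rule hom_continuous[OF F_hom])

lemma F_Field:
  "A \<in> obj k \<Longrightarrow> B \<in> obj k \<Longrightarrow> f \<in> hom k A B \<Longrightarrow> t \<in> Field (F_obj A) \<Longrightarrow>
    on_hom F A B f t \<in> Field (F_obj B)"
  by (rule hom_Field[OF F_hom])

lemma F_hom_mono:
  "A \<in> obj k \<Longrightarrow> B \<in> obj k \<Longrightarrow> (f, g) \<in> hom_order k A B \<Longrightarrow>
    (on_hom F A B f, on_hom F A B g) \<in> hom_order k (F_obj A) (F_obj B)"
  by (rule continuous_map_mono[OF F_hom_continuous])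

lemma F_ident_hom: "A \<in> obj k \<Longrightarrow> on_hom F A A (ident A) = ident (F_obj A)"
  using enriched by (simp add: enriched_endofunctor_def)

lemma F_compose_hom:
  "A \<in> obj k \<Longrightarrow> B \<in> obj k \<Longrightarrow> C \<in> obj k \<Longrightarrow> f \<in> hom k A B \<Longrightarrow> g \<in> hom k B C \<Longrightarrow>
    on_hom F A C (compose (Field A) g f) =
      compose (Field (F_obj A)) (on_hom F B C g) (on_hom F A B f)"
  using enriched by (simp add: enriched_endofunctor_def)

lemma F_ident: "A \<in> obj k \<Longrightarrow> t \<in> Field (F_obj A) \<Longrightarrow> on_hom F A A (ident A) t = t"
  by (subst F_ident_hom) (simp_all add: ident_def)

lemma F_compose:
  "A \<in> obj k \<Longrightarrow> B \<in> obj k \<Longrightarrow> C \<in> obj k \<Longrightarrow> f \<in> hom k A B \<Longrightarrow> g \<in> hom k B C \<Longrightarrow>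
    t \<in> Field (F_obj A) \<Longrightarrow>
    on_hom F A C (compose (Field A) g f) t = on_hom F B C g (on_hom F A B f t)"
  by (simp add: F_compose_hom compose_eq)

text \<open>Local continuity in the form in which it is used: at a fixed element \<open>t\<close>,
  the functor acts continuously in the morphism.\<close>

lemma F_eval_continuous:
  assumes "A \<in> obj k" "B \<in> obj k" "t \<in> Field (F_obj A)"
  shows "continuous_map k (hom_order k A B) (F_obj B) (\<lambda>f. on_hom F A B f t)"
  using continuous_map_compose[OF F_hom_continuous[OF assms(1,2)], of "F_obj B" "\<lambda>f. f t"]
    cmaps_order_eval_continuous[OF obj_complete[OF F_obj[OF assms(2)]] F_po[OF assms(1)] assms(3)]
  by (simp add: hom_order_eq_cmaps_order)

section \<open>Tuples as morphisms out of finite discrete objects\<close>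

lemma Id_on_obj: "finite n \<Longrightarrow> Id_on (n :: 'u set) \<in> obj k"
  by (rule discrete_obj[OF universe])

lemma fin_hom: "C \<in> obj k \<Longrightarrow> f \<in> n \<rightarrow>\<^sub>E Field C \<Longrightarrow> f \<in> hom k (Id_on n) C"
  by (simp add: hom_Id_on obj_po)

abbreviation F_act :: "'u set \<Rightarrow> 'u rel \<Rightarrow> ('u \<Rightarrow> 'u) \<Rightarrow> 'u \<Rightarrow> 'u" where
  "F_act n C f \<equiv> on_hom F (Id_on n) C f"

lemma F_act_Field:
  "finite n \<Longrightarrow> C \<in> obj k \<Longrightarrow> f \<in> n \<rightarrow>\<^sub>E Field C \<Longrightarrow> t \<in> Field (F_fin n) \<Longrightarrow> F_act n C f t \<in> Field (F_obj C)"
  by (rule F_Field[OF Id_on_obj]) (auto intro: fin_hom)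

lemma F_act_continuous:
  "finite n \<Longrightarrow> C \<in> obj k \<Longrightarrow> f \<in> n \<rightarrow>\<^sub>E Field C \<Longrightarrow> continuous_map k (F_fin n) (F_obj C) (F_act n C f)"
  by (rule F_continuous[OF Id_on_obj]) (auto intro: fin_hom)

lemma F_act_eval_continuous:
  "finite n \<Longrightarrow> C \<in> obj k \<Longrightarrow> t \<in> Field (F_fin n) \<Longrightarrow>
    continuous_map k (power_order k n C) (F_obj C) (\<lambda>f. F_act n C f t)"
  using F_eval_continuous[OF Id_on_obj, of n C t] by (simp add: hom_order_eq_cmaps_order)

lemma F_act_compose:
  assumes "finite n" "C \<in> obj k" "D \<in> obj k" "f \<in> n \<rightarrow>\<^sub>E Field C" "g \<in> hom k C D" "t \<in> Field (F_fin n)"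
  shows "on_hom F C D g (F_act n C f t) = F_act n D (compose n g f) t"
  using F_compose[OF Id_on_obj[OF assms(1)] assms(2,3) fin_hom[OF assms(2,4)] assms(5,6)] by simp

lemma F_act_reindex:
  assumes "finite n" "finite m" "C \<in> obj k" "g \<in> n \<rightarrow>\<^sub>E m" "f \<in> m \<rightarrow>\<^sub>E Field C" "t \<in> Field (F_fin n)"
  shows "F_act m C f (F_act n (Id_on m) g t) = F_act n C (compose n f g) t"
  using F_act_compose[OF assms(1) Id_on_obj[OF assms(2)] assms(3) _ fin_hom[OF assms(3,5)] assms(6)] assms(4)
  by simp

text \<open>
  The universal property of \<open>F C\<close> as the coend of \<open>C\<^sup>n \<times> F n\<close> over finite sets \<open>n\<close>; by cartesian
  closedness a cocone can be described as a family continuous in each of its two arguments.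
\<close>

definition finite_points :: "'u rel \<Rightarrow> 'u set" where
  "finite_points C = {F_act n C f t |n f t. finite n \<and> f \<in> n \<rightarrow>\<^sub>E Field C \<and> t \<in> Field (F_fin n)}"

definition family :: "'u rel \<Rightarrow> 'u rel \<Rightarrow> ('u set \<Rightarrow> 'u \<Rightarrow> ('u \<Rightarrow> 'u) \<Rightarrow> 'u) \<Rightarrow> bool" where
  "family C X \<theta> \<longleftrightarrow>
     (\<forall>n f. finite n \<and> f \<in> n \<rightarrow>\<^sub>E Field C \<longrightarrow> continuous_map k (F_fin n) X (\<lambda>t. \<theta> n t f)) \<and>
     (\<forall>n t. finite n \<and> t \<in> Field (F_fin n) \<longrightarrow> continuous_map k (power_order k n C) X (\<theta> n t)) \<and>
     (\<forall>n m g f t. finite n \<and> finite m \<and> g \<in> n \<rightarrow>\<^sub>E m \<and> f \<in> m \<rightarrow>\<^sub>E Field C \<and> t \<in> Field (F_fin n) \<longrightarrow>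
        \<theta> m (F_act n (Id_on m) g t) f = \<theta> n t (compose n f g))"

definition extensible :: "'u rel \<Rightarrow> bool" where
  "extensible C \<longleftrightarrow> (\<forall>X\<in>obj k. \<forall>\<theta>. family C X \<theta> \<longrightarrow>
     (\<exists>h. continuous_map k (F_obj C) X h \<and>
       (\<forall>n f t. finite n \<and> f \<in> n \<rightarrow>\<^sub>E Field C \<and> t \<in> Field (F_fin n) \<longrightarrow>
          h (F_act n C f t) = \<theta> n t f)))"

text \<open>The halves are kept apart because generation can be inherited without extensibility;
  together they give existence and uniqueness of the map induced by a family.\<close>

definition is_coend :: "'u rel \<Rightarrow> bool" where
  "is_coend C \<longleftrightarrow> generates k (F_obj C) (finite_points C) \<and> extensible C"

lemma familyI:
  assumes "\<And>n f. finite n \<Longrightarrow> f \<in> n \<rightarrow>\<^sub>E Field C \<Longrightarrow> continuous_map k (F_fin n) X (\<lambda>t. \<theta> n t f)"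
    and "\<And>n t. finite n \<Longrightarrow> t \<in> Field (F_fin n) \<Longrightarrow> continuous_map k (power_order k n C) X (\<theta> n t)"
    and "\<And>n m g f t. finite n \<Longrightarrow> finite m \<Longrightarrow> g \<in> n \<rightarrow>\<^sub>E m \<Longrightarrow> f \<in> m \<rightarrow>\<^sub>E Field C \<Longrightarrow> t \<in> Field (F_fin n) \<Longrightarrow>
      \<theta> m (F_act n (Id_on m) g t) f = \<theta> n t (compose n f g)"
  shows "family C X \<theta>"
  unfolding family_def
  by (intro conjI allI impI; elim conjE; (rule assms(1) | rule assms(2) | rule assms(3)); assumption)

lemma familyD:
  assumes "family C X \<theta>"
  shows family_left: "finite n \<Longrightarrow> f \<in> n \<rightarrow>\<^sub>E Field C \<Longrightarrow> continuous_map k (F_fin n) X (\<lambda>t. \<theta> n t f)"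
    and family_right:
      "finite n \<Longrightarrow> t \<in> Field (F_fin n) \<Longrightarrow> continuous_map k (power_order k n C) X (\<theta> n t)"
    and family_natural:
      "finite n \<Longrightarrow> finite m \<Longrightarrow> g \<in> n \<rightarrow>\<^sub>E m \<Longrightarrow> f \<in> m \<rightarrow>\<^sub>E Field C \<Longrightarrow> t \<in> Field (F_fin n) \<Longrightarrow>
        \<theta> m (F_act n (Id_on m) g t) f = \<theta> n t (compose n f g)"
  by (rule assms[unfolded family_def, THEN conjunct1, rule_format]; simp)
    (rule assms[unfolded family_def, THEN conjunct2, THEN conjunct1, rule_format]
      assms[unfolded family_def, THEN conjunct2, THEN conjunct2, rule_format]; simp)+

lemma extensibleD:
  assumes "extensible C" "X \<in> obj k" "family C X \<theta>"
  shows "\<exists>h. continuous_map k (F_obj C) X h \<and>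
    (\<forall>n f t. finite n \<and> f \<in> n \<rightarrow>\<^sub>E Field C \<and> t \<in> Field (F_fin n) \<longrightarrow> h (F_act n C f t) = \<theta> n t f)"
  by (rule assms(1)[unfolded extensible_def, THEN bspec, OF assms(2), THEN spec, THEN mp, OF assms(3)])

lemma finite_points_subset: "C \<in> obj k \<Longrightarrow> finite_points C \<subseteq> Field (F_obj C)"
  unfolding finite_points_def by (auto intro: F_act_Field)

lemma finite_points_eqI:
  assumes "is_coend C" "Partial_order X" "continuous_map k (F_obj C) X h" "continuous_map k (F_obj C) X h'"
    and "\<And>n f t. finite n \<Longrightarrow> f \<in> n \<rightarrow>\<^sub>E Field C \<Longrightarrow> t \<in> Field (F_fin n) \<Longrightarrow>
      h (F_act n C f t) = h' (F_act n C f t)"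
    and "x \<in> Field (F_obj C)"
  shows "h x = h' x"
  by (rule continuous_eq_on_generators[of k "F_obj C" "finite_points C" X h h'])
    (use assms in \<open>auto simp: is_coend_def finite_points_def\<close>)

lemma finite_points_leI:
  assumes "generates k (F_obj C) (finite_points C)" "Partial_order X"
    and "continuous_map k (F_obj C) X h" "continuous_map k (F_obj C) X h'"
    and "\<And>n f t. finite n \<Longrightarrow> f \<in> n \<rightarrow>\<^sub>E Field C \<Longrightarrow> t \<in> Field (F_fin n) \<Longrightarrow>
      (h (F_act n C f t), h' (F_act n C f t)) \<in> X"
    and "x \<in> Field (F_obj C)"
  shows "(h x, h' x) \<in> X"
  by (rule continuous_le_on_generators[of k "F_obj C" "finite_points C" X h h'])
    (use assms in \<open>auto simp: finite_points_def\<close>)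

section \<open>Strong finitarity is the coend formula\<close>

lemma coend_imp_strongly_finitary:
  assumes coend: "\<And>C. C \<in> obj k \<Longrightarrow> is_coend C"
  shows "strongly_finitary k F"
  unfolding strongly_finitary_def
proof (intro allI impI)
  fix G :: "'u endo" and \<sigma>
  assume "enriched_endofunctor k G" and \<sigma>: "K_nat_trans k F G \<sigma>"
  then interpret G: endofunctor k G by unfold_locales (rule universe)
  have \<sigma>_hom: "\<sigma> n \<in> hom k (F_fin n) (G.F_fin n)" if "finite n" for n
    using \<sigma> that by (auto simp: K_nat_trans_def)
  have \<sigma>_Field: "\<sigma> n t \<in> Field (G.F_fin n)" if "finite n" "t \<in> Field (F_fin n)" for n t
    using hom_Field[OF \<sigma>_hom] that by blast
  have \<sigma>_nat: "G.F_act n (Id_on m) g (\<sigma> n t) = \<sigma> m (F_act n (Id_on m) g t)"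
    if "finite n" "finite m" "g \<in> n \<rightarrow>\<^sub>E m" "t \<in> Field (F_fin n)" for n m g t
  proof -
    have "compose (Field (F_fin n)) (G.F_act n (Id_on m) g) (\<sigma> n) =
        compose (Field (F_fin n)) (\<sigma> m) (F_act n (Id_on m) g)"
      using \<sigma> that by (auto simp: K_nat_trans_def)
    from fun_cong[OF this, of t] that show ?thesis by (simp add: compose_eq)
  qed
  \<comment> \<open>Forced by naturality: a transformation extending \<open>\<sigma>\<close> has to
    send \<open>F f t\<close> to \<open>G f (\<sigma> n t)\<close>.\<close>
  let ?\<theta> = "\<lambda>C n t f. G.F_act n C f (\<sigma> n t)"
  have fam: "family C (G.F_obj C) (?\<theta> C)" if C: "C \<in> obj k" for C
  proof (rule familyI)
    show "continuous_map k (F_fin n) (G.F_obj C) (\<lambda>t. ?\<theta> C n t f)"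
      if "finite n" "f \<in> n \<rightarrow>\<^sub>E Field C" for n f
      by (rule continuous_map_compose[OF hom_continuous[OF \<sigma>_hom[OF that(1)]]
            G.F_act_continuous[OF that(1) C that(2)]])
    show "continuous_map k (power_order k n C) (G.F_obj C) (?\<theta> C n t)"
      if "finite n" "t \<in> Field (F_fin n)" for n t
      using that by (intro G.F_act_eval_continuous C \<sigma>_Field)
    fix n m :: "'u set" and g f t
    assume a: "finite n" "finite m" "g \<in> n \<rightarrow>\<^sub>E m" "f \<in> m \<rightarrow>\<^sub>E Field C" "t \<in> Field (F_fin n)"
    show "?\<theta> C m (F_act n (Id_on m) g t) f = ?\<theta> C n t (compose n f g)"
      using G.F_act_reindex[OF a(1,2) C a(3,4) \<sigma>_Field[OF a(1,5)]] \<sigma>_nat[OF a(1,2,3,5)] by simp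
  qed
  have "\<exists>h. continuous_map k (F_obj C) (G.F_obj C) h \<and>
      (\<forall>n f t. finite n \<and> f \<in> n \<rightarrow>\<^sub>E Field C \<and> t \<in> Field (F_fin n) \<longrightarrow> h (F_act n C f t) = ?\<theta> C n t f)"
    if "C \<in> obj k" for C
    using coend[OF that] G.F_obj[OF that] fam[OF that] unfolding is_coend_def extensible_def by blast
  then obtain h where h: "\<And>C. C \<in> obj k \<Longrightarrow> continuous_map k (F_obj C) (G.F_obj C) (h C)"
    "\<And>C n f t. C \<in> obj k \<Longrightarrow> finite n \<Longrightarrow> f \<in> n \<rightarrow>\<^sub>E Field C \<Longrightarrow> t \<in> Field (F_fin n) \<Longrightarrow>
      h C (F_act n C f t) = ?\<theta> C n t f" by metis
  \<comment> \<open>Restricted both to objects and to carriers, so that uniqueness can hold as an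
    equation between functions.\<close>
  define \<tau> where "\<tau> = (\<lambda>C\<in>obj k. restrict (h C) (Field (F_obj C)))"
  have \<tau>: "\<tau> C x = h C x" if "C \<in> obj k" "x \<in> Field (F_obj C)" for C x
    using that by (simp add: \<tau>_def)
  have nat: "nat_trans k F G \<tau>"
    unfolding nat_trans_def
  proof (intro conjI ballI)
    show "\<tau> \<in> (\<Pi>\<^sub>E A\<in>obj k. hom k (F_obj A) (G.F_obj A))"
      unfolding \<tau>_def by (auto intro: restrict_hom h(1) F_po)
    fix A B :: "'u rel" and f assume A: "A \<in> obj k" and B: "B \<in> obj k" and f: "f \<in> hom k A B"
    have "on_hom G A B f (h A x) = h B (on_hom F A B f x)" if x: "x \<in> Field (F_obj A)" for x
    proof (rule finite_points_eqI[OF coend[OF A] G.F_po[OF B] _ _ _ x])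
      show "continuous_map k (F_obj A) (G.F_obj B) (\<lambda>x. on_hom G A B f (h A x))"
        by (rule continuous_map_compose[OF h(1)[OF A] G.F_continuous[OF A B f]])
      show "continuous_map k (F_obj A) (G.F_obj B) (\<lambda>x. h B (on_hom F A B f x))"
        by (rule continuous_map_compose[OF F_continuous[OF A B f] h(1)[OF B]])
      fix n :: "'u set" and a t assume a: "finite n" "a \<in> n \<rightarrow>\<^sub>E Field A" "t \<in> Field (F_fin n)"
      have fa: "compose n f a \<in> n \<rightarrow>\<^sub>E Field B"
        using a(2) hom_Field[OF f] by (auto simp: compose_def)
      show "on_hom G A B f (h A (F_act n A a t)) = h B (on_hom F A B f (F_act n A a t))"
        by (simp add: F_act_compose[OF a(1) A B a(2) f a(3)] h(2)[OF A a] h(2)[OF B a(1) fa a(3)]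
            G.F_act_compose[OF a(1) A B a(2) f \<sigma>_Field[OF a(1,3)]])
    qed
    then show "compose (Field (F_obj A)) (on_hom G A B f) (\<tau> A) =
        compose (Field (F_obj A)) (\<tau> B) (on_hom F A B f)"
      unfolding compose_def by (intro restrict_ext) (simp add: \<tau> A B F_Field[OF A B f])
  qed
  have ext: "\<tau> (Id_on n) = \<sigma> n" if n: "finite n" for n
  proof (rule hom_eqI[OF _ \<sigma>_hom[OF n]])
    note N = Id_on_obj[OF n]
    show "\<tau> (Id_on n) \<in> hom k (F_fin n) (G.F_fin n)"
      using N nat by (auto simp: nat_trans_def)
    fix t assume t: "t \<in> Field (F_fin n)"
    \<comment> \<open>As \<open>F\<close> preserves identities, every \<open>t\<close> is itself the
      finite point of the identity tuple, where the value of \<open>h\<close> is prescribed.\<close>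
    have i: "ident (Id_on n) \<in> n \<rightarrow>\<^sub>E Field (Id_on n)" by (auto simp: ident_def)
    have "\<tau> (Id_on n) t = h (Id_on n) (F_act n (Id_on n) (ident (Id_on n)) t)"
      using \<tau>[OF N t] F_ident[OF N t] by simp
    also have "\<dots> = \<sigma> n t"
      using h(2)[OF N n i t] G.F_ident[OF N \<sigma>_Field[OF n t]] by simp
    finally show "\<tau> (Id_on n) t = \<sigma> n t" .
  qed
  show "\<exists>!\<tau>. nat_trans k F G \<tau> \<and> (\<forall>n. finite n \<longrightarrow> \<tau> (Id_on n) = \<sigma> n)"
  proof (rule ex1I[of _ \<tau>])
    show "nat_trans k F G \<tau> \<and> (\<forall>n. finite n \<longrightarrow> \<tau> (Id_on n) = \<sigma> n)" using nat ext by blast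
    fix \<tau>' assume \<tau>': "nat_trans k F G \<tau>' \<and> (\<forall>n. finite n \<longrightarrow> \<tau>' (Id_on n) = \<sigma> n)"
    have hom: "\<tau>' A \<in> hom k (F_obj A) (G.F_obj A)" if "A \<in> obj k" for A
      using \<tau>' that by (auto simp: nat_trans_def)
    have eq: "\<tau>' A x = h A x" if A: "A \<in> obj k" and x: "x \<in> Field (F_obj A)" for A x
    proof (rule finite_points_eqI[OF coend[OF A] G.F_po[OF A] hom_continuous[OF hom[OF A]] h(1)[OF A] _ x])
      fix n :: "'u set" and a t assume a: "finite n" "a \<in> n \<rightarrow>\<^sub>E Field A" "t \<in> Field (F_fin n)"
      \<comment> \<open>The tuple \<open>a\<close> is a morphism from a discrete object, so
        naturality of \<open>\<tau>'\<close> at \<open>a\<close> determines its value at the finite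
        point.\<close>
      have "compose (Field (F_fin n)) (G.F_act n A a) (\<tau>' (Id_on n)) =
          compose (Field (F_fin n)) (\<tau>' A) (F_act n A a)"
        using \<tau>' Id_on_obj[OF a(1)] A fin_hom[OF A a(2)] by (auto simp: nat_trans_def)
      from fun_cong[OF this, of t] \<tau>' a show "\<tau>' A (F_act n A a t) = h A (F_act n A a t)"
        by (simp add: compose_eq h(2)[OF A a])
    qed
    show "\<tau>' = \<tau>"
    proof
      fix A :: "'u rel" show "\<tau>' A = \<tau> A"
      proof (cases "A \<in> obj k")
        case True
        then show ?thesis
          using nat eq \<tau> by (intro hom_eqI[OF hom[OF True]]) (auto simp: nat_trans_def)
      next
        case False
        then show ?thesis using \<tau>' by (auto simp: nat_trans_def \<tau>_def PiE_def extensional_def)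
      qed
    qed
  qed
qed

end

text \<open>
  The right Kan extension of \<open>X\<close> along \<open>C\<close>, i.e. the endofunctor \<open>A \<mapsto> [[A, C], X]\<close>: natural
  transformations from \<open>F\<close> into it correspond to morphisms \<open>F C \<rightarrow> X\<close>, and those from \<open>F K\<close> to the
  families on \<open>C\<close> with values in \<open>X\<close>. So strong finitarity can be tested against it.
\<close>

definition ran_order :: "kind \<Rightarrow> 'u rel \<Rightarrow> 'u rel \<Rightarrow> 'u rel \<Rightarrow> (('u \<Rightarrow> 'u) \<Rightarrow> 'u) rel" where
  "ran_order k C X A = cmaps_order k (cmaps_order k A C) X"

text \<open>Abstraction and application hide the coding of \<open>[[A, C], X]\<close>. Afterwards it
  is handled by the laws \<open>ran_app_abs\<close> and \<open>ran_abs_app\<close> and by continuity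
  in each argument.\<close>

definition ran_abs :: "kind \<Rightarrow> 'u rel \<Rightarrow> 'u rel \<Rightarrow> 'u rel \<Rightarrow> (('u \<Rightarrow> 'u) \<Rightarrow> 'u) \<Rightarrow> 'u" where
  "ran_abs k C X A H = encode (ran_order k C X A) (restrict H (cmaps k A C))"

definition ran_app :: "kind \<Rightarrow> 'u rel \<Rightarrow> 'u rel \<Rightarrow> 'u rel \<Rightarrow> 'u \<Rightarrow> ('u \<Rightarrow> 'u) \<Rightarrow> 'u" where
  "ran_app k C X A u = decode (ran_order k C X A) u"

definition ran :: "kind \<Rightarrow> 'u rel \<Rightarrow> 'u rel \<Rightarrow> 'u endo" where
  "ran k C X = \<lparr>on_obj = \<lambda>A. coded (ran_order k C X A),
     on_hom = \<lambda>A B f. restrict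
       (\<lambda>u. ran_abs k C X B (\<lambda>g. ran_app k C X A u (compose (Field A) g f)))
       (Field (coded (ran_order k C X A) :: 'u rel))\<rparr>"

lemma ran_abs_cong:
  "(\<And>g. g \<in> cmaps k A C \<Longrightarrow> H g = H' g) \<Longrightarrow> ran_abs k C X A H = ran_abs k C X A H'"
  unfolding ran_abs_def by (metis restrict_ext)

context
  fixes k :: kind and C X :: "'u rel"
  assumes universe: "universe TYPE('u)" and C: "C \<in> obj k" and X: "X \<in> obj k"
begin

lemma ran_on_obj: "on_obj (ran k C X) A = coded (ran_order k C X A)"
  by (simp add: ran_def)

lemma ran_on_hom:
  "u \<in> Field (on_obj (ran k C X) A) \<Longrightarrow>
    on_hom (ran k C X) A B f u = ran_abs k C X B (\<lambda>g. ran_app k C X A u (compose (Field A) g f))"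
  by (simp add: ran_def)

lemma Field_hom_poset: "Field (cmaps_order k A C) = cmaps k A C"
  by (simp add: obj_po[OF C])

lemma hom_poset_po: "Partial_order (cmaps_order k A C)"
  by (rule cmaps_order_Partial_order[OF obj_po[OF C]])

lemma ran_order_complete: "complete_poset k (ran_order k C X A)"
  unfolding ran_order_def by (rule cmaps_order_complete[OF obj_complete[OF X] hom_poset_po])

lemma ran_order_po: "Partial_order (ran_order k C X A)"
  by (rule complete_poset_po[OF ran_order_complete])

lemma Field_ran_order: "Field (ran_order k C X A) = cmaps k (cmaps_order k A C) X"
  by (simp add: ran_order_def obj_po[OF X])

lemma ran_order_small: "A \<in> obj k \<Longrightarrow> Field (ran_order k C X A) \<prec> (UNIV :: 'u set)"
  unfolding Field_ran_order
  by (intro cmaps_lesspoll universe obj_small[OF X])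
    (unfold Field_hom_poset, intro cmaps_lesspoll universe obj_small[OF C] obj_small)

lemma ran_obj: "A \<in> obj k \<Longrightarrow> on_obj (ran k C X) A \<in> obj k"
  unfolding ran_on_obj by (rule coded_obj[OF ran_order_small ran_order_complete])

lemma ran_abs_continuous:
  assumes A: "A \<in> obj k" and q: "Partial_order q"
    and "\<And>z. z \<in> Field q \<Longrightarrow> continuous_map k (cmaps_order k A C) X (H z)"
    and "\<And>g. g \<in> cmaps k A C \<Longrightarrow> continuous_map k q X (\<lambda>z. H z g)"
  shows "continuous_map k q (on_obj (ran k C X) A) (\<lambda>z. ran_abs k C X A (H z))"
  unfolding ran_on_obj ran_abs_def
proof (rule continuous_map_compose[OF _ encode_continuous[OF ran_order_small[OF A] ran_order_po]])
  show "continuous_map k q (ran_order k C X A) (\<lambda>z. restrict (H z) (cmaps k A C))"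
    unfolding ran_order_def
  proof (rule continuous_into_cmaps_orderI[OF obj_complete[OF X] hom_poset_po q])
    show "restrict (H z) (cmaps k A C) \<in> cmaps k (cmaps_order k A C) X" if "z \<in> Field q" for z
      using restrict_cmaps[OF hom_poset_po assms(3)[OF that]] by (simp add: Field_hom_poset)
    show "continuous_map k q X (\<lambda>z. restrict (H z) (cmaps k A C) g)"
      if "g \<in> Field (cmaps_order k A C)" for g
      using assms(4)[of g] that by (simp add: Field_hom_poset)
  qed
qed

lemma ran_app_abs:
  assumes "A \<in> obj k" "continuous_map k (cmaps_order k A C) X H" "g \<in> cmaps k A C"
  shows "ran_app k C X A (ran_abs k C X A H) g = H g"
proof -
  have "restrict H (cmaps k A C) \<in> Field (ran_order k C X A)"
    using restrict_cmaps[OF hom_poset_po assms(2)] by (simp add: Field_ran_order Field_hom_poset)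
  then show ?thesis
    unfolding ran_app_def ran_abs_def using decode_encode[OF ran_order_small[OF assms(1)]] assms(3)
    by simp
qed

lemma ran_app_cmaps:
  "A \<in> obj k \<Longrightarrow> u \<in> Field (on_obj (ran k C X) A) \<Longrightarrow> ran_app k C X A u \<in> cmaps k (cmaps_order k A C) X"
  unfolding ran_app_def ran_on_obj
  using decode_Field[OF ran_order_small] by (simp add: Field_ran_order)

lemma ran_app_continuous:
  "A \<in> obj k \<Longrightarrow> u \<in> Field (on_obj (ran k C X) A) \<Longrightarrow>
    continuous_map k (cmaps_order k A C) X (ran_app k C X A u)"
  by (rule cmaps_continuous[OF ran_app_cmaps])

lemma ran_app_continuous_left:
  assumes "A \<in> obj k" "g \<in> cmaps k A C"
  shows "continuous_map k (on_obj (ran k C X) A) X (\<lambda>u. ran_app k C X A u g)"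
  unfolding ran_app_def ran_on_obj
proof (rule continuous_map_compose[OF decode_continuous[OF ran_order_small[OF assms(1)] ran_order_po]])
  show "continuous_map k (ran_order k C X A) X (\<lambda>\<phi>. \<phi> g)"
    unfolding ran_order_def using assms(2)
    by (intro cmaps_order_eval_continuous obj_complete[OF X] hom_poset_po) (simp add: Field_hom_poset)
qed

lemma ran_abs_app:
  assumes "A \<in> obj k" "u \<in> Field (on_obj (ran k C X) A)"
  shows "ran_abs k C X A (ran_app k C X A u) = u"
proof -
  have "restrict (ran_app k C X A u) (cmaps k A C) = ran_app k C X A u"
    using cmaps_extensional[OF ran_app_cmaps[OF assms]]
    by (simp add: Field_hom_poset extensional_restrict)
  then show ?thesis
    using encode_decode[OF ran_order_small[OF assms(1)]] assms(2)
    by (simp add: ran_abs_def ran_app_def ran_on_obj)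
qed

lemma ran_precompose_continuous:
  assumes "A \<in> obj k" "B \<in> obj k" "f \<in> hom k A B" "u \<in> Field (on_obj (ran k C X) A)"
  shows "continuous_map k (cmaps_order k B C) X (\<lambda>g. ran_app k C X A u (compose (Field A) g f))"
  by (rule continuous_map_compose[OF precompose_continuous[OF obj_complete[OF C] obj_po obj_po
        hom_continuous[OF assms(3)]] ran_app_continuous]) (use assms in auto)

lemma ran_compose_cmaps:
  "A \<in> obj k \<Longrightarrow> f \<in> hom k A B \<Longrightarrow> g \<in> cmaps k B C \<Longrightarrow> compose (Field A) g f \<in> cmaps k A C"
  for A B :: "'u rel"
  using compose_hom[of f k A B g C] obj_po[of A k] by (simp add: hom_eq_cmaps)

text \<open>A morphism \<open>f\<close> acts by evaluating at maps precomposed with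
  \<open>f\<close>; functoriality is the unit law and associativity of composition. Local continuity
  reduces to continuity of \<open>f \<mapsto> g f\<close> for fixed \<open>g\<close>, followed by
  the continuous functional coded by \<open>u\<close>.\<close>

lemma ran_enriched: "enriched_endofunctor k (ran k C X)"
  unfolding enriched_endofunctor_def
proof (intro conjI ballI)
  let ?G = "ran k C X"
  fix A :: "'u rel" assume A: "A \<in> obj k"
  then show "on_obj ?G A \<in> obj k" by (rule ran_obj)
  note pA = obj_po[OF ran_obj[OF A]]
  have id_g: "compose (Field A) g (ident A) = g" if "g \<in> cmaps k A C" for g
    using that compose_ident_right by (simp add: hom_eq_cmaps)
  show "on_hom ?G A A (ident A) = ident (on_obj ?G A)"
    unfolding ident_def[of "on_obj ?G A"]
  proof
    fix u show "on_hom ?G A A (ident A) u = restrict (\<lambda>x. x) (Field (on_obj ?G A)) u"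
    proof (cases "u \<in> Field (on_obj ?G A)")
      case True
      have "ran_abs k C X A (\<lambda>g. ran_app k C X A u (compose (Field A) g (ident A))) =
          ran_abs k C X A (ran_app k C X A u)"
        by (rule ran_abs_cong) (simp add: id_g)
      with True show ?thesis by (simp add: ran_on_hom ran_abs_app[OF A])
    qed (simp add: ran_def)
  qed
  fix B :: "'u rel" assume B: "B \<in> obj k"
  have G_hom: "on_hom ?G A B f \<in> hom k (on_obj ?G A) (on_obj ?G B)" if f: "f \<in> hom k A B" for f
  proof -
    have "continuous_map k (on_obj ?G A) (on_obj ?G B)
        (\<lambda>u. ran_abs k C X B (\<lambda>g. ran_app k C X A u (compose (Field A) g f)))"
      by (intro ran_abs_continuous[OF B pA] ran_precompose_continuous[OF A B f]
          ran_app_continuous_left[OF A ran_compose_cmaps[OF A f]])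
    from restrict_hom[OF this pA] show ?thesis by (simp add: ran_def)
  qed
  show "continuous_map k (hom_order k A B) (hom_order k (on_obj ?G A) (on_obj ?G B)) (on_hom ?G A B)"
    unfolding hom_order_eq_cmaps_order
  proof (rule continuous_into_cmaps_orderI[OF obj_complete[OF ran_obj[OF B]] pA
        cmaps_order_Partial_order[OF obj_po[OF B]]])
    show "on_hom ?G A B f \<in> cmaps k (on_obj ?G A) (on_obj ?G B)" if "f \<in> Field (cmaps_order k A B)" for f
      using G_hom[of f] that obj_po[OF B] by (simp add: hom_eq_cmaps)
    fix u assume u: "u \<in> Field (on_obj ?G A)"
    have "continuous_map k (cmaps_order k A B) (on_obj ?G B)
        (\<lambda>f. ran_abs k C X B (\<lambda>g. ran_app k C X A u (compose (Field A) g f)))"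
    proof (rule ran_abs_continuous[OF B cmaps_order_Partial_order[OF obj_po[OF B]]])
      show "continuous_map k (cmaps_order k B C) X (\<lambda>g. ran_app k C X A u (compose (Field A) g f))"
        if "f \<in> Field (cmaps_order k A B)" for f
        using that obj_po[OF B] by (intro ran_precompose_continuous[OF A B _ u]) (simp add: hom_eq_cmaps)
      show "continuous_map k (cmaps_order k A B) X (\<lambda>f. ran_app k C X A u (compose (Field A) g f))"
        if "g \<in> cmaps k B C" for g
        by (rule continuous_map_compose[OF postcompose_continuous[OF obj_complete[OF B] obj_complete[OF C]
              obj_po[OF A] cmaps_continuous[OF that]] ran_app_continuous[OF A u]])
    qed
    then show "continuous_map k (cmaps_order k A B) (on_obj ?G B) (\<lambda>f. on_hom ?G A B f u)"
      using u by (simp add: ran_on_hom)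
  qed
  fix D :: "'u rel" and f g assume D: "D \<in> obj k" and f: "f \<in> hom k A B" and g: "g \<in> hom k B D"
  show "on_hom ?G A D (compose (Field A) g f) =
      compose (Field (on_obj ?G A)) (on_hom ?G B D g) (on_hom ?G A B f)"
  proof (rule hom_eqI)
    have gf: "compose (Field A) g f \<in> hom k A D" by (rule compose_hom[OF f g obj_po[OF A]])
    have "continuous_map k (on_obj ?G A) (on_obj ?G D)
        (\<lambda>u. ran_abs k C X D (\<lambda>e. ran_app k C X A u (compose (Field A) e (compose (Field A) g f))))"
      by (intro ran_abs_continuous[OF D pA] ran_precompose_continuous[OF A D gf]
          ran_app_continuous_left[OF A ran_compose_cmaps[OF A gf]])
    from restrict_hom[OF this pA]
    show "on_hom ?G A D (compose (Field A) g f) \<in> hom k (on_obj ?G A) (on_obj ?G D)"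
      by (simp add: ran_def)
    have "continuous_map k (on_obj ?G B) (on_obj ?G D)
        (\<lambda>u. ran_abs k C X D (\<lambda>e. ran_app k C X B u (compose (Field B) e g)))"
      by (intro ran_abs_continuous[OF D obj_po[OF ran_obj[OF B]]] ran_precompose_continuous[OF B D g]
          ran_app_continuous_left[OF B ran_compose_cmaps[OF B g]])
    from restrict_hom[OF this obj_po[OF ran_obj[OF B]]]
    have "on_hom ?G B D g \<in> hom k (on_obj ?G B) (on_obj ?G D)" by (simp add: ran_def)
    then show "compose (Field (on_obj ?G A)) (on_hom ?G B D g) (on_hom ?G A B f)
        \<in> hom k (on_obj ?G A) (on_obj ?G D)"
      by (rule compose_hom[OF G_hom[OF f] _ pA])
    fix u assume u: "u \<in> Field (on_obj ?G A)"
    have u': "on_hom ?G A B f u \<in> Field (on_obj ?G B)" by (rule hom_Field[OF G_hom[OF f] u])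
    have f': "f \<in> Field A \<rightarrow> Field B" using hom_Field[OF f] by auto
    \<comment> \<open>Both composites evaluate \<open>u\<close> at \<open>e\<close> precomposed with
      \<open>g\<close> and then \<open>f\<close>; they differ only by bracketing.\<close>
    have "ran_app k C X B (on_hom ?G A B f u) (compose (Field B) e g) =
        ran_app k C X A u (compose (Field A) e (compose (Field A) g f))" if e: "e \<in> cmaps k D C" for e
      unfolding ran_on_hom[OF u] compose_assoc[OF f']
      by (rule ran_app_abs[OF B ran_precompose_continuous[OF A B f u] ran_compose_cmaps[OF B g e]])
    then show "on_hom ?G A D (compose (Field A) g f) u =
        compose (Field (on_obj ?G A)) (on_hom ?G B D g) (on_hom ?G A B f) u"
      unfolding compose_eq[OF u] ran_on_hom[OF u] ran_on_hom[OF u', unfolded ran_on_hom[OF u]]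
      by (intro ran_abs_cong) (simp add: ran_on_hom[OF u])
  qed
qed

end

context endofunctor
begin

text \<open>The natural transformation corresponding to \<open>h : F C -> X\<close> in the style of
  Yoneda; evaluating its component at \<open>C\<close> in \<open>ident C\<close> gives
  \<open>h\<close> back.\<close>

definition ran_transpose :: "'u rel \<Rightarrow> 'u rel \<Rightarrow> ('u \<Rightarrow> 'u) \<Rightarrow> 'u rel \<Rightarrow> 'u \<Rightarrow> 'u" where
  "ran_transpose C X h = (\<lambda>A\<in>obj k. \<lambda>u\<in>Field (F_obj A). ran_abs k C X A (\<lambda>g. h (on_hom F A C g u)))"

lemma ran_transpose_continuous:
  assumes "A \<in> obj k" "C \<in> obj k" "continuous_map k (F_obj C) X h" "u \<in> Field (F_obj A)"
  shows "continuous_map k (cmaps_order k A C) X (\<lambda>g. h (on_hom F A C g u))"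
  using continuous_map_compose[OF F_eval_continuous[OF assms(1,2,4)] assms(3)]
  by (simp add: hom_order_eq_cmaps_order)

lemma ran_transpose_app:
  fixes C X :: "'u rel"
  assumes C: "C \<in> obj k" and X: "X \<in> obj k" and h: "continuous_map k (F_obj C) X h"
    and x: "x \<in> Field (F_obj C)"
  shows "ran_app k C X C (ran_transpose C X h C x) (ident C) = h x"
  using ran_app_abs[OF universe C X C ran_transpose_continuous[OF C C h x], of "ident C"]
    ident_hom[OF obj_po[OF C], of k] F_ident[OF C x] C x
  by (simp add: ran_transpose_def hom_eq_cmaps)

lemma ran_transpose_nat_trans:
  fixes C X :: "'u rel"
  assumes C: "C \<in> obj k" and X: "X \<in> obj k" and h: "continuous_map k (F_obj C) X h"
  shows "nat_trans k F (ran k C X) (ran_transpose C X h)"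
  unfolding nat_trans_def
proof (intro conjI ballI)
  let ?G = "ran k C X" and ?\<tau> = "ran_transpose C X h"
  note ctx = universe C X
  have hom: "?\<tau> A \<in> hom k (F_obj A) (on_obj ?G A)" if A: "A \<in> obj k" for A
  proof -
    have "continuous_map k (F_obj A) (on_obj ?G A) (\<lambda>u. ran_abs k C X A (\<lambda>g. h (on_hom F A C g u)))"
    proof (rule ran_abs_continuous[OF ctx A F_po[OF A] ran_transpose_continuous[OF A C h]])
      show "continuous_map k (F_obj A) X (\<lambda>u. h (on_hom F A C g u))" if "g \<in> cmaps k A C" for g
        using that continuous_map_compose[OF F_continuous[OF A C] h] by (simp add: hom_eq_cmaps)
    qed
    from restrict_hom[OF this F_po[OF A]] A show ?thesis by (simp add: ran_transpose_def)
  qed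
  then show "?\<tau> \<in> (\<Pi>\<^sub>E A\<in>obj k. hom k (F_obj A) (on_obj ?G A))"
    by (auto simp: ran_transpose_def)
  fix A B :: "'u rel" and f assume A: "A \<in> obj k" and B: "B \<in> obj k" and f: "f \<in> hom k A B"
  have "on_hom ?G A B f (?\<tau> A u) = ?\<tau> B (on_hom F A B f u)" if u: "u \<in> Field (F_obj A)" for u
  proof -
    have "ran_app k C X A (?\<tau> A u) (compose (Field A) g f) = h (on_hom F B C g (on_hom F A B f u))"
      if g: "g \<in> cmaps k B C" for g
      using ran_app_abs[OF ctx A ran_transpose_continuous[OF A C h u] ran_compose_cmaps[OF ctx A f g]]
        F_compose[OF A B C f _ u, of g] g A u
      by (simp add: ran_transpose_def hom_eq_cmaps)
    then show ?thesis
      using ran_on_hom[OF ctx hom_Field[OF hom[OF A] u]] B F_Field[OF A B f u]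
      by (simp add: ran_transpose_def[of C X h] cong: ran_abs_cong)
  qed
  then show "compose (Field (F_obj A)) (on_hom ?G A B f) (?\<tau> A) =
      compose (Field (F_obj A)) (?\<tau> B) (on_hom F A B f)"
    unfolding compose_def by (intro restrict_ext) simp
qed

text \<open>The transposes of \<open>h\<close> and \<open>h'\<close> into \<open>ran k C X\<close>
  restrict to the same transformation on finite discrete objects, so the uniqueness clause of strong
  finitarity identifies them. This is derived directly because generation will be deduced from
  it.\<close>

lemma strongly_finitary_unique:
  fixes C :: "'u rel"
  assumes sf: "strongly_finitary k F" and C: "C \<in> obj k" and X: "(X :: 'u rel) \<in> obj k"
    and h: "continuous_map k (F_obj C) X h" "continuous_map k (F_obj C) X h'"
    and eq: "\<And>x. x \<in> finite_points C \<Longrightarrow> h x = h' x" and x: "x \<in> Field (F_obj C)"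
  shows "h x = h' x"
proof -
  let ?G = "ran k C X"
  define \<sigma> where "\<sigma> = (\<lambda>n\<in>{n. finite n}. ran_transpose C X h (Id_on n))"
  note nat = ran_transpose_nat_trans[OF C X h(1)] and nat' = ran_transpose_nat_trans[OF C X h(2)]
  have "K_nat_trans k F ?G \<sigma>"
    unfolding K_nat_trans_def
  proof (intro conjI allI impI ballI; (elim conjE)?)
    show "\<sigma> \<in> (\<Pi>\<^sub>E n\<in>{n. finite n}. hom k (F_fin n) (on_obj ?G (Id_on n)))"
      using nat Id_on_obj by (auto simp: \<sigma>_def nat_trans_def)
    fix n m :: "'u set" and f assume "finite n" "finite m" "f \<in> n \<rightarrow>\<^sub>E m"
    then show "compose (Field (F_fin n)) (on_hom ?G (Id_on n) (Id_on m) f) (\<sigma> n) =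
        compose (Field (F_fin n)) (\<sigma> m) (F_act n (Id_on m) f)"
      using nat Id_on_obj fin_hom[OF Id_on_obj, of m f n] by (simp add: \<sigma>_def nat_trans_def)
  qed
  \<comment> \<open>The component at a finite discrete object involves \<open>h'\<close> only at
    finite points of \<open>C\<close>, where it agrees with \<open>h\<close>.\<close>
  moreover have "ran_transpose C X h' (Id_on n) = \<sigma> n" if n: "finite n" for n
  proof -
    have "h (F_act n C g u) = h' (F_act n C g u)"
      if "u \<in> Field (F_fin n)" "g \<in> cmaps k (Id_on n) C" for u g
      using that n by (intro eq) (auto simp: finite_points_def cmaps_Id_on[OF obj_po[OF C]])
    then show ?thesis
      using n Id_on_obj[OF n] by (auto simp: \<sigma>_def ran_transpose_def intro!: restrict_ext ran_abs_cong)
  qed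
  ultimately have "ran_transpose C X h = ran_transpose C X h'"
    using sf[unfolded strongly_finitary_def, rule_format, OF ran_enriched[OF universe C X]] nat nat'
    by (metis (mono_tags, lifting) \<sigma>_def mem_Collect_eq restrict_apply')
  then show ?thesis using ran_transpose_app[OF C X h(1) x] ran_transpose_app[OF C X h(2) x] by simp
qed

text \<open>A family on \<open>C\<close> is the same thing as a transformation from
  \<open>F K\<close> into the Kan extension restricted along \<open>K\<close>. Strong finitarity
  extends it to all objects, and its component at \<open>C\<close> contains the map sought.\<close>

lemma strongly_finitary_extensible:
  fixes C :: "'u rel"
  assumes sf: "strongly_finitary k F" and C: "C \<in> obj k"
  shows "extensible C"
  unfolding extensible_def
proof (intro ballI allI impI)
  fix X :: "'u rel" and \<theta> assume X: "X \<in> obj k" and \<theta>: "family C X \<theta>"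
  let ?G = "ran k C X"
  note ctx = universe C X
  define \<sigma> where "\<sigma> = (\<lambda>n\<in>{n. finite n}. \<lambda>t\<in>Field (F_fin n). ran_abs k C X (Id_on n) (\<theta> n t))"
  have \<theta>_cont: "continuous_map k (cmaps_order k (Id_on n) C) X (\<theta> n t)"
    if "finite n" "t \<in> Field (F_fin n)" for n t
    by (rule family_right[OF \<theta> that])
  have \<sigma>_hom: "\<sigma> n \<in> hom k (F_fin n) (on_obj ?G (Id_on n))" if n: "finite n" for n
  proof -
    have "continuous_map k (F_fin n) (on_obj ?G (Id_on n)) (\<lambda>t. ran_abs k C X (Id_on n) (\<theta> n t))"
      by (intro ran_abs_continuous[OF ctx Id_on_obj[OF n] F_po[OF Id_on_obj[OF n]]] \<theta>_cont n
          family_left[OF \<theta> n]) (simp_all add: cmaps_Id_on[OF obj_po[OF C]])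
    from restrict_hom[OF this F_po[OF Id_on_obj[OF n]]] n show ?thesis by (simp add: \<sigma>_def)
  qed
  have \<sigma>_app: "ran_app k C X (Id_on n) (\<sigma> n t) f = \<theta> n t f"
    if "finite n" "t \<in> Field (F_fin n)" "f \<in> n \<rightarrow>\<^sub>E Field C" for n t f
    using ran_app_abs[OF ctx Id_on_obj[OF that(1)] \<theta>_cont[OF that(1,2)], of f] that
    by (simp add: \<sigma>_def cmaps_Id_on[OF obj_po[OF C]])
  have "K_nat_trans k F ?G \<sigma>"
    unfolding K_nat_trans_def
  proof (intro conjI allI impI ballI; (elim conjE)?)
    show "\<sigma> \<in> (\<Pi>\<^sub>E n\<in>{n. finite n}. hom k (F_fin n) (on_obj ?G (Id_on n)))"
      using \<sigma>_hom by (auto simp: \<sigma>_def)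
    fix n m :: "'u set" and g assume n: "finite n" and m: "finite m" and g: "g \<in> n \<rightarrow>\<^sub>E m"
    have "on_hom ?G (Id_on n) (Id_on m) g (\<sigma> n t) = \<sigma> m (F_act n (Id_on m) g t)"
      if t: "t \<in> Field (F_fin n)" for t
    proof -
      have "ran_app k C X (Id_on n) (\<sigma> n t) (compose n f g) = \<theta> m (F_act n (Id_on m) g t) f"
        if f: "f \<in> cmaps k (Id_on m) C" for f
      proof -
        have f': "f \<in> m \<rightarrow>\<^sub>E Field C" using f by (simp add: cmaps_Id_on[OF obj_po[OF C]])
        then have "compose n f g \<in> n \<rightarrow>\<^sub>E Field C" using g by (auto simp: compose_def)
        then show ?thesis using \<sigma>_app[OF n t] family_natural[OF \<theta> n m g f' t] by simp
      qed
      moreover have "F_act n (Id_on m) g t \<in> Field (F_fin m)"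
        using F_act_Field[OF n Id_on_obj[OF m] _ t] g by simp
      ultimately show ?thesis
        using ran_on_hom[OF ctx hom_Field[OF \<sigma>_hom[OF n] t], of "Id_on m" g] m
        by (simp add: \<sigma>_def[THEN fun_cong, of m] cong: ran_abs_cong)
    qed
    then show "compose (Field (F_fin n)) (on_hom ?G (Id_on n) (Id_on m) g) (\<sigma> n) =
        compose (Field (F_fin n)) (\<sigma> m) (F_act n (Id_on m) g)"
      unfolding compose_def by (intro restrict_ext) simp
  qed
  then obtain \<tau> where \<tau>: "nat_trans k F ?G \<tau>" "\<And>n. finite n \<Longrightarrow> \<tau> (Id_on n) = \<sigma> n"
    using sf[unfolded strongly_finitary_def, rule_format, OF ran_enriched[OF ctx]] by blast
  have \<tau>_hom: "\<tau> C \<in> hom k (F_obj C) (on_obj ?G C)" using \<tau>(1) C by (auto simp: nat_trans_def)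
  have i: "ident C \<in> cmaps k C C" using ident_hom[OF obj_po[OF C], of k] by (simp add: hom_eq_cmaps)
  show "\<exists>h. continuous_map k (F_obj C) X h \<and> (\<forall>n f t. finite n \<and> f \<in> n \<rightarrow>\<^sub>E Field C \<and>
      t \<in> Field (F_fin n) \<longrightarrow> h (F_act n C f t) = \<theta> n t f)"
  proof (intro exI conjI allI impI; (elim conjE)?)
    \<comment> \<open>Evaluation at \<open>ident C\<close> is the counit of the right Kan
      extension.\<close>
    show "continuous_map k (F_obj C) X (\<lambda>x. ran_app k C X C (\<tau> C x) (ident C))"
      by (rule continuous_map_compose[OF hom_continuous[OF \<tau>_hom] ran_app_continuous_left[OF ctx C i]])
    fix n f t assume n: "finite n" and f: "f \<in> n \<rightarrow>\<^sub>E Field C" and t: "t \<in> Field (F_fin n)"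
    note N = Id_on_obj[OF n] and fh = fin_hom[OF C f]
    have "compose (Field (F_fin n)) (on_hom ?G (Id_on n) C f) (\<tau> (Id_on n)) =
        compose (Field (F_fin n)) (\<tau> C) (F_act n C f)"
      using \<tau>(1) N C fh by (auto simp: nat_trans_def)
    from fun_cong[OF this, of t] t n \<tau>(2)
    have "\<tau> C (F_act n C f t) = on_hom ?G (Id_on n) C f (\<sigma> n t)" by (simp add: compose_eq)
    also have "\<dots> = ran_abs k C X C (\<lambda>g. ran_app k C X (Id_on n) (\<sigma> n t) (compose n g f))"
      using ran_on_hom[OF ctx hom_Field[OF \<sigma>_hom[OF n] t]] by simp
    finally have "ran_app k C X C (\<tau> C (F_act n C f t)) (ident C) =
        ran_app k C X (Id_on n) (\<sigma> n t) (compose n (ident C) f)"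
      using ran_app_abs[OF ctx C ran_precompose_continuous[OF ctx N C fh hom_Field[OF \<sigma>_hom[OF n] t]] i]
      by simp
    then show "ran_app k C X C (\<tau> C (F_act n C f t)) (ident C) = \<theta> n t f"
      using \<sigma>_app[OF n t f] compose_ident_left[OF fh] by simp
  qed
qed

text \<open>For generation, let \<open>T\<close> be a subobject containing the finite points. The
  finite points form a family with values in \<open>T\<close>, so extensibility gives a map from
  \<open>F C\<close> to \<open>T\<close>; followed by the inclusion it agrees with the identity on
  finite points, hence everywhere.\<close>

lemma strongly_finitary_imp_coend:
  fixes C :: "'u rel"
  assumes sf: "strongly_finitary k F" and C: "C \<in> obj k"
  shows "is_coend C"
  unfolding is_coend_def
proof
  show "extensible C" by (rule strongly_finitary_extensible[OF assms])
  show "generates k (F_obj C) (finite_points C)"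
  proof (rule generatesI_subobject[OF F_obj[OF C] finite_points_subset[OF C]])
    fix T assume T: "finite_points C \<subseteq> T" "T \<subseteq> Field (F_obj C)" "Restr (F_obj C) T \<in> obj k"
      "continuous_map k (Restr (F_obj C) T) (F_obj C) (\<lambda>x. x)"
    let ?X = "Restr (F_obj C) T"
    have pt: "F_act n C f t \<in> T" if "finite n" "f \<in> n \<rightarrow>\<^sub>E Field C" "t \<in> Field (F_fin n)" for n f t
      using T(1) that by (auto simp: finite_points_def)
    have fam: "family C ?X (\<lambda>n t f. F_act n C f t)"
    proof (rule familyI)
      show "continuous_map k (F_fin n) ?X (\<lambda>t. F_act n C f t)" if "finite n" "f \<in> n \<rightarrow>\<^sub>E Field C" for n f
        using that pt
        by (intro Restr_corestrict_continuous[OF F_act_continuous F_po F_po T(2)] Id_on_obj C)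
      show "continuous_map k (power_order k n C) ?X (\<lambda>f. F_act n C f t)"
        if "finite n" "t \<in> Field (F_fin n)" for n t
        using that pt
        by (intro Restr_corestrict_continuous[OF F_act_eval_continuous _ F_po T(2)]
            cmaps_order_Partial_order obj_po[OF C] C) (auto simp: Field_power_order[OF obj_po[OF C]])
    qed (simp add: F_act_reindex C)
    from extensibleD[OF strongly_finitary_extensible[OF assms] T(3) fam] obtain h
      where h: "continuous_map k (F_obj C) ?X h"
        "\<forall>n f t. finite n \<and> f \<in> n \<rightarrow>\<^sub>E Field C \<and> t \<in> Field (F_fin n) \<longrightarrow>
          h (F_act n C f t) = F_act n C f t" by (elim exE conjE)
    have "h x = x" if "x \<in> Field (F_obj C)" for x
      by (rule strongly_finitary_unique[OF sf C F_obj[OF C] continuous_map_compose[OF h(1) T(4)]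
            continuous_map_id _ that]) (auto simp: finite_points_def h(2))
    with h(1) show "\<exists>h. continuous_map k (F_obj C) ?X h \<and> (\<forall>x\<in>Field (F_obj C). h x = x)" by blast
  qed
qed

end

section \<open>Preservation of colimits from the coend formula\<close>

context endofunctor
begin

text \<open>Combines the coend formula with a presentation of \<open>C\<close>: a map out of
  \<open>F C\<close> may be given on tuples of representatives. Each \<open>\<phi> n t\<close>
  extends to the power of \<open>C\<close>; continuity in \<open>t\<close> and naturality in
  \<open>n\<close> are then checked on tuples of generators.\<close>

lemma extend_from_presentation:
  fixes C X :: "'u rel" and \<gamma> :: "'i \<times> 'b \<Rightarrow> 'u"
    and \<phi> :: "'u set \<Rightarrow> 'u \<Rightarrow> ('u \<Rightarrow> 'i \<times> 'b) \<Rightarrow> 'u"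
  assumes ext: "extensible C" and pres: "presents k J B R C \<gamma>" and X: "X \<in> obj k"
    and left: "\<And>n f. finite n \<Longrightarrow> f \<in> n \<rightarrow>\<^sub>E points J B \<Longrightarrow> continuous_map k (F_fin n) X (\<lambda>t. \<phi> n t f)"
    and right: "\<And>n t x f. finite n \<Longrightarrow> t \<in> Field (F_fin n) \<Longrightarrow> x \<in> n \<Longrightarrow> f \<in> n - {x} \<rightarrow>\<^sub>E points J B \<Longrightarrow>
      admissible k J B R X (\<lambda>p. \<phi> n t (f(x := p)))"
    and natural: "\<And>n m g f t. finite n \<Longrightarrow> finite m \<Longrightarrow> g \<in> n \<rightarrow>\<^sub>E m \<Longrightarrow> f \<in> m \<rightarrow>\<^sub>E points J B \<Longrightarrow>
      t \<in> Field (F_fin n) \<Longrightarrow> \<phi> m (F_act n (Id_on m) g t) f = \<phi> n t (compose n f g)"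
  shows "\<exists>h. continuous_map k (F_obj C) X h \<and>
    (\<forall>n f t. finite n \<and> f \<in> n \<rightarrow>\<^sub>E points J B \<and> t \<in> Field (F_fin n) \<longrightarrow>
      h (F_act n C (compose n \<gamma> f) t) = \<phi> n t f)"
proof -
  let ?P = "points J B"
  note C = presents_obj[OF pres] and gen = presents_generates[OF pres]
  note cC = obj_complete[OF C] and pC = obj_po[OF C] and pX = obj_po[OF X]
  have "\<exists>\<Phi>. continuous_map k (power_order k n C) X \<Phi> \<and> (\<forall>f \<in> n \<rightarrow>\<^sub>E ?P. \<Phi> (compose n \<gamma> f) = \<phi> n t f)"
    if "finite n" "t \<in> Field (F_fin n)" for n t
    using that right continuous_map_Field[OF left]
    by (intro power_extension[OF pres X that(1)]) blast+
  then obtain \<Phi> where \<Phi>: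
    "\<And>n t. finite n \<Longrightarrow> t \<in> Field (F_fin n) \<Longrightarrow> continuous_map k (power_order k n C) X (\<Phi> n t)"
    "\<And>n t f. finite n \<Longrightarrow> t \<in> Field (F_fin n) \<Longrightarrow> f \<in> n \<rightarrow>\<^sub>E ?P \<Longrightarrow> \<Phi> n t (compose n \<gamma> f) = \<phi> n t f"
    by metis
  have pw: "generates k (power_order k n C) (n \<rightarrow>\<^sub>E \<gamma> ` ?P)" if "finite n" for n :: "'u set"
    by (rule power_generates[OF cC gen that])
  have "family C X \<Phi>"
  proof (rule familyI[OF _ \<Phi>(1)])
    fix n :: "'u set" and f assume n: "finite n" and f: "f \<in> n \<rightarrow>\<^sub>E Field C"
    note pF = F_po[OF Id_on_obj[OF n]]
    from f have "f \<in> Field (power_order k n C)" by (simp add: Field_power_order[OF pC])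
    with pw[OF n] show "continuous_map k (F_fin n) X (\<lambda>t. \<Phi> n t f)"
    proof (induction rule: generates_induct)
      case (gen f)
      then obtain f' where f': "f' \<in> n \<rightarrow>\<^sub>E ?P" "f = compose n \<gamma> f'" using PiE_image_lift by blast
      then show ?case
        using left[OF n f'(1)] \<Phi>(2)[OF n _ f'(1)]
          continuous_map_cong[OF pF, of "\<lambda>t. \<Phi> n t f" "\<lambda>t. \<phi> n t f'"] by simp
    next
      case (join S f)
      show ?case
        by (rule continuous_map_pointwise_join[OF pX pF, where H = "\<lambda>f t. \<Phi> n t f" and S = S])
          (use continuous_map_join[OF \<Phi>(1)[OF n] join(1,2)] join(3) in auto)
    qed
  next
    fix n m :: "'u set" and g f t
    assume n: "finite n" and m: "finite m" and g: "g \<in> n \<rightarrow>\<^sub>E m" and f: "f \<in> m \<rightarrow>\<^sub>E Field C"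
      and t: "t \<in> Field (F_fin n)"
    have gt: "F_act n (Id_on m) g t \<in> Field (F_fin m)"
      using F_act_Field[OF n Id_on_obj[OF m] _ t] g by simp
    have g': "g \<in> n \<rightarrow> m" using g by auto
    show "\<Phi> m (F_act n (Id_on m) g t) f = \<Phi> n t (compose n f g)"
    proof (rule continuous_eq_on_generators[OF pw[OF m] pX \<Phi>(1)[OF m gt]
          continuous_map_compose[OF power_precompose_continuous[OF cC g'] \<Phi>(1)[OF n t]]])
      show "f \<in> Field (power_order k m C)" using f by (simp add: Field_power_order[OF pC])
      fix f assume "f \<in> m \<rightarrow>\<^sub>E \<gamma> ` ?P"
      then obtain f' where f': "f' \<in> m \<rightarrow>\<^sub>E ?P" "f = compose m \<gamma> f'" using PiE_image_lift by blast
      have "compose n f g = compose n \<gamma> (compose n f' g)"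
        using g' unfolding f'(2) by (intro compose_assoc[symmetric])
      moreover have "compose n f' g \<in> n \<rightarrow>\<^sub>E ?P" using f'(1) g by (auto simp: compose_def)
      ultimately show "\<Phi> m (F_act n (Id_on m) g t) f = \<Phi> n t (compose n f g)"
        using \<Phi>(2)[OF m gt f'(1)] \<Phi>(2)[OF n t] natural[OF n m g f'(1) t] f'(2) by simp
    qed
  qed
  from extensibleD[OF ext X this] obtain h where h: "continuous_map k (F_obj C) X h"
    "\<forall>n f t. finite n \<and> f \<in> n \<rightarrow>\<^sub>E Field C \<and> t \<in> Field (F_fin n) \<longrightarrow> h (F_act n C f t) = \<Phi> n t f"
    by (elim exE conjE)
  have "h (F_act n C (compose n \<gamma> f) t) = \<phi> n t f"
    if n: "finite n" and f: "f \<in> n \<rightarrow>\<^sub>E ?P" and t: "t \<in> Field (F_fin n)" for n f t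
  proof -
    have "compose n \<gamma> f \<in> n \<rightarrow>\<^sub>E Field C" using f generates_subset[OF gen] by (auto simp: compose_def)
    then have "h (F_act n C (compose n \<gamma> f) t) = \<Phi> n t (compose n \<gamma> f)"
      using n t by (intro h(2)[rule_format]) simp
    then show ?thesis using \<Phi>(2)[OF n t f] by simp
  qed
  with h(1) show ?thesis by (intro exI[of _ h]) simp
qed

text \<open>For fixed \<open>t\<close> the point \<open>F f t\<close> depends continuously on
  \<open>f\<close>, and tuples of generators generate the power of \<open>C\<close>.\<close>

lemma generates_from_generators:
  fixes C :: "'u rel"
  assumes gF: "generates k (F_obj C) (finite_points C)" and C: "C \<in> obj k" and G: "generates k C G"
  shows "generates k (F_obj C) {F_act n C f t |n f t. finite n \<and> f \<in> n \<rightarrow>\<^sub>E G \<and> t \<in> Field (F_fin n)}"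
    (is "generates _ _ ?G")
proof (rule generatesI)
  have "?G \<subseteq> finite_points C"
    using generates_subset[OF G] unfolding finite_points_def by (fastforce simp: PiE_iff)
  then show "?G \<subseteq> Field (F_obj C)" using generates_subset[OF gF] by (rule order_trans)
  fix T x assume T: "?G \<subseteq> T" "join_closed k (F_obj C) T" and x: "x \<in> Field (F_obj C)"
  have "F_act n C f t \<in> T" if n: "finite n" and f: "f \<in> n \<rightarrow>\<^sub>E Field C" and t: "t \<in> Field (F_fin n)" for n f t
  proof -
    have "Field (power_order k n C) \<subseteq> {f. F_act n C f t \<in> T}"
      using T(1) n t
      by (intro generatesD[OF power_generates[OF obj_complete[OF C] G n]]
          join_closed_vimage[OF F_act_eval_continuous[OF n C t] T(2)]) auto
    with f show ?thesis by (auto simp: Field_power_order[OF obj_po[OF C]])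
  qed
  then have "finite_points C \<subseteq> T" by (auto simp: finite_points_def)
  with generatesD[OF gF _ T(2)] x show "x \<in> T" by blast
qed

end

section \<open>Presentations of directed colimits and coinserters\<close>

lemma directed_diagramD:
  assumes "directed_diagram k I D d"
  shows "Partial_order I" "directed_in I (Field I)" "i \<in> Field I \<Longrightarrow> D i \<in> obj k"
    and "(i, j) \<in> I \<Longrightarrow> d i j \<in> hom k (D i) (D j)" "i \<in> Field I \<Longrightarrow> d i i = ident (D i)"
    and "(i, j) \<in> I \<Longrightarrow> (j, l) \<in> I \<Longrightarrow> compose (Field (D i)) (d j l) (d i j) = d i l"
  using assms unfolding directed_diagram_def by blast+

text \<open>Each identification of \<open>x\<close> with \<open>d i j x\<close> is expressed by two
  opposite inequations.\<close>

definition diagram_rel ::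
    "'u rel \<Rightarrow> ('u \<Rightarrow> 'u rel) \<Rightarrow> ('u \<Rightarrow> 'u \<Rightarrow> 'u \<Rightarrow> 'u) \<Rightarrow> (('u \<times> 'u) \<times> ('u \<times> 'u)) set" where
  "diagram_rel I D d =
     {((i, x), (j, d i j x)) |i j x. (i, j) \<in> I \<and> x \<in> Field (D i)} \<union>
     {((j, d i j x), (i, x)) |i j x. (i, j) \<in> I \<and> x \<in> Field (D i)}"

lemma colimitD:
  assumes "is_colimit k I D d C c"
  shows "C \<in> obj k" "i \<in> Field I \<Longrightarrow> c i \<in> hom k (D i) C"
    and "(i, j) \<in> I \<Longrightarrow> compose (Field (D i)) (c j) (d i j) = c i"
    and "cocone k I D d E e \<Longrightarrow>
      \<exists>!h. h \<in> hom k C E \<and> (\<forall>i\<in>Field I. compose (Field (D i)) h (c i) = e i)"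
  using assms unfolding is_colimit_def cocone_def by blast+

text \<open>A subobject \<open>T\<close> containing the images of all \<open>c i\<close> is the
  vertex of a cocone. The induced map \<open>C -> T\<close>, followed by the inclusion, is the
  identity by uniqueness of mediating maps, so the images generate.\<close>

lemma colimit_presents:
  fixes C :: "'u rel"
  assumes dd: "directed_diagram k I D d" and col: "is_colimit k I D d C c"
  shows "presents k (Field I) D (diagram_rel I D d) C (\<lambda>(i, x). c i x)"
proof -
  note D = directed_diagramD[OF dd] and C = colimitD(1)[OF col] and c = colimitD(2)[OF col]
  have c_hom: "continuous_map k (D i) C (c i)" if "i \<in> Field I" for i
    by (rule hom_continuous[OF c[OF that]])
  have c_comp: "c j (d i j x) = c i x" if "(i, j) \<in> I" "x \<in> Field (D i)" for i j x
    using fun_cong[OF colimitD(3)[OF col that(1)], of x] that by (simp add: compose_eq)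
  let ?G = "(\<lambda>(i, x). c i x) ` points (Field I) D"
  have "generates k C ?G"
  proof (rule generatesI_subobject[OF C])
    show "?G \<subseteq> Field C" using hom_Field[OF c] by (auto simp: points_def)
    fix T assume T: "?G \<subseteq> T" "T \<subseteq> Field C" "Restr C T \<in> obj k"
      "continuous_map k (Restr C T) C (\<lambda>x. x)"
    have cT: "c i x \<in> T" if "i \<in> Field I" "x \<in> Field (D i)" for i x
      using T(1) that by (force simp: points_def)
    have "c i \<in> hom k (D i) (Restr C T)" if i: "i \<in> Field I" for i
    proof -
      have "continuous_map k (D i) (Restr C T) (c i)"
        using cT i by (intro Restr_corestrict_continuous[OF c_hom[OF i] obj_po[OF D(3)[OF i]] obj_po[OF C] T(2)])
      with c[OF i] show ?thesis by (simp add: hom_def)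
    qed
    then have "cocone k I D d (Restr C T) c"
      using T(3) colimitD(3)[OF col] unfolding cocone_def by blast
    from colimitD(4)[OF col this] obtain h where h: "h \<in> hom k C (Restr C T)"
      "\<forall>i\<in>Field I. compose (Field (D i)) h (c i) = c i" by blast
    have "h \<in> hom k C C"
      using h(1) continuous_map_compose[OF hom_continuous[OF h(1)] T(4)] by (simp add: hom_def)
    moreover have "compose (Field (D i)) (ident C) (c i) = c i" if "i \<in> Field I" for i
      by (rule compose_ident_left[OF c[OF that]])
    moreover have "cocone k I D d C c" using col by (simp add: is_colimit_def)
    ultimately have "h = ident C"
      using colimitD(4)[OF col, of C c] h(2) ident_hom[OF obj_po[OF C], of k] by blast
    then show "\<exists>h. continuous_map k C (Restr C T) h \<and> (\<forall>x\<in>Field C. h x = x)"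
      using hom_continuous[OF h(1)] by (auto simp: ident_def)
  qed
  moreover have "\<exists>h. continuous_map k C X h \<and> (\<forall>p\<in>points (Field I) D. h (case p of (i, x) \<Rightarrow> c i x) = \<phi> p)"
    if X: "X \<in> obj k" and \<phi>: "admissible k (Field I) D (diagram_rel I D d) X \<phi>" for X :: "'u rel" and \<phi>
  proof -
    define e where "e i = restrict (\<lambda>b. \<phi> (i, b)) (Field (D i))" for i
    have e: "e i \<in> hom k (D i) X" if "i \<in> Field I" for i
      unfolding e_def using \<phi> that by (intro restrict_hom obj_po[OF D(3)]) (auto simp: admissible_def)
    have "\<phi> (j, d i j x) = \<phi> (i, x)" if "(i, j) \<in> I" "x \<in> Field (D i)" for i j x
    proof -
      have "((i, x), (j, d i j x)) \<in> diagram_rel I D d" "((j, d i j x), (i, x)) \<in> diagram_rel I D d"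
        using that by (auto simp: diagram_rel_def)
      then have "(\<phi> (i, x), \<phi> (j, d i j x)) \<in> X" "(\<phi> (j, d i j x), \<phi> (i, x)) \<in> X"
        using \<phi> by (auto simp: admissible_def)
      then show ?thesis using po_antisym[OF obj_po[OF X]] by blast
    qed
    then have "compose (Field (D i)) (e j) (d i j) = e i" if "(i, j) \<in> I" for i j
      using that hom_Field[OF D(4)[OF that]] unfolding compose_def e_def[of i]
      by (intro restrict_ext) (simp add: e_def)
    then have "cocone k I D d X e" using X e by (simp add: cocone_def)
    from colimitD(4)[OF col this] obtain h where h: "h \<in> hom k C X"
      "\<And>i. i \<in> Field I \<Longrightarrow> compose (Field (D i)) h (c i) = e i" by blast
    have "h (c i x) = \<phi> (i, x)" if "i \<in> Field I" "x \<in> Field (D i)" for i x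
      using fun_cong[OF h(2)[OF that(1)], of x] that by (simp add: compose_eq e_def)
    then show ?thesis using hom_continuous[OF h(1)] by (intro exI[of _ h]) (auto simp: points_def)
  qed
  moreover have "diagram_rel I D d \<subseteq> points (Field I) D \<times> points (Field I) D"
    using hom_Field[OF D(4)] by (auto simp: diagram_rel_def points_def intro: FieldI1 FieldI2)
  ultimately show ?thesis using C obj_po[OF D(3)] unfolding presents_def by simp
qed

section \<open>Coinserters as presentations\<close>

lemma coinserterD:
  assumes "is_coinserter k A B f0 f1 C c"
  shows "A \<in> obj k" "B \<in> obj k" "C \<in> obj k" "f0 \<in> hom k A B" "f1 \<in> hom k A B" "c \<in> hom k B C"
    and "(compose (Field A) c f0, compose (Field A) c f1) \<in> hom_order k A C"
    and "D \<in> obj k \<Longrightarrow> c' \<in> hom k B D \<Longrightarrow>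
      (compose (Field A) c' f0, compose (Field A) c' f1) \<in> hom_order k A D \<Longrightarrow>
      \<exists>h\<in>hom k C D. c' = compose (Field B) h c"
    and "D \<in> obj k \<Longrightarrow> u \<in> hom k C D \<Longrightarrow> v \<in> hom k C D \<Longrightarrow>
      (compose (Field B) u c, compose (Field B) v c) \<in> hom_order k B D \<Longrightarrow> (u, v) \<in> hom_order k C D"
  using assms unfolding is_coinserter_def by blast+

text \<open>As for colimits, the subobject \<open>T\<close> receives a map from \<open>C\<close>.
  Condition (b), used in both directions, forces its composite with the inclusion to be the
  identity.\<close>

lemma coinserter_generates:
  fixes C :: "'u rel"
  assumes "is_coinserter k A B f0 f1 C c"
  shows "generates k C (c ` Field B)"
proof (rule generatesI_subobject)
  note co = coinserterD[OF assms]
  note C = co(3)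
  show "C \<in> obj k" by (rule C)
  show "c ` Field B \<subseteq> Field C" using hom_Field[OF co(6)] by auto
  fix T assume T: "c ` Field B \<subseteq> T" "T \<subseteq> Field C" "Restr C T \<in> obj k"
    "continuous_map k (Restr C T) C (\<lambda>x. x)"
  have "continuous_map k B (Restr C T) c"
    using T(1) by (intro Restr_corestrict_continuous[OF hom_continuous[OF co(6)] obj_po[OF co(2)]
        obj_po[OF C] T(2)]) auto
  then have c: "c \<in> hom k B (Restr C T)" using co(6) by (simp add: hom_def)
  have "(compose (Field A) c f0, compose (Field A) c f1) \<in> hom_order k A (Restr C T)"
  proof (rule hom_orderI)
    show "compose (Field A) c f0 \<in> hom k A (Restr C T)" "compose (Field A) c f1 \<in> hom k A (Restr C T)"
      using compose_hom[OF _ c obj_po[OF co(1)]] co(4,5) by blast+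
    fix x assume x: "x \<in> Field A"
    then have "c (f0 x) \<in> T" "c (f1 x) \<in> T" using T(1) hom_Field[OF co(4)] hom_Field[OF co(5)] by auto
    with hom_orderD[OF co(7) x] x show "(compose (Field A) c f0 x, compose (Field A) c f1 x) \<in> Restr C T"
      by (simp add: compose_eq)
  qed
  from co(8)[OF T(3) c this] obtain h where h: "h \<in> hom k C (Restr C T)" "c = compose (Field B) h c"
    by blast
  have h': "h \<in> hom k C C"
    using h(1) continuous_map_compose[OF hom_continuous[OF h(1)] T(4)] by (simp add: hom_def)
  note i = ident_hom[OF obj_po[OF C], of k]
  have eq: "compose (Field B) h c = compose (Field B) (ident C) c"
    using h(2) compose_ident_left[OF co(6)] by simp
  have le: "(compose (Field B) (ident C) c, compose (Field B) (ident C) c) \<in> hom_order k B C"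
    using po_refl[OF obj_po[OF C]] hom_Field[OF compose_hom[OF co(6) i obj_po[OF co(2)]]]
    by (intro hom_orderI compose_hom[OF co(6) i obj_po[OF co(2)]]) blast
  have "(h, ident C) \<in> hom_order k C C" "(ident C, h) \<in> hom_order k C C"
    using co(9)[OF C h' i] co(9)[OF C i h'] le eq by simp_all
  then have "(h x, x) \<in> C" "(x, h x) \<in> C" if "x \<in> Field C" for x
    using that by (auto simp: ident_def dest!: hom_orderD)
  then have "h x = x" if "x \<in> Field C" for x
    using that po_antisym[OF obj_po[OF C]] by blast
  with hom_continuous[OF h(1)] show "\<exists>h. continuous_map k C (Restr C T) h \<and> (\<forall>x\<in>Field C. h x = x)"
    by blast
qed

lemma coinserter_presents:
  fixes C :: "'u rel"
  assumes "is_coinserter k A B f0 f1 C c"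
  shows "presents k {()} (\<lambda>_. B) {(((), f0 a), ((), f1 a)) |a. a \<in> Field A} C (\<lambda>(_, b). c b)"
proof -
  note co = coinserterD[OF assms]
  have P: "points {()} (\<lambda>_. B) = {()} \<times> Field B" by (auto simp: points_def)
  have "(\<lambda>(_, b). c b) ` ({()} \<times> Field B) = c ` Field B" by force
  moreover have "\<exists>h. continuous_map k C X h \<and> (\<forall>p\<in>{()} \<times> Field B. h (case p of (_, b) \<Rightarrow> c b) = \<phi> p)"
    if X: "X \<in> obj k" and \<phi>: "admissible k {()} (\<lambda>_. B) {(((), f0 a), ((), f1 a)) |a. a \<in> Field A} X \<phi>"
    for X :: "'u rel" and \<phi>
  proof -
    let ?e = "restrict (\<lambda>b. \<phi> ((), b)) (Field B)"
    have e: "?e \<in> hom k B X" using \<phi> by (intro restrict_hom obj_po[OF co(2)]) (simp add: admissible_def)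
    have "(compose (Field A) ?e f0, compose (Field A) ?e f1) \<in> hom_order k A X"
    proof (rule hom_orderI)
      show "compose (Field A) ?e f0 \<in> hom k A X" "compose (Field A) ?e f1 \<in> hom k A X"
        using compose_hom[OF _ e obj_po[OF co(1)]] co(4,5) by blast+
      show "(compose (Field A) ?e f0 x, compose (Field A) ?e f1 x) \<in> X" if "x \<in> Field A" for x
        using that \<phi> hom_Field[OF co(4) that] hom_Field[OF co(5) that]
        by (auto simp: compose_eq admissible_def)
    qed
    from co(8)[OF X e this] obtain h where h: "h \<in> hom k C X" "?e = compose (Field B) h c" by blast
    have "h (c b) = \<phi> ((), b)" if "b \<in> Field B" for b
      using fun_cong[OF h(2), of b] that by (simp add: compose_eq)
    then show ?thesis using hom_continuous[OF h(1)] by (intro exI[of _ h]) auto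
  qed
  moreover have "{(((), f0 a), ((), f1 a)) |a. a \<in> Field A} \<subseteq> ({()} \<times> Field B) \<times> ({()} \<times> Field B)"
    using hom_Field[OF co(4)] hom_Field[OF co(5)] by auto
  ultimately show ?thesis
    using co(3) obj_po[OF co(2)] coinserter_generates[OF assms] unfolding presents_def P by simp
qed

context endofunctor
begin

text \<open>A finite tuple of points of the diagram can be moved to a common stage \<open>j\<close>,
  where \<open>e j\<close> gives it a value. The value does not depend on the stage, and this is
  what extends to \<open>F C\<close>.\<close>

lemma coend_preserves_directed_colimits:
  assumes coend: "\<And>C. C \<in> obj k \<Longrightarrow> is_coend C"
  shows "preserves_directed_colimits k F"
  unfolding preserves_directed_colimits_def
proof (intro allI impI; elim conjE)
  fix I :: "'u rel" and D d and C :: "'u rel" and c assume dd: "directed_diagram k I D d" and col: "is_colimit k I D d C c"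
  note D = directed_diagramD[OF dd] and C = colimitD(1)[OF col] and c = colimitD(2)[OF col]
  note pres = colimit_presents[OF dd col]
  let ?P = "points (Field I) D"
  have d_comp: "d j l (d i j x) = d i l x" if "(i, j) \<in> I" "(j, l) \<in> I" "x \<in> Field (D i)" for i j l x
    using fun_cong[OF D(6)[OF that(1,2)], of x] that by (simp add: compose_eq)
  have c_comp: "c j (d i j x) = c i x" if "(i, j) \<in> I" "x \<in> Field (D i)" for i j x
    using fun_cong[OF colimitD(3)[OF col that(1)], of x] that by (simp add: compose_eq)
  \<comment> \<open>A stage satisfying \<open>upper n f j\<close> lies above the stages of all
    entries, so \<open>\<delta> n f j\<close> can push the whole tuple into
    \<open>D j\<close>.\<close>
  define upper where "upper n f j \<longleftrightarrow> j \<in> Field I \<and> (\<forall>x\<in>n. (fst (f x), j) \<in> I)"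
    for n :: "'u set" and f :: "'u \<Rightarrow> 'u \<times> 'u" and j
  define \<delta> where "\<delta> n f j = (\<lambda>x\<in>n. d (fst (f x)) j (snd (f x)))"
    for n :: "'u set" and f :: "'u \<Rightarrow> 'u \<times> 'u" and j
  have pt: "fst p \<in> Field I" "snd p \<in> Field (D (fst p))" if "p \<in> ?P" for p
    using that by (auto simp: points_def)
  have upper_ex: "\<exists>j. upper n f j" if "finite n" "f \<in> n \<rightarrow> ?P" for n f
  proof -
    have "(\<lambda>x. fst (f x)) ` n \<subseteq> Field I" using that(2) by (force simp: points_def)
    with directed_finite_upper[OF D(1,2), of "(\<lambda>x. fst (f x)) ` n"] that(1) show ?thesis
      by (auto simp: upper_def)
  qed
  have \<delta>: "\<delta> n f j \<in> n \<rightarrow>\<^sub>E Field (D j)" if "upper n f j" "f \<in> n \<rightarrow> ?P" for n f j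
  proof -
    have "d (fst (f x)) j (snd (f x)) \<in> Field (D j)" if "x \<in> n" for x
      using that \<open>upper n f j\<close> pt[of "f x"] \<open>f \<in> n \<rightarrow> ?P\<close>
      by (intro hom_Field[OF D(4)]) (auto simp: upper_def)
    then show ?thesis by (simp add: \<delta>_def)
  qed
  have \<delta>_step: "compose n (d j l) (\<delta> n f j) = \<delta> n f l" if "upper n f j" "(j, l) \<in> I" "f \<in> n \<rightarrow> ?P" for n f j l
    unfolding compose_def \<delta>_def[of n f l]
    using that pt by (intro restrict_ext) (auto simp: \<delta>_def upper_def d_comp Pi_iff)
  have upper_common: "\<exists>l. (j, l) \<in> I \<and> (j', l) \<in> I" if "j \<in> Field I" "j' \<in> Field I" for j j'
    using directed_inD(3)[OF D(2) that] by blast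
  let ?FD = "\<lambda>i. F_obj (D i)" and ?Fd = "\<lambda>i j. on_hom F (D i) (D j) (d i j)"
    and ?Fc = "\<lambda>i. on_hom F (D i) C (c i)"
  have gamma: "compose n (\<lambda>(i, x). c i x) f = compose n (c j) (\<delta> n f j)" if "upper n f j" "f \<in> n \<rightarrow> ?P" for n f j
    unfolding compose_def
    using that pt by (intro restrict_ext) (auto simp: \<delta>_def upper_def c_comp Pi_iff case_prod_beta)
  have act_gamma: "F_act n C (compose n (\<lambda>(i, x). c i x) f) t = ?Fc j (F_act n (D j) (\<delta> n f j) t)"
    if "finite n" "upper n f j" "f \<in> n \<rightarrow> ?P" "t \<in> Field (F_fin n)" for n f j t
  proof -
    have j: "j \<in> Field I" using that(2) by (simp add: upper_def)
    show ?thesis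
      using F_act_compose[OF that(1) D(3)[OF j] C \<delta>[OF that(2,3)] c[OF j] that(4)] gamma[OF that(2,3)]
      by simp
  qed
  have cocone: "cocone k I ?FD ?Fd (F_obj C) ?Fc"
    unfolding cocone_def
  proof (intro conjI ballI allI impI)
    show "F_obj C \<in> obj k" by (rule F_obj[OF C])
    show "?Fc i \<in> hom k (?FD i) (F_obj C)" if "i \<in> Field I" for i
      by (rule F_hom[OF D(3)[OF that] C c[OF that]])
    fix i j assume ij: "(i, j) \<in> I"
    then have "i \<in> Field I" "j \<in> Field I" by (auto intro: FieldI1 FieldI2)
    with F_compose_hom[OF D(3) D(3) C D(4)[OF ij] c] colimitD(3)[OF col ij]
    show "compose (Field (?FD i)) (?Fc j) (?Fd i j) = ?Fc i" by simp
  qed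
  show "is_colimit k I ?FD ?Fd (F_obj C) ?Fc"
    unfolding is_colimit_def
  proof (intro conjI cocone allI impI)
    fix X :: "'u rel" and e assume cone: "cocone k I ?FD ?Fd X e"
    then have X: "X \<in> obj k" and e: "\<And>i. i \<in> Field I \<Longrightarrow> e i \<in> hom k (?FD i) X" by (auto simp: cocone_def)
    have e_comp: "e j (?Fd i j y) = e i y" if "(i, j) \<in> I" "y \<in> Field (?FD i)" for i j y
    proof -
      have "compose (Field (?FD i)) (e j) (?Fd i j) = e i" using cone that(1) by (simp add: cocone_def)
      from fun_cong[OF this, of y] that(2) show ?thesis by (simp add: compose_eq)
    qed
    define val where "val n t f j = e j (F_act n (D j) (\<delta> n f j) t)"
      for n t and f :: "'u \<Rightarrow> 'u \<times> 'u" and j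
    have val_step: "val n t f j = val n t f l"
      if n: "finite n" and j: "upper n f j" and jl: "(j, l) \<in> I" and f: "f \<in> n \<rightarrow> ?P" and t: "t \<in> Field (F_fin n)"
      for n t f j l
    proof -
      have F: "j \<in> Field I" "l \<in> Field I" using jl by (auto intro: FieldI1 FieldI2)
      have "val n t f j = e l (?Fd j l (F_act n (D j) (\<delta> n f j) t))"
        unfolding val_def using e_comp[OF jl F_act_Field[OF n D(3)[OF F(1)] \<delta>[OF j f] t]] by simp
      also have "\<dots> = val n t f l"
        unfolding val_def
        using F_act_compose[OF n D(3)[OF F(1)] D(3)[OF F(2)] \<delta>[OF j f] D(4)[OF jl] t] \<delta>_step[OF j jl f]
        by simp
      finally show ?thesis .
    qed
    have val_eq: "val n t f j = val n t f j'"
      if "finite n" "upper n f j" "upper n f j'" "f \<in> n \<rightarrow> ?P" "t \<in> Field (F_fin n)" for n t f j j'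
      using upper_common[of j j'] val_step[OF that(1,2) _ that(4,5)] val_step[OF that(1,3) _ that(4,5)] that
      unfolding upper_def by metis
    \<comment> \<open>The choice of stage is immaterial by \<open>val_eq\<close>; each argument
      below picks the stage that suits it.\<close>
    define \<phi> where "\<phi> n t f = val n t f (SOME j. upper n f j)" for n t f
    have \<phi>: "\<phi> n t f = val n t f j"
      if "finite n" "upper n f j" "f \<in> n \<rightarrow> ?P" "t \<in> Field (F_fin n)" for n t f j
      unfolding \<phi>_def by (rule val_eq[OF that(1) someI[of "upper n f", OF that(2)] that(2-4)])
    have cont_t: "continuous_map k (F_fin n) X (\<lambda>t. \<phi> n t f)" if n: "finite n" and f: "f \<in> n \<rightarrow>\<^sub>E ?P" for n f
    proof -
      have f': "f \<in> n \<rightarrow> ?P" using f by auto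
      from upper_ex[OF n f'] obtain j where j: "upper n f j" by blast
      then have jI: "j \<in> Field I" by (simp add: upper_def)
      have "continuous_map k (F_fin n) X (\<lambda>t. val n t f j)"
        unfolding val_def
        by (rule continuous_map_compose[OF F_act_continuous[OF n D(3)[OF jI] \<delta>[OF j f']] hom_continuous[OF e[OF jI]]])
      then show ?thesis
        using continuous_map_cong[OF F_po[OF Id_on_obj[OF n]], of "\<lambda>t. \<phi> n t f" "\<lambda>t. val n t f j"] \<phi>[OF n j f']
        by simp
    qed
    have ex: "\<exists>h. continuous_map k (F_obj C) X h \<and> (\<forall>n f t. finite n \<and> f \<in> n \<rightarrow>\<^sub>E ?P \<and>
        t \<in> Field (F_fin n) \<longrightarrow> h (F_act n C (compose n (\<lambda>(i, x). c i x) f) t) = \<phi> n t f)"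
    proof (rule extend_from_presentation[OF _ pres X cont_t])
      show "extensible C" using coend[OF C] by (simp add: is_coend_def)
      fix n :: "'u set" and t x f assume n: "finite n" and t: "t \<in> Field (F_fin n)" and x: "x \<in> n" and f: "f \<in> n - {x} \<rightarrow>\<^sub>E ?P"
      have upd: "f(x := p) \<in> n \<rightarrow>\<^sub>E ?P" if "p \<in> ?P" for p
        using that f x by (auto simp: PiE_iff extensional_def)
      \<comment> \<open>The stage bounds \<open>i\<close> and the fixed coordinates, whatever point
        of \<open>D i\<close> is inserted at \<open>x\<close>. Hence one formula describes
        \<open>\<phi>\<close> on all of \<open>D i\<close>, and continuity can be read off from
        it.\<close>
      have upper': "\<exists>j. (i, j) \<in> I \<and> (\<forall>y\<in>n - {x}. (fst (f y), j) \<in> I)" if i: "i \<in> Field I" for i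
      proof -
        from upper_ex[of "n - {x}" f] f n obtain j where j: "upper (n - {x}) f j" by (auto simp: PiE_iff)
        then obtain l where "(i, l) \<in> I" "(j, l) \<in> I" using upper_common[OF i] by (auto simp: upper_def)
        moreover from this j have "\<forall>y\<in>n - {x}. (fst (f y), l) \<in> I"
          unfolding upper_def by (blast intro: po_trans[OF D(1)])
        ultimately show ?thesis by blast
      qed
      have up: "upper n (f(x := (i, b))) j" if "(i, j) \<in> I" "\<forall>y\<in>n - {x}. (fst (f y), j) \<in> I" for i j b
        using that by (auto simp: upper_def intro: FieldI2)
      have \<delta>_upd: "\<delta> n (f(x := (i, b))) j = (\<delta> (n - {x}) f j)(x := d i j b)" for i b j
        using x by (auto simp: \<delta>_def fun_eq_iff)
      show "admissible k (Field I) D (diagram_rel I D d) X (\<lambda>p. \<phi> n t (f(x := p)))"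
        unfolding admissible_def
      proof (intro conjI ballI)
        fix i assume i: "i \<in> Field I"
        from upper'[OF i] obtain j where j: "(i, j) \<in> I" "\<forall>y\<in>n - {x}. (fst (f y), j) \<in> I" by blast
        have jI: "j \<in> Field I" using j by (auto intro: FieldI2)
        have eq: "\<phi> n t (f(x := (i, b))) = e j (F_act n (D j) ((\<delta> (n - {x}) f j)(x := d i j b)) t)"
          if "b \<in> Field (D i)" for b
        proof -
          have "f(x := (i, b)) \<in> n \<rightarrow> ?P" using upd[of "(i, b)"] that i by (auto simp: points_def)
          from \<phi>[OF n up[OF j] this t] show ?thesis by (simp add: val_def \<delta>_upd)
        qed
        have "\<delta> (n - {x}) f j \<in> n - {x} \<rightarrow>\<^sub>E Field (D j)"
          using f j jI by (intro \<delta>) (auto simp: upper_def)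
        then have "continuous_map k (D j) (power_order k n (D j)) (\<lambda>c. (\<delta> (n - {x}) f j)(x := c))"
          using x by (intro power_update_continuous[OF obj_complete[OF D(3)[OF jI]]])
            (auto simp: PiE_iff extensional_def)
        from continuous_map_compose[OF continuous_map_compose[OF continuous_map_compose[OF
              hom_continuous[OF D(4)[OF j(1)]] this] F_act_eval_continuous[OF n D(3)[OF jI] t]]
            hom_continuous[OF e[OF jI]]]
        have cont: "continuous_map k (D i) X (\<lambda>b. e j (F_act n (D j) ((\<delta> (n - {x}) f j)(x := d i j b)) t))" .
        show "continuous_map k (D i) X (\<lambda>b. \<phi> n t (f(x := (i, b))))"
          by (rule iffD2[OF continuous_map_cong[OF obj_po[OF D(3)[OF i]]] cont]) (rule eq)
      next
        fix pq assume pq: "pq \<in> diagram_rel I D d"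
        have "(\<phi> n t (f(x := p)), \<phi> n t (f(x := q))) \<in> X"
          if eq: "\<phi> n t (f(x := p)) = \<phi> n t (f(x := q))" and q: "q \<in> ?P" for p q
          unfolding eq using continuous_map_Field[OF cont_t[OF n upd[OF q]] t] po_refl[OF obj_po[OF X]] by blast
        \<comment> \<open>At a common stage above \<open>l\<close> the points \<open>(i, b)\<close>
          and \<open>(l, d i l b)\<close> have the same image, so the values are equal and both
          inequations hold.\<close>
        moreover have "\<phi> n t (f(x := (i, b))) = \<phi> n t (f(x := (l, d i l b))) \<and> (i, b) \<in> ?P \<and> (l, d i l b) \<in> ?P"
          if il: "(i, l) \<in> I" and b: "b \<in> Field (D i)" for i l b
        proof -
          have F: "i \<in> Field I" "l \<in> Field I" using il by (auto intro: FieldI1 FieldI2)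
          then have p: "(i, b) \<in> ?P" "(l, d i l b) \<in> ?P" using b hom_Field[OF D(4)[OF il] b] by (auto simp: points_def)
          from upper'[OF F(2)] obtain j where j: "(l, j) \<in> I" "\<forall>y\<in>n - {x}. (fst (f y), j) \<in> I" by blast
          have ij: "(i, j) \<in> I" using il j(1) by (rule po_trans[OF D(1)])
          have "f(x := (i, b)) \<in> n \<rightarrow> ?P" "f(x := (l, d i l b)) \<in> n \<rightarrow> ?P" using upd p by blast+
          with \<phi>[OF n up[OF ij j(2)] _ t] \<phi>[OF n up[OF j] _ t] d_comp[OF il j(1) b] p show ?thesis
            by (simp add: val_def \<delta>_upd)
        qed
        ultimately show "case pq of (p, q) \<Rightarrow> (\<phi> n t (f(x := p)), \<phi> n t (f(x := q))) \<in> X"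
          using pq unfolding diagram_rel_def by fastforce
      qed
    next
      fix n m :: "'u set" and g f t
      assume n: "finite n" and m: "finite m" and g: "g \<in> n \<rightarrow>\<^sub>E m" and f: "f \<in> m \<rightarrow>\<^sub>E ?P" and t: "t \<in> Field (F_fin n)"
      have f': "f \<in> m \<rightarrow> ?P" using f by auto
      from upper_ex[OF m f'] obtain j where j: "upper m f j" by blast
      then have jI: "j \<in> Field I" by (simp add: upper_def)
      have gt: "F_act n (Id_on m) g t \<in> Field (F_fin m)"
        using F_act_Field[OF n Id_on_obj[OF m] _ t] g by simp
      have fg: "compose n f g \<in> n \<rightarrow> ?P" "upper n (compose n f g) j"
        using f j g by (auto simp: compose_def upper_def PiE_iff)
      have "\<delta> n (compose n f g) j = compose n (\<delta> m f j) g"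
        using g by (auto simp: \<delta>_def compose_def fun_eq_iff)
      then show "\<phi> m (F_act n (Id_on m) g t) f = \<phi> n t (compose n f g)"
        using \<phi>[OF m j f' gt] \<phi>[OF n fg(2,1) t] F_act_reindex[OF n m D(3)[OF jI] g \<delta>[OF j f'] t]
        by (simp add: val_def)
    qed
    then obtain h where h: "continuous_map k (F_obj C) X h"
      "\<forall>n f t. finite n \<and> f \<in> n \<rightarrow>\<^sub>E ?P \<and> t \<in> Field (F_fin n) \<longrightarrow>
        h (F_act n C (compose n (\<lambda>(i, x). c i x) f) t) = \<phi> n t f" by (elim exE conjE)
    note h_act = h(2)[rule_format, OF conjI[OF _ conjI]]
    let ?h = "restrict h (Field (F_obj C))"
    have h_hom: "?h \<in> hom k (F_obj C) X" by (rule restrict_hom[OF h(1) F_po[OF C]])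
    have he: "h (?Fc i y) = e i y" if i: "i \<in> Field I" and y: "y \<in> Field (?FD i)" for i y
    proof (rule finite_points_eqI[OF coend[OF D(3)[OF i]] obj_po[OF X] _ hom_continuous[OF e[OF i]] _ y])
      show "continuous_map k (?FD i) X (\<lambda>y. h (?Fc i y))"
        by (rule continuous_map_compose[OF F_continuous[OF D(3)[OF i] C c[OF i]] h(1)])
      fix n :: "'u set" and a t assume n: "finite n" and a: "a \<in> n \<rightarrow>\<^sub>E Field (D i)" and t: "t \<in> Field (F_fin n)"
      \<comment> \<open>All entries of \<open>a\<close> are placed at stage \<open>i\<close>;
        pushing the tuple to stage \<open>i\<close> leaves it unchanged because \<open>d i i\<close>
        is the identity.\<close>
      define f where "f = (\<lambda>x\<in>n. (i, a x))"
      have f: "f \<in> n \<rightarrow>\<^sub>E ?P" using a i by (auto simp: f_def points_def)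
      then have f': "f \<in> n \<rightarrow> ?P" by auto
      have up: "upper n f i" using i po_refl[OF D(1) i] by (simp add: upper_def f_def)
      have \<delta>a: "\<delta> n f i = a"
        using a D(5)[OF i] by (auto simp: \<delta>_def f_def fun_eq_iff ident_def PiE_iff extensional_def)
      show "h (?Fc i (F_act n (D i) a t)) = e i (F_act n (D i) a t)"
        using act_gamma[OF n up f' t] h_act[OF n f t] \<phi>[OF n up f' t] by (simp add: val_def \<delta>a)
    qed
    show "\<exists>!h. h \<in> hom k (F_obj C) X \<and> (\<forall>i\<in>Field I. compose (Field (?FD i)) h (?Fc i) = e i)"
    proof (rule ex1I[of _ ?h])
      have "compose (Field (?FD i)) ?h (?Fc i) = e i" if i: "i \<in> Field I" for i
      proof (rule hom_eqI[OF compose_hom[OF F_hom[OF D(3)[OF i] C c[OF i]] h_hom F_po[OF D(3)[OF i]]] e[OF i]])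
        show "compose (Field (?FD i)) ?h (?Fc i) y = e i y" if "y \<in> Field (?FD i)" for y
          using he[OF i that] F_Field[OF D(3)[OF i] C c[OF i] that] that by (simp add: compose_eq)
      qed
      with h_hom show "?h \<in> hom k (F_obj C) X \<and> (\<forall>i\<in>Field I. compose (Field (?FD i)) ?h (?Fc i) = e i)"
        by blast
      fix h' assume h': "h' \<in> hom k (F_obj C) X \<and> (\<forall>i\<in>Field I. compose (Field (?FD i)) h' (?Fc i) = e i)"
      then have h'e: "h' (?Fc i y) = e i y" if "i \<in> Field I" "y \<in> Field (?FD i)" for i y
        using that by (metis compose_eq)
      show "h' = ?h"
      proof (rule hom_eqI[OF conjunct1[OF h'] h_hom])
        fix x assume x: "x \<in> Field (F_obj C)"
        have "generates k (F_obj C) (finite_points C)" using coend[OF C] by (simp add: is_coend_def)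
        from generates_from_generators[OF this C presents_generates[OF pres]]
        have "h' x = h x"
        proof (rule continuous_eq_on_generators[OF _ obj_po[OF X] hom_continuous[OF conjunct1[OF h']] h(1) _ x])
          fix y assume "y \<in> {F_act n C f t |n f t. finite n \<and> f \<in> n \<rightarrow>\<^sub>E (\<lambda>(i, x). c i x) ` ?P \<and> t \<in> Field (F_fin n)}"
          then obtain n f t where n: "finite n" and f: "f \<in> n \<rightarrow>\<^sub>E (\<lambda>(i, x). c i x) ` ?P"
            and t: "t \<in> Field (F_fin n)" and y: "y = F_act n C f t" by blast
          from PiE_image_lift[OF f] obtain f0 where f0: "f0 \<in> n \<rightarrow>\<^sub>E ?P" "f = compose n (\<lambda>(i, x). c i x) f0" by blast
          then have f0': "f0 \<in> n \<rightarrow> ?P" by auto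
          from upper_ex[OF n f0'] obtain j where j: "upper n f0 j" by blast
          then have jI: "j \<in> Field I" by (simp add: upper_def)
          have "y = ?Fc j (F_act n (D j) (\<delta> n f0 j) t)" using act_gamma[OF n j f0' t] y f0 by simp
          then show "h' y = h y"
            using h'e[OF jI] he[OF jI] F_act_Field[OF n D(3)[OF jI] \<delta>[OF j f0'] t] by simp
        qed
        then show "h' x = ?h x" using x by simp
      qed
    qed
  qed
qed

text \<open>Reflexivity is decisive here: the inequations of the power change one coordinate from
  \<open>f0 a\<close> to \<open>f1 a\<close>, whereas the hypothesis on \<open>e\<close> speaks of
  \<open>F A\<close>, hence of tuples all of whose entries lie in \<open>A\<close>.\<close>

lemma coend_preserves_reflexive_coinserters:
  assumes coend: "\<And>C. C \<in> obj k \<Longrightarrow> is_coend C"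
  shows "preserves_reflexive_coinserters k F"
  unfolding preserves_reflexive_coinserters_def
proof (intro allI impI; elim conjE)
  fix A B :: "'u rel" and f0 f1 and C :: "'u rel" and c assume coins: "is_coinserter k A B f0 f1 C c" and refl: "reflexive_pair k A B f0 f1"
  note co = coinserterD[OF coins] and pres = coinserter_presents[OF coins]
  note A = co(1) and B = co(2) and C = co(3) and f0 = co(4) and f1 = co(5) and c = co(6)
  note gC = coend[OF C, unfolded is_coend_def]
  let ?P = "points {()} (\<lambda>_. B)"
  have P: "?P = {()} \<times> Field B" by (auto simp: points_def)
  from refl obtain d where d: "d \<in> hom k B A" "compose (Field B) f0 d = ident B" "compose (Field B) f1 d = ident B"
    unfolding reflexive_pair_def by blast
  have fd: "f0 (d b) = b" "f1 (d b) = b" if "b \<in> Field B" for b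
    using fun_cong[OF d(2), of b] fun_cong[OF d(3), of b] that by (simp_all add: compose_eq ident_def)
  let ?FA = "F_obj A" and ?FB = "F_obj B" and ?FC = "F_obj C"
  let ?F0 = "on_hom F A B f0" and ?F1 = "on_hom F A B f1" and ?Fc = "on_hom F B C c"
  have act_gamma: "F_act n C (compose n (\<lambda>(_, b). c b) f) t = ?Fc (F_act n B (\<lambda>x\<in>n. snd (f x)) t)"
    if n: "finite n" and f: "f \<in> n \<rightarrow> ?P" and t: "t \<in> Field (F_fin n)" for n f t
  proof -
    have "(\<lambda>x\<in>n. snd (f x)) \<in> n \<rightarrow>\<^sub>E Field B" using f by (force simp: P)
    moreover have "compose n (\<lambda>(_, b). c b) f = compose n c (\<lambda>x\<in>n. snd (f x))"
      unfolding compose_def by (intro restrict_ext) (simp add: case_prod_beta)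
    ultimately show ?thesis using F_act_compose[OF n B C _ c t] by simp
  qed
  show "preserves_coinserter k F A B f0 f1 C c"
    unfolding preserves_coinserter_def is_coinserter_def
  proof (intro conjI ballI impI F_obj F_hom A B C f0 f1 c)
    show "(compose (Field ?FA) ?Fc ?F0, compose (Field ?FA) ?Fc ?F1) \<in> hom_order k ?FA ?FC"
      using F_hom_mono[OF A C co(7)] F_compose_hom[OF A B C f0 c] F_compose_hom[OF A B C f1 c] by simp
  next
    fix X :: "'u rel" and e assume X: "X \<in> obj k" and e: "e \<in> hom k ?FB X"
      and le: "(compose (Field ?FA) e ?F0, compose (Field ?FA) e ?F1) \<in> hom_order k ?FA X"
    have le': "(e (?F0 y), e (?F1 y)) \<in> X" if "y \<in> Field ?FA" for y
      using hom_orderD[OF le that] that by (simp add: compose_eq)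
    define \<phi> where "\<phi> n t f = e (F_act n B (\<lambda>x\<in>n. snd (f x)) t)" for n t and f :: "'u \<Rightarrow> unit \<times> 'u"
    have sB: "(\<lambda>x\<in>n. snd (f x)) \<in> n \<rightarrow>\<^sub>E Field B" if "f \<in> n \<rightarrow> ?P" for n f
      using that by (force simp: P)
    have "\<exists>h. continuous_map k ?FC X h \<and> (\<forall>n f t. finite n \<and> f \<in> n \<rightarrow>\<^sub>E ?P \<and>
        t \<in> Field (F_fin n) \<longrightarrow> h (F_act n C (compose n (\<lambda>(_, b). c b) f) t) = \<phi> n t f)"
    proof (rule extend_from_presentation[OF conjunct2[OF gC] pres X])
      fix n :: "'u set" and f assume n: "finite n" and f: "f \<in> n \<rightarrow>\<^sub>E ?P"
      show "continuous_map k (F_fin n) X (\<lambda>t. \<phi> n t f)"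
        unfolding \<phi>_def using f
        by (intro continuous_map_compose[OF F_act_continuous[OF n B sB] hom_continuous[OF e]]) auto
    next
      fix n :: "'u set" and t x f assume n: "finite n" and t: "t \<in> Field (F_fin n)" and x: "x \<in> n" and f: "f \<in> n - {x} \<rightarrow>\<^sub>E ?P"
      have s: "(\<lambda>x\<in>n - {x}. snd (f x)) \<in> n - {x} \<rightarrow>\<^sub>E Field B" using f by (intro sB) auto
      have upd: "(\<lambda>y\<in>n. snd ((f(x := (u, b))) y)) = (\<lambda>x\<in>n - {x}. snd (f x))(x := b)" for u b
        using x by (auto simp: fun_eq_iff)
      show "admissible k {()} (\<lambda>_. B) {(((), f0 a), ((), f1 a)) |a. a \<in> Field A} X (\<lambda>p. \<phi> n t (f(x := p)))"
        unfolding admissible_def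
      proof (intro conjI ballI)
        fix u :: unit
        have "continuous_map k B (power_order k n B) (\<lambda>b. (\<lambda>x\<in>n - {x}. snd (f x))(x := b))"
          using s x by (intro power_update_continuous[OF obj_complete[OF B]]) (auto simp: PiE_iff extensional_def)
        from continuous_map_compose[OF continuous_map_compose[OF this F_act_eval_continuous[OF n B t]]
            hom_continuous[OF e]]
        show "continuous_map k B X (\<lambda>b. \<phi> n t (f(x := (u, b))))" by (simp only: \<phi>_def upd)
      next
        fix pq :: "(unit \<times> 'u) \<times> (unit \<times> 'u)"
        assume "pq \<in> {(((), f0 a), ((), f1 a)) |a. a \<in> Field A}"
        then obtain a where a: "a \<in> Field A" "pq = (((), f0 a), ((), f1 a))" by blast
        \<comment> \<open>The splitting \<open>d\<close> fills the unchanged coordinates;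
          \<open>f0\<close> and \<open>f1\<close> both undo it, so the images of \<open>g\<close>
          differ at \<open>x\<close> only.\<close>
        define g where "g = (\<lambda>y\<in>n. if y = x then a else d (snd (f y)))"
        have fy: "snd (f y) \<in> Field B" if "y \<in> n" "y \<noteq> x" for y
        proof -
          have "f y \<in> ?P" using f that by auto
          then show ?thesis by (auto simp: P)
        qed
        then have g: "g \<in> n \<rightarrow>\<^sub>E Field A" using a hom_Field[OF d(1)] by (auto simp: g_def)
        have g01: "compose n f0 g = (\<lambda>x\<in>n - {x}. snd (f x))(x := f0 a)"
          "compose n f1 g = (\<lambda>x\<in>n - {x}. snd (f x))(x := f1 a)"
          using x fd fy by (auto simp: compose_def g_def fun_eq_iff)
        have "(e (F_act n B (compose n f0 g) t), e (F_act n B (compose n f1 g) t)) \<in> X"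
          using le'[OF F_act_Field[OF n A g t]] F_act_compose[OF n A B g f0 t] F_act_compose[OF n A B g f1 t]
          by simp
        then show "case pq of (p, q) \<Rightarrow> (\<phi> n t (f(x := p)), \<phi> n t (f(x := q))) \<in> X"
          unfolding a(2) prod.case \<phi>_def upd g01 .
      qed
    next
      fix n m :: "'u set" and g f t
      assume n: "finite n" and m: "finite m" and g: "g \<in> n \<rightarrow>\<^sub>E m" and f: "f \<in> m \<rightarrow>\<^sub>E ?P" and t: "t \<in> Field (F_fin n)"
      have "compose n (\<lambda>x\<in>m. snd (f x)) g = (\<lambda>x\<in>n. snd (compose n f g x))"
        using g by (auto simp: compose_def fun_eq_iff)
      moreover have "(\<lambda>x\<in>m. snd (f x)) \<in> m \<rightarrow>\<^sub>E Field B" using f by (intro sB) auto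
      ultimately show "\<phi> m (F_act n (Id_on m) g t) f = \<phi> n t (compose n f g)"
        using F_act_reindex[OF n m B g _ t] by (simp add: \<phi>_def)
    qed
    then obtain h where h: "continuous_map k ?FC X h"
      "\<forall>n f t. finite n \<and> f \<in> n \<rightarrow>\<^sub>E ?P \<and> t \<in> Field (F_fin n) \<longrightarrow>
        h (F_act n C (compose n (\<lambda>(_, b). c b) f) t) = \<phi> n t f" by (elim exE conjE)
    note h_act = h(2)[rule_format, OF conjI[OF _ conjI]]
    let ?h = "restrict h (Field ?FC)"
    have h_hom: "?h \<in> hom k ?FC X" by (rule restrict_hom[OF h(1) F_po[OF C]])
    have he: "h (?Fc y) = e y" if y: "y \<in> Field ?FB" for y
    proof (rule finite_points_eqI[OF coend[OF B] obj_po[OF X] _ hom_continuous[OF e] _ y])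
      show "continuous_map k ?FB X (\<lambda>y. h (?Fc y))"
        by (rule continuous_map_compose[OF F_continuous[OF B C c] h(1)])
      fix n :: "'u set" and a t assume n: "finite n" and a: "a \<in> n \<rightarrow>\<^sub>E Field B" and t: "t \<in> Field (F_fin n)"
      define f where "f = (\<lambda>x\<in>n. ((), a x))"
      have f: "f \<in> n \<rightarrow>\<^sub>E ?P" using a by (auto simp: f_def P)
      then have f': "f \<in> n \<rightarrow> ?P" by auto
      have "(\<lambda>x\<in>n. snd (f x)) = a" using a by (auto simp: f_def fun_eq_iff PiE_iff extensional_def)
      then show "h (?Fc (F_act n B a t)) = e (F_act n B a t)"
        using act_gamma[OF n f' t] h_act[OF n f t] by (simp add: \<phi>_def)
    qed
    have "e = compose (Field ?FB) ?h ?Fc"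
      by (rule hom_eqI[OF e compose_hom[OF F_hom[OF B C c] h_hom F_po[OF B]]])
        (simp add: compose_eq he F_Field[OF B C c])
    with h_hom show "\<exists>h\<in>hom k ?FC X. e = compose (Field ?FB) h ?Fc" by blast
  next
    fix X :: "'u rel" and u v assume X: "X \<in> obj k" and u: "u \<in> hom k ?FC X" and v: "v \<in> hom k ?FC X"
      and le: "(compose (Field ?FB) u ?Fc, compose (Field ?FB) v ?Fc) \<in> hom_order k ?FB X"
    show "(u, v) \<in> hom_order k ?FC X"
    proof (rule hom_orderI[OF u v])
      fix x assume x: "x \<in> Field ?FC"
      from generates_from_generators[OF conjunct1[OF gC] C coinserter_generates[OF coins]]
      show "(u x, v x) \<in> X"
      proof (rule continuous_le_on_generators[OF _ obj_po[OF X] hom_continuous[OF u] hom_continuous[OF v] _ x])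
        fix y assume "y \<in> {F_act n C f t |n f t. finite n \<and> f \<in> n \<rightarrow>\<^sub>E c ` Field B \<and> t \<in> Field (F_fin n)}"
        then obtain n f t where n: "finite n" and f: "f \<in> n \<rightarrow>\<^sub>E c ` Field B"
          and t: "t \<in> Field (F_fin n)" and y: "y = F_act n C f t" by blast
        from PiE_image_lift[OF f] obtain g where g: "g \<in> n \<rightarrow>\<^sub>E Field B" "f = compose n c g" by blast
        have "y = ?Fc (F_act n B g t)" using F_act_compose[OF n B C g(1) c t] y g by simp
        with hom_orderD[OF le F_act_Field[OF n B g(1) t]] F_act_Field[OF n B g(1) t] show "(u y, v y) \<in> X"
          by (simp add: compose_eq)
      qed
    qed
  qed
qed

end

section \<open>The coend formula from preservation of colimits\<close>

text \<open>
  The lifting condition makes the surjection \<open>q\<close> a quotient also with respect to joins. It holds for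
  \<open>Id_on (Field P) \<rightarrow> P\<close> with \<open>P\<close> finite, and for the canonical map from the free completion of the
  underlying poset of \<open>C\<close> to \<open>C\<close>.
\<close>

lemma comma_coinserter:
  fixes A B C :: "'u rel"
  assumes A: "A \<in> obj k" and B: "B \<in> obj k" and C: "C \<in> obj k"
    and p0: "p0 \<in> hom k A B" and p1: "p1 \<in> hom k A B" and q: "q \<in> hom k B C"
    and le: "\<And>a. a \<in> Field A \<Longrightarrow> (q (p0 a), q (p1 a)) \<in> C"
    and comma: "\<And>x y. x \<in> Field B \<Longrightarrow> y \<in> Field B \<Longrightarrow> (q x, q y) \<in> C \<Longrightarrow> \<exists>a\<in>Field A. p0 a = x \<and> p1 a = y"
    and surj: "q ` Field B = Field C"
    and lift: "\<And>S x. joinable k C S \<Longrightarrow> is_join C S x \<Longrightarrow>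
      \<exists>S' y. joinable k B S' \<and> is_join B S' y \<and> q ` S' \<subseteq> S \<and> q y = x"
  shows "is_coinserter k A B p0 p1 C q"
  unfolding is_coinserter_def
proof (intro conjI ballI impI A B C p0 p1 q)
  note pA = obj_po[OF A]
  show "(compose (Field A) q p0, compose (Field A) q p1) \<in> hom_order k A C"
    using le by (intro hom_orderI compose_hom[OF p0 q pA] compose_hom[OF p1 q pA]) (simp add: compose_eq)
next
  fix D :: "'u rel" and u v assume D: "D \<in> obj k" and u: "u \<in> hom k C D" and v: "v \<in> hom k C D"
    and uv: "(compose (Field B) u q, compose (Field B) v q) \<in> hom_order k B D"
  show "(u, v) \<in> hom_order k C D"
  proof (rule hom_orderI[OF u v])
    fix x assume "x \<in> Field C"
    then obtain b where "b \<in> Field B" "x = q b" using surj by auto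
    with hom_orderD[OF uv] show "(u x, v x) \<in> D" by (auto simp: compose_eq)
  qed
next
  fix D :: "'u rel" and e assume D: "D \<in> obj k" and e: "e \<in> hom k B D"
    and "(compose (Field A) e p0, compose (Field A) e p1) \<in> hom_order k A D"
  then have ep: "(e (p0 a), e (p1 a)) \<in> D" if "a \<in> Field A" for a
    using that by (auto simp: compose_eq dest: hom_orderD)
  have mono: "(e x, e y) \<in> D" if "x \<in> Field B" "y \<in> Field B" "(q x, q y) \<in> C" for x y
    using comma[OF that] ep by blast
  have "\<forall>x\<in>Field C. \<exists>b\<in>Field B. q b = x" using surj by (metis imageE)
  then obtain s where s: "\<And>x. x \<in> Field C \<Longrightarrow> s x \<in> Field B" "\<And>x. x \<in> Field C \<Longrightarrow> q (s x) = x" by metis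
  \<comment> \<open>\<open>s\<close> is an arbitrary section and need not be monotone. Points with
    equal image under \<open>q\<close> are related both ways in the comma object, so
    \<open>e\<close> identifies them.\<close>
  have es: "e (s (q b)) = e b" if b: "b \<in> Field B" for b
  proof -
    have qb: "q b \<in> Field C" by (rule hom_Field[OF q b])
    have "(q b, q b) \<in> C" using po_refl[OF obj_po[OF C] qb] .
    then have "(e (s (q b)), e b) \<in> D" "(e b, e (s (q b))) \<in> D"
      using mono[OF s(1)[OF qb] b] mono[OF b s(1)[OF qb]] s(2)[OF qb] by simp_all
    then show ?thesis using po_antisym[OF obj_po[OF D]] by blast
  qed
  have "continuous_map k C D (\<lambda>x. e (s x))"
  proof (rule continuous_mapI)
    show "(e (s x), e (s y)) \<in> D" if "(x, y) \<in> C" for x y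
      using that by (intro mono) (simp_all add: s FieldI1[OF that] FieldI2[OF that])
    show "e (s x) \<in> Field D" if "x \<in> Field C" for x using s that hom_Field[OF e] by blast
    fix S x y assume S: "joinable k C S" "is_join C S x" and y: "y \<in> Field D"
      and le: "\<And>z. z \<in> S \<Longrightarrow> (e (s z), y) \<in> D"
    \<comment> \<open>Preservation of joins rests on the lift: the join in \<open>C\<close> is the
      image of a join in \<open>B\<close>, which \<open>e\<close> preserves.\<close>
    from lift[OF S] obtain S' b where S': "joinable k B S'" "is_join B S' b" "q ` S' \<subseteq> S" "q b = x" by blast
    have "(e b, y) \<in> D"
    proof (rule is_join_least[OF continuous_map_join[OF hom_continuous[OF e] S'(1,2)] y])
      fix w assume "w \<in> e ` S'"
      then obtain b' where b': "b' \<in> S'" "w = e b'" by auto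
      then have "b' \<in> Field B" using joinable_subset[OF obj_po[OF B] S'(1)] by auto
      with le[of "q b'"] es b' S'(3) show "(w, y) \<in> D" by auto
    qed
    then show "(e (s x), y) \<in> D" using es[OF is_join_Field[OF S'(2)]] S'(4) by simp
  qed
  from restrict_hom[OF this obj_po[OF C]] have h: "restrict (\<lambda>x. e (s x)) (Field C) \<in> hom k C D" .
  have "e = compose (Field B) (restrict (\<lambda>x. e (s x)) (Field C)) q"
    by (rule hom_eqI[OF e compose_hom[OF q h obj_po[OF B]]]) (simp add: compose_eq es hom_Field[OF q])
  with h show "\<exists>h\<in>hom k C D. e = compose (Field B) h q" by blast
qed

lemma discrete_eq_Id_on:
  assumes "Partial_order A" "\<And>a b. (a, b) \<in> A \<Longrightarrow> a = b"
  shows "A = Id_on (Field A)"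
proof (intro equalityI subrelI)
  show "(a, b) \<in> Id_on (Field A)" if "(a, b) \<in> A" for a b
    using assms(2)[OF that] FieldI1[OF that] by auto
  show "(a, b) \<in> A" if "(a, b) \<in> Id_on (Field A)" for a b
    using that by (elim Id_onE) (simp add: po_refl[OF assms(1)])
qed

context endofunctor
begin

text \<open>The identity tuple makes every element of \<open>F n\<close> a finite point, and
  naturality of the family reduces all its values to those at the identity tuple.\<close>

lemma Id_on_coend:
  assumes n: "finite n"
  shows "is_coend (Id_on n)"
  unfolding is_coend_def extensible_def
proof (intro conjI ballI allI impI)
  note N = Id_on_obj[OF n]
  have i: "ident (Id_on n) \<in> n \<rightarrow>\<^sub>E Field (Id_on n)" by (auto simp: ident_def)
  have "F_act n (Id_on n) (ident (Id_on n)) t \<in> finite_points (Id_on n)" if "t \<in> Field (F_fin n)" for t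
    unfolding finite_points_def using i n that by blast
  then have "Field (F_fin n) \<subseteq> finite_points (Id_on n)" using F_ident[OF N] by auto
  with finite_points_subset[OF N] have "finite_points (Id_on n) = Field (F_fin n)" by blast
  then show "generates k (F_fin n) (finite_points (Id_on n))" by (simp add: generates_UNIV)
  fix X :: "'u rel" and \<theta> assume X: "X \<in> obj k" and \<theta>: "family (Id_on n) X \<theta>"
  have "\<theta> n (F_act m (Id_on n) f t) (ident (Id_on n)) = \<theta> m t f"
    if m: "finite m" and f: "f \<in> m \<rightarrow>\<^sub>E n" and t: "t \<in> Field (F_fin m)" for m f t
    using family_natural[OF \<theta> m n f i t] compose_ident_left[OF fin_hom[OF N, of f m]] f by simp
  then show "\<exists>h. continuous_map k (F_fin n) X h \<and> (\<forall>m f t. finite m \<and> f \<in> m \<rightarrow>\<^sub>E Field (Id_on n) \<and>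
      t \<in> Field (F_fin m) \<longrightarrow> h (F_act m (Id_on n) f t) = \<theta> m t f)"
    using family_left[OF \<theta> n i] by (intro exI[of _ "\<lambda>t. \<theta> n t (ident (Id_on n))"]) simp
qed

lemma family_precompose:
  fixes B C :: "'u rel"
  assumes \<theta>: "family C X \<theta>" and B: "B \<in> obj k" and C: "C \<in> obj k" and q: "q \<in> hom k B C"
  shows "family B X (\<lambda>n t f. \<theta> n t (compose n q f))"
proof (rule familyI)
  have q': "compose n q f \<in> n \<rightarrow>\<^sub>E Field C" if "f \<in> n \<rightarrow>\<^sub>E Field B" for n :: "'u set" and f
    using that hom_Field[OF q] by (auto simp: compose_def)
  show "continuous_map k (F_fin n) X (\<lambda>t. \<theta> n t (compose n q f))"
    if "finite n" "f \<in> n \<rightarrow>\<^sub>E Field B" for n f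
    by (rule family_left[OF \<theta> that(1) q'[OF that(2)]])
  show "continuous_map k (power_order k n B) X (\<lambda>f. \<theta> n t (compose n q f))"
    if n: "finite n" and t: "t \<in> Field (F_fin n)" for n t
  proof -
    have "continuous_map k (power_order k n B) (power_order k n C) (compose n q)"
      using postcompose_continuous[OF obj_complete[OF B] obj_complete[OF C]
          Id_on_Partial_order[of n] hom_continuous[OF q]] by simp
    from continuous_map_compose[OF this family_right[OF \<theta> n t]] show ?thesis .
  qed
  fix n m :: "'u set" and g f t
  assume n: "finite n" and m: "finite m" and g: "g \<in> n \<rightarrow>\<^sub>E m" and f: "f \<in> m \<rightarrow>\<^sub>E Field B"
    and t: "t \<in> Field (F_fin n)"
  have "compose n (compose m q f) g = compose n q (compose n f g)"
    using g by (intro compose_assoc[symmetric]) auto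
  then show "\<theta> m (F_act n (Id_on m) g t) (compose m q f) = \<theta> n t (compose n q (compose n f g))"
    using family_natural[OF \<theta> n m g q'[OF f] t] by simp
qed

lemma finite_points_image:
  fixes B C :: "'u rel"
  assumes B: "B \<in> obj k" and C: "C \<in> obj k" and q: "q \<in> hom k B C"
  shows "on_hom F B C q ` finite_points B \<subseteq> finite_points C"
proof
  fix y assume "y \<in> on_hom F B C q ` finite_points B"
  then obtain n f t where n: "finite n" and f: "f \<in> n \<rightarrow>\<^sub>E Field B" and t: "t \<in> Field (F_fin n)"
    and y: "y = on_hom F B C q (F_act n B f t)" by (auto simp: finite_points_def)
  have "compose n q f \<in> n \<rightarrow>\<^sub>E Field C" using f hom_Field[OF q] by (auto simp: compose_def)
  with y F_act_compose[OF n B C f q t] n t show "y \<in> finite_points C"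
    unfolding finite_points_def by blast
qed

text \<open>\<open>F q\<close> is again a coinserter, hence dense, and it maps finite points to
  finite points. Nothing about \<open>A\<close> enters.\<close>

lemma generates_of_coinserter:
  assumes co: "is_coinserter k A B p0 p1 C q" and Fco: "preserves_coinserter k F A B p0 p1 C q"
    and B: "generates k (F_obj B) (finite_points B)"
  shows "generates k (F_obj C) (finite_points C)"
proof -
  note c = coinserterD[OF co]
  note Fc = Fco[unfolded preserves_coinserter_def]
  have "generates k (F_obj C) (on_hom F B C q ` finite_points B)"
    by (rule generates_image[OF B F_continuous[OF c(2,3,6)] coinserter_generates[OF Fc]])
  then show ?thesis
    using finite_points_image[OF c(2,3,6)] finite_points_subset[OF c(3)] by (rule generates_mono)
qed

text \<open>A family on \<open>C\<close> restricts along \<open>q\<close> to one on \<open>B\<close>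
  and so induces \<open>e\<close> on \<open>F B\<close>. That \<open>e\<close> respects the pair
  \<open>F p0\<close>, \<open>F p1\<close> is tested at finite points of \<open>A\<close> only, and
  surjectivity writes each tuple in \<open>C\<close> as the image of a tuple in
  \<open>B\<close>.\<close>

lemma coend_of_surjective_coinserter:
  assumes co: "is_coinserter k A B p0 p1 C q" and Fco: "preserves_coinserter k F A B p0 p1 C q"
    and surj: "q ` Field B = Field C"
    and B: "is_coend B" and genA: "generates k (F_obj A) (finite_points A)"
  shows "is_coend C"
  unfolding is_coend_def extensible_def
proof (intro conjI ballI allI impI)
  note c = coinserterD[OF co]
  note oA = c(1) and oB = c(2) and oC = c(3) and p0 = c(4) and p1 = c(5) and q = c(6)
  note Fc = Fco[unfolded preserves_coinserter_def]
  have act_q: "on_hom F B C q (F_act n B f t) = F_act n C (compose n q f) t"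
    if "finite n" "f \<in> n \<rightarrow>\<^sub>E Field B" "t \<in> Field (F_fin n)" for n f t
    by (rule F_act_compose[OF that(1) oB oC that(2) q that(3)])
  show "generates k (F_obj C) (finite_points C)"
    by (rule generates_of_coinserter[OF co Fco conjunct1[OF B[unfolded is_coend_def]]])
  fix X :: "'u rel" and \<theta> assume X: "X \<in> obj k" and \<theta>: "family C X \<theta>"
  have q': "compose n q f \<in> n \<rightarrow>\<^sub>E Field C" if "f \<in> n \<rightarrow>\<^sub>E Field B" for n :: "'u set" and f
    using that hom_Field[OF q] by (auto simp: compose_def)
  from extensibleD[OF conjunct2[OF B[unfolded is_coend_def]] X family_precompose[OF \<theta> oB oC q]]
  obtain e where e: "continuous_map k (F_obj B) X e"
    "\<forall>n f t. finite n \<and> f \<in> n \<rightarrow>\<^sub>E Field B \<and> t \<in> Field (F_fin n) \<longrightarrow>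
      e (F_act n B f t) = \<theta> n t (compose n q f)" by (elim exE conjE)
  note e_act = e(2)[rule_format, OF conjI[OF _ conjI]]
  let ?e = "restrict e (Field (F_obj B))" and ?F0 = "on_hom F A B p0" and ?F1 = "on_hom F A B p1"
  have e_hom: "?e \<in> hom k (F_obj B) X" by (rule restrict_hom[OF e(1) F_po[OF oB]])
  have le: "(e (?F0 y), e (?F1 y)) \<in> X" if y: "y \<in> Field (F_obj A)" for y
  proof (rule finite_points_leI[OF genA obj_po[OF X] _ _ _ y])
    show "continuous_map k (F_obj A) X (\<lambda>y. e (?F0 y))" "continuous_map k (F_obj A) X (\<lambda>y. e (?F1 y))"
      by (rule continuous_map_compose[OF F_continuous[OF oA oB] e(1)], rule p0 p1)+
    fix n f t assume n: "finite n" and f: "f \<in> n \<rightarrow>\<^sub>E Field A" and t: "t \<in> Field (F_fin n)"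
    have pf: "compose n p0 f \<in> n \<rightarrow>\<^sub>E Field B" "compose n p1 f \<in> n \<rightarrow>\<^sub>E Field B"
      using f hom_Field[OF p0] hom_Field[OF p1] by (auto simp: compose_def)
    \<comment> \<open>The two tuples in \<open>C\<close> are comparable coordinatewise because
      \<open>q p0 \<le> q p1\<close>; monotonicity of the family in its tuple then compares the
      values.\<close>
    have "(compose n q (compose n p0 f), compose n q (compose n p1 f)) \<in> power_order k n C"
      using q'[OF pf(1)] q'[OF pf(2)] f hom_orderD[OF c(7)]
      by (auto simp: cmaps_order_def cmaps_Id_on[OF obj_po[OF oC]] compose_def)
    from continuous_map_mono[OF family_right[OF \<theta> n t] this]
    show "(e (?F0 (F_act n A f t)), e (?F1 (F_act n A f t))) \<in> X"
      by (simp add: F_act_compose[OF n oA oB f _ t] p0 p1 e_act[OF n _ t] pf)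
  qed
  have "(compose (Field (F_obj A)) ?e ?F0, compose (Field (F_obj A)) ?e ?F1) \<in> hom_order k (F_obj A) X"
    using le F_Field[OF oA oB p0] F_Field[OF oA oB p1]
    by (intro hom_orderI compose_hom[OF F_hom[OF oA oB] e_hom F_po[OF oA]] p0 p1) (simp add: compose_eq)
  from coinserterD(8)[OF Fc X e_hom this] obtain h where h: "h \<in> hom k (F_obj C) X"
    "?e = compose (Field (F_obj B)) h (on_hom F B C q)" by blast
  have he: "h (on_hom F B C q y) = e y" if "y \<in> Field (F_obj B)" for y
    using fun_cong[OF h(2), of y] that by (simp add: compose_eq)
  have "h (F_act n C f t) = \<theta> n t f"
    if n: "finite n" and f: "f \<in> n \<rightarrow>\<^sub>E Field C" and t: "t \<in> Field (F_fin n)" for n f t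
  proof -
    from f surj PiE_image_lift[of f n q "Field B"] obtain g
      where g: "g \<in> n \<rightarrow>\<^sub>E Field B" "f = compose n q g" by auto
    then show ?thesis
      using act_q[OF n g(1) t] he[OF F_act_Field[OF n oB g(1) t]] e_act[OF n g(1) t] by simp
  qed
  then show "\<exists>h. continuous_map k (F_obj C) X h \<and> (\<forall>n f t. finite n \<and> f \<in> n \<rightarrow>\<^sub>E Field C \<and>
      t \<in> Field (F_fin n) \<longrightarrow> h (F_act n C f t) = \<theta> n t f)"
    using hom_continuous[OF h(1)] by (intro exI[of _ h]) simp
qed

lemma preserved_quotient:
  fixes B C :: "'u rel"
  assumes pres: "preserves_reflexive_surjective_coinserters k F"
    and B: "B \<in> obj k" and C: "C \<in> obj k" and q: "q \<in> hom k B C" and surj: "q ` Field B = Field C"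
    and lift: "\<And>S x. joinable k C S \<Longrightarrow> is_join C S x \<Longrightarrow>
      \<exists>S' y. joinable k B S' \<and> is_join B S' y \<and> q ` S' \<subseteq> S \<and> q y = x"
  shows "\<exists>A p0 p1. is_coinserter k A B p0 p1 C q \<and> preserves_coinserter k F A B p0 p1 C q \<and>
    (\<forall>a\<in>Field A. \<forall>a'\<in>Field A. (p0 a, p0 a') \<in> B \<and> (p1 a, p1 a') \<in> B \<longrightarrow> (a, a') \<in> A)"
proof -
  from comma_object[OF universe B C q] obtain A p0 p1 where A: "A \<in> obj k"
    and p: "p0 \<in> hom k A B" "p1 \<in> hom k A B" and refl: "reflexive_pair k A B p0 p1"
    and le: "\<forall>a\<in>Field A. (q (p0 a), q (p1 a)) \<in> C"
    and comma: "\<forall>x\<in>Field B. \<forall>y\<in>Field B. (q x, q y) \<in> C \<longrightarrow> (\<exists>a\<in>Field A. p0 a = x \<and> p1 a = y)"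
    and ord: "\<forall>a\<in>Field A. \<forall>a'\<in>Field A. (p0 a, p0 a') \<in> B \<and> (p1 a, p1 a') \<in> B \<longrightarrow> (a, a') \<in> A"
    by blast
  have co: "is_coinserter k A B p0 p1 C q"
    using le comma by (intro comma_coinserter[OF A B C p q _ _ surj lift]) auto
  then have "preserves_coinserter k F A B p0 p1 C q"
    using pres refl surj unfolding preserves_reflexive_surjective_coinserters_def by blast
  with co ord show ?thesis by blast
qed

text \<open>Present \<open>P\<close> by the discrete poset on its elements. The comma object is then
  the order relation of \<open>P\<close> with discrete order, so both objects of the pair are finite
  discrete.\<close>

lemma finite_poset_coend:
  fixes P :: "'u rel"
  assumes pres: "preserves_reflexive_surjective_coinserters k F"
    and P: "P \<in> obj k" and fin: "finite (Field P)"
  shows "is_coend P"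
proof -
  let ?n = "Field P" and ?q = "restrict (\<lambda>x. x) (Field P)"
  note po = obj_po[OF P]
  have q: "?q \<in> hom k (Id_on ?n) P" unfolding hom_Id_on[OF po] by auto
  have surj: "?q ` Field (Id_on ?n) = Field P" by simp
  have lift: "\<exists>S' y. joinable k (Id_on ?n) S' \<and> is_join (Id_on ?n) S' y \<and> ?q ` S' \<subseteq> S \<and> ?q y = x"
    if S: "joinable k P S" "is_join P S x" for S x
  proof -
    have "S \<subseteq> ?n" by (rule joinable_subset[OF po S(1)])
    then have "finite S" using fin by (rule finite_subset)
    \<comment> \<open>The join belongs to the finite set \<open>S\<close>, so the singleton
      \<open>{x}\<close> of the discrete poset serves as the lift.\<close>
    with S have "x \<in> S" by (intro joinable_finite_max[OF po])
    with \<open>S \<subseteq> ?n\<close> show ?thesis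
      by (intro exI[of _ "{x}"] exI[of _ x] conjI joinable_singleton is_join_singleton) auto
  qed
  from preserved_quotient[OF pres Id_on_obj[OF fin] P q surj lift] obtain A p0 p1
    where co: "is_coinserter k A (Id_on ?n) p0 p1 P ?q" "preserves_coinserter k F A (Id_on ?n) p0 p1 P ?q"
      and ord: "\<forall>a\<in>Field A. \<forall>a'\<in>Field A.
        (p0 a, p0 a') \<in> Id_on ?n \<and> (p1 a, p1 a') \<in> Id_on ?n \<longrightarrow> (a, a') \<in> A" by blast
  note A = coinserterD(1)[OF co(1)] and p0 = coinserterD(4)[OF co(1)] and p1 = coinserterD(5)[OF co(1)]
  have F: "p0 a \<in> Field P" "p1 a \<in> Field P" if "a \<in> Field A" for a
    using hom_Field[OF p0 that] hom_Field[OF p1 that] by simp_all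
  \<comment> \<open>The projections jointly reflect the order and take values in a discrete poset,
    so they are jointly injective and \<open>A\<close> is discrete and finite.\<close>
  have inj: "a = a'" if a: "a \<in> Field A" "a' \<in> Field A" "p0 a = p0 a'" "p1 a = p1 a'" for a a'
  proof (rule po_antisym[OF obj_po[OF A]])
    show "(a, a') \<in> A" "(a', a) \<in> A"
      by (rule ord[rule_format], use a F in auto)+
  qed
  have "A = Id_on (Field A)"
  proof (rule discrete_eq_Id_on[OF obj_po[OF A]])
    fix a a' assume aa: "(a, a') \<in> A"
    have "(p0 a, p0 a') \<in> Id_on ?n" "(p1 a, p1 a') \<in> Id_on ?n"
      by (rule continuous_map_mono[OF hom_continuous aa], rule p0 p1)+
    then have "p0 a = p0 a'" "p1 a = p1 a'" by auto
    then show "a = a'" by (rule inj[OF FieldI1[OF aa] FieldI2[OF aa]])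
  qed
  moreover have "inj_on (\<lambda>a. (p0 a, p1 a)) (Field A)" by (rule inj_onI) (auto intro: inj)
  then have "finite (Field A)"
    by (rule inj_on_finite[of _ _ "?n \<times> ?n"]) (use F fin in auto)
  ultimately have "generates k (F_obj A) (finite_points A)"
    using Id_on_coend[of "Field A"] unfolding is_coend_def by metis
  then show ?thesis by (rule coend_of_surjective_coinserter[OF co surj Id_on_coend[OF fin]])
qed

end

section \<open>The free completion as a directed colimit of finite posets\<close>

lemma continuous_map_finite:
  assumes "Partial_order r" "finite (Field r)" "\<And>x y. (x, y) \<in> r \<Longrightarrow> (f x, f y) \<in> s"
  shows "continuous_map k r s f"
proof (rule continuous_mapI[OF assms(3)])
  show "f x \<in> Field s" if "x \<in> Field r" for x
    using assms(3)[OF po_refl[OF assms(1) that]] by (rule FieldI1)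
  fix S x y assume S: "joinable k r S" "is_join r S x" and y: "\<And>z. z \<in> S \<Longrightarrow> (f z, y) \<in> s"
  have "finite S" using joinable_subset[OF assms(1) S(1)] assms(2) by (rule finite_subset)
  then have "x \<in> S" by (rule joinable_finite_max[OF assms(1) S(1) _ S(2)])
  then show "(f x, y) \<in> s" by (rule y)
qed

text \<open>A cocone over the finite subposets of \<open>C\<close> amounts to a monotone map on
  \<open>C\<close>, since monotonicity involves two elements at a time. The completion has the
  universal property for such maps. The last clause will let finite tuples of generators factor
  through one member of the diagram.\<close>

lemma free_completion_colimit:
  fixes C D :: "'u rel"
  assumes U: "universe TYPE('u)" and C: "C \<in> obj k" and D: "D \<in> obj k"
    and mono: "\<forall>x y. (x, y) \<in> C \<longrightarrow> (\<eta> x, \<eta> y) \<in> D"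
    and gen: "generates k D (\<eta> ` Field C)"
    and ext: "\<forall>X\<in>(obj k :: 'u rel set). \<forall>e. (\<forall>x y. (x, y) \<in> C \<longrightarrow> (e x, e y) \<in> X) \<longrightarrow>
      (\<exists>h. continuous_map k D X h \<and> (\<forall>x\<in>Field C. h (\<eta> x) = e x))"
  shows "\<exists>I P d c. directed_diagram k I P d \<and> is_colimit k I P d D c \<and>
    (\<forall>i\<in>Field I. finite (Field (P i))) \<and>
    (\<forall>M. finite M \<and> M \<subseteq> Field C \<longrightarrow> (\<exists>i\<in>Field I. M \<subseteq> Field (P i) \<and> (\<forall>x\<in>M. c i x = \<eta> x)))"
proof -
  note po = obj_po[OF C]
  define R where "R = {(M, N). M \<subseteq> N \<and> finite N \<and> N \<subseteq> Field C}"
  have FR: "Field R = {M. finite M \<and> M \<subseteq> Field C}"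
    by (auto simp: R_def Field_def intro: finite_subset)
  have pR: "Partial_order R"
  proof (rule Partial_orderI)
    show "(x, z) \<in> R" if "(x, y) \<in> R" "(y, z) \<in> R" for x y z using that by (auto simp: R_def)
    show "(x, x) \<in> R" if "x \<in> Field R" for x using that by (simp add: FR) (simp add: R_def)
  qed (auto simp: R_def)
  have small_R: "Field R \<prec> (UNIV :: 'u set)"
    by (rule lesspoll_subset[OF lesspoll_universe_Pow[OF U obj_small[OF C]]]) (auto simp: FR)
  define I where "I = (coded R :: 'u rel)"
  define S where "S i = decode R i" for i :: 'u
  define P where "P i = Restr C (S i)" for i
  define d where "d i j = ident (P i)" for i j :: 'u
  define c where "c i = restrict \<eta> (Field (P i))" for i
  have pI: "Partial_order I" unfolding I_def by (rule coded_Partial_order[OF small_R pR])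
  have S: "finite (S i)" "S i \<subseteq> Field C" if "i \<in> Field I" for i
    using decode_Field[OF small_R] that unfolding I_def S_def FR by blast+
  have S_mono: "S i \<subseteq> S j" if "(i, j) \<in> I" for i j
    using coded_decode[OF small_R] that unfolding I_def S_def R_def by blast
  have I_iff: "(i, j) \<in> I" if "i \<in> Field I" "j \<in> Field I" "S i \<subseteq> S j" for i j
  proof -
    have "(S i, S j) \<in> R" using that S[OF that(2)] by (simp add: R_def)
    from encode_mono[OF small_R this] encode_decode[OF small_R] that(1,2) show ?thesis
      unfolding I_def S_def by simp
  qed
  define enc where "enc M = (encode R M :: 'u)" for M
  have enc: "enc M \<in> Field I" "S (enc M) = M" if "finite M" "M \<subseteq> Field C" for M
    using encode_Field[OF small_R, of M] decode_encode[OF small_R, of M] that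
    by (simp_all add: enc_def I_def S_def FR)
  have FP: "Field (P i) = S i" if "i \<in> Field I" for i
    unfolding P_def by (rule Field_Restr[OF po S(2)[OF that]])
  have pP: "Partial_order (P i)" for i unfolding P_def by (rule Restr_Partial_order[OF po])
  have P: "P i \<in> obj k" if "i \<in> Field I" for i
    using S[OF that] FP[OF that]
    by (intro objI finite_complete_poset pP finite_lesspoll_universe[OF U]) simp_all
  have fin_hom: "restrict f (Field (P i)) \<in> hom k (P i) X"
    if "i \<in> Field I" "\<And>x y. (x, y) \<in> P i \<Longrightarrow> (f x, f y) \<in> X" for i f and X :: "'u rel"
    using that S(1) FP by (intro restrict_hom continuous_map_finite pP) auto
  have d: "d i j \<in> hom k (P i) (P j)" if "(i, j) \<in> I" for i j
    unfolding d_def ident_def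
    by (rule fin_hom[OF FieldI1[OF that]]) (use S_mono[OF that] in \<open>auto simp: P_def\<close>)
  have c: "c i \<in> hom k (P i) D" if "i \<in> Field I" for i
    unfolding c_def by (rule fin_hom[OF that]) (auto simp: P_def mono)
  have d_app: "d i j x = x" if "x \<in> Field (P i)" for i j x using that by (simp add: d_def ident_def)
  have P_sub: "Field (P i) \<subseteq> Field (P j)" if "(i, j) \<in> I" for i j
    using S_mono[OF that] FP FieldI1[OF that] FieldI2[OF that] by simp
  have dir: "directed_in I (Field I)"
    unfolding directed_in_def
  proof (intro conjI ballI)
    show "Field I \<noteq> {}" using enc(1)[of "{}"] by auto
    fix i j assume i: "i \<in> Field I" and j: "j \<in> Field I"
    have M: "finite (S i \<union> S j)" "S i \<union> S j \<subseteq> Field C" using S[OF i] S[OF j] by auto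
    show "\<exists>l\<in>Field I. (i, l) \<in> I \<and> (j, l) \<in> I"
      using enc[OF M] I_iff[OF i] I_iff[OF j] by (intro bexI[of _ "enc (S i \<union> S j)"]) auto
  qed simp
  have "compose (Field (P i)) (d j l) (d i j) = d i l" if "(i, j) \<in> I" "(j, l) \<in> I" for i j l
    unfolding d_def[of i l] ident_def compose_def
    using P_sub[OF that(1)] by (intro restrict_ext) (auto simp: d_app)
  moreover have "small (Field I)"
    unfolding small_def I_def Field_coded[OF small_R] by (rule lesspoll_image[OF small_R])
  ultimately have dd: "directed_diagram k I P d"
    unfolding directed_diagram_def using pI dir P d d_def by blast
  have cocone: "cocone k I P d D c"
    unfolding cocone_def
  proof (intro conjI ballI allI impI D c)
    show "compose (Field (P i)) (c j) (d i j) = c i" if "(i, j) \<in> I" for i j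
      unfolding c_def[of i] compose_def
      using P_sub[OF that] by (intro restrict_ext) (auto simp: d_app c_def)
  qed
  have "is_colimit k I P d D c"
    unfolding is_colimit_def
  proof (intro conjI cocone allI impI)
    fix E :: "'u rel" and e assume cone: "cocone k I P d E e"
    then have E: "E \<in> obj k" and e: "\<And>i. i \<in> Field I \<Longrightarrow> e i \<in> hom k (P i) E" by (auto simp: cocone_def)
    have e_comp: "e j x = e i x" if ij: "(i, j) \<in> I" and x: "x \<in> Field (P i)" for i j x
    proof -
      have "compose (Field (P i)) (e j) (d i j) = e i" using cone ij by (simp add: cocone_def)
      from fun_cong[OF this, of x] x show ?thesis by (simp add: compose_eq d_app)
    qed
    \<comment> \<open>The cocone is read off at singletons; compatibility makes every component
      agree with this map.\<close>
    define e' where "e' x = e (enc {x}) x" for x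
    have e': "e i x = e' x" if i: "i \<in> Field I" and x: "x \<in> S i" for i x
    proof -
      have xC: "finite {x}" "{x} \<subseteq> Field C" using x S[OF i] by auto
      have "(enc {x}, i) \<in> I" using enc[OF xC] x by (intro I_iff[OF _ i]) auto
      then show ?thesis using e_comp[of "enc {x}" i x] FP[OF enc(1)[OF xC]] enc(2)[OF xC]
        by (simp add: e'_def)
    qed
    have "\<forall>x y. (x, y) \<in> C \<longrightarrow> (e' x, e' y) \<in> E"
    proof (intro allI impI)
      fix x y assume xy: "(x, y) \<in> C"
      \<comment> \<open>Two comparable elements share the subposet \<open>{x, y}\<close>, whose
        component of the cocone is monotone.\<close>
      have M: "finite {x, y}" "{x, y} \<subseteq> Field C" using FieldI1[OF xy] FieldI2[OF xy] by auto
      have "(x, y) \<in> P (enc {x, y})" using xy enc(2)[OF M] by (simp add: P_def)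
      from continuous_map_mono[OF hom_continuous[OF e[OF enc(1)[OF M]]] this]
      show "(e' x, e' y) \<in> E" using e'[OF enc(1)[OF M]] enc(2)[OF M] by simp
    qed
    from ext[THEN bspec, OF E, THEN spec, THEN mp, OF this] obtain h where h: "continuous_map k D E h" "\<forall>x\<in>Field C. h (\<eta> x) = e' x" by blast
    have hom: "restrict h (Field D) \<in> hom k D E" by (rule restrict_hom[OF h(1) obj_po[OF D]])
    show "\<exists>!h. h \<in> hom k D E \<and> (\<forall>i\<in>Field I. compose (Field (P i)) h (c i) = e i)"
    proof (rule ex1I[of _ "restrict h (Field D)"])
      have "compose (Field (P i)) (restrict h (Field D)) (c i) = e i" if i: "i \<in> Field I" for i
      proof (rule hom_eqI[OF compose_hom[OF c[OF i] hom pP] e[OF i]])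
        fix x assume x: "x \<in> Field (P i)"
        then have "x \<in> S i" "x \<in> Field C" using FP[OF i] S[OF i] by auto
        then show "compose (Field (P i)) (restrict h (Field D)) (c i) x = e i x"
          using h(2) e'[OF i] hom_Field[OF c[OF i] x] x by (simp add: compose_eq c_def)
      qed
      with hom show "restrict h (Field D) \<in> hom k D E \<and>
          (\<forall>i\<in>Field I. compose (Field (P i)) (restrict h (Field D)) (c i) = e i)" by blast
      fix h' assume h': "h' \<in> hom k D E \<and> (\<forall>i\<in>Field I. compose (Field (P i)) h' (c i) = e i)"
      show "h' = restrict h (Field D)"
      proof (rule hom_eqI[OF conjunct1[OF h'] hom])
        fix y assume y: "y \<in> Field D"
        have "h' y = h y"
        proof (rule continuous_eq_on_generators[OF gen obj_po[OF E] hom_continuous[OF conjunct1[OF h']] h(1) _ y])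
          fix z assume "z \<in> \<eta> ` Field C"
          then obtain x where x: "x \<in> Field C" "z = \<eta> x" by auto
          then have M: "finite {x}" "{x} \<subseteq> Field C" by auto
          have "compose (Field (P (enc {x}))) h' (c (enc {x})) = e (enc {x})" using h' enc(1)[OF M] by blast
          from fun_cong[OF this, of x] FP[OF enc(1)[OF M]] enc(2)[OF M] x h(2)
          show "h' z = h z" by (simp add: compose_eq c_def e'_def)
        qed
        with y show "h' y = restrict h (Field D) y" by simp
      qed
    qed
  qed
  moreover have "\<exists>i\<in>Field I. M \<subseteq> Field (P i) \<and> (\<forall>x\<in>M. c i x = \<eta> x)" if "finite M" "M \<subseteq> Field C" for M
    using enc[OF that] FP[OF enc(1)[OF that]] by (intro bexI[of _ "enc M"]) (auto simp: c_def)
  moreover have "\<forall>i\<in>Field I. finite (Field (P i))" using S(1) FP by simp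
  ultimately show ?thesis using dd by blast
qed

context endofunctor
begin

lemma F_directed_diagram:
  assumes "directed_diagram k I P d"
  shows "directed_diagram k I (\<lambda>i. F_obj (P i)) (\<lambda>i j. on_hom F (P i) (P j) (d i j))"
proof -
  note D = directed_diagramD[OF assms]
  have "compose (Field (F_obj (P i))) (on_hom F (P j) (P l) (d j l)) (on_hom F (P i) (P j) (d i j)) =
      on_hom F (P i) (P l) (d i l)" if "(i, j) \<in> I" "(j, l) \<in> I" for i j l
    using F_compose_hom[OF D(3)[OF FieldI1[OF that(1)]] D(3)[OF FieldI1[OF that(2)]] D(3)[OF FieldI2[OF that(2)]]
        D(4)[OF that(1)] D(4)[OF that(2)]] D(6)[OF that] by simp
  moreover have "on_hom F (P i) (P j) (d i j) \<in> hom k (F_obj (P i)) (F_obj (P j))" if "(i, j) \<in> I" for i j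
    by (rule F_hom[OF D(3)[OF FieldI1[OF that]] D(3)[OF FieldI2[OF that]] D(4)[OF that]])
  moreover have "small (Field I)" using assms by (simp add: directed_diagram_def)
  ultimately show ?thesis
    unfolding directed_diagram_def using D(1,2) F_obj[OF D(3)] F_ident_hom[OF D(3)] D(5) by simp
qed

text \<open>A family on \<open>D\<close> restricts to each finite member \<open>P i\<close> and
  induces maps \<open>e i\<close> there. They form a cocone because they are determined at finite
  points, and preservation of the colimit glues them to a map on \<open>F D\<close>.\<close>

lemma free_completion_coend:
  fixes C D :: "'u rel"
  assumes dcol: "preserves_directed_colimits k F" and rsc: "preserves_reflexive_surjective_coinserters k F"
    and C: "C \<in> obj k" and D: "D \<in> obj k"
    and mono: "\<forall>x y. (x, y) \<in> C \<longrightarrow> (\<eta> x, \<eta> y) \<in> D"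
    and gen: "generates k D (\<eta> ` Field C)"
    and ext: "\<forall>X\<in>(obj k :: 'u rel set). \<forall>e. (\<forall>x y. (x, y) \<in> C \<longrightarrow> (e x, e y) \<in> X) \<longrightarrow>
      (\<exists>h. continuous_map k D X h \<and> (\<forall>x\<in>Field C. h (\<eta> x) = e x))"
  shows "is_coend D"
proof -
  from free_completion_colimit[OF universe C D mono gen ext] obtain I P d c
    where dd: "directed_diagram k I P d" and col: "is_colimit k I P d D c"
      and fin: "\<forall>i\<in>Field I. finite (Field (P i))"
      and cov: "\<forall>M. finite M \<and> M \<subseteq> Field C \<longrightarrow> (\<exists>i\<in>Field I. M \<subseteq> Field (P i) \<and> (\<forall>x\<in>M. c i x = \<eta> x))"
    by (elim exE conjE)
  note P = directed_diagramD[OF dd] and c = colimitD(2)[OF col]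
  have coendP: "is_coend (P i)" if "i \<in> Field I" for i
    using fin that by (intro finite_poset_coend[OF rsc P(3)[OF that]]) blast
  let ?FP = "\<lambda>i. F_obj (P i)" and ?Fd = "\<lambda>i j. on_hom F (P i) (P j) (d i j)"
    and ?Fc = "\<lambda>i. on_hom F (P i) D (c i)"
  have Fcol: "is_colimit k I ?FP ?Fd (F_obj D) ?Fc"
    using dcol dd col unfolding preserves_directed_colimits_def by blast
  have "generates k (F_obj D) (finite_points D)"
  proof (rule generatesI[OF finite_points_subset[OF D]])
    fix T x assume T: "finite_points D \<subseteq> T" "join_closed k (F_obj D) T" and x: "x \<in> Field (F_obj D)"
    have "Field (?FP i) \<subseteq> {y. ?Fc i y \<in> T}" if i: "i \<in> Field I" for i
      using finite_points_image[OF P(3)[OF i] D c[OF i]] T(1) coendP[OF i, unfolded is_coend_def]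
      by (intro generatesD[OF _ _ join_closed_vimage[OF F_continuous[OF P(3)[OF i] D c[OF i]] T(2)]]) auto
    then have "(\<lambda>(i, x). ?Fc i x) ` points (Field I) ?FP \<subseteq> T" by (auto simp: points_def)
    with generatesD[OF presents_generates[OF colimit_presents[OF F_directed_diagram[OF dd] Fcol]] _ T(2)] x
    show "x \<in> T" by blast
  qed
  moreover have "extensible D"
    unfolding extensible_def
  proof (intro ballI allI impI)
    fix X :: "'u rel" and \<theta> assume X: "X \<in> obj k" and \<theta>: "family D X \<theta>"
    have "\<exists>e. continuous_map k (?FP i) X e \<and> (\<forall>n f t. finite n \<and> f \<in> n \<rightarrow>\<^sub>E Field (P i) \<and>
        t \<in> Field (F_fin n) \<longrightarrow> e (F_act n (P i) f t) = \<theta> n t (compose n (c i) f))" if i: "i \<in> Field I" for i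
      using coendP[OF i]
      by (intro extensibleD[OF _ X family_precompose[OF \<theta> P(3)[OF i] D c[OF i]]]) (simp add: is_coend_def)
    then have "\<forall>i\<in>Field I. \<exists>e. continuous_map k (?FP i) X e \<and> (\<forall>n f t. finite n \<and> f \<in> n \<rightarrow>\<^sub>E Field (P i) \<and>
        t \<in> Field (F_fin n) \<longrightarrow> e (F_act n (P i) f t) = \<theta> n t (compose n (c i) f))" by blast
    from bchoice[OF this] obtain e0 where e0: "\<forall>i\<in>Field I. continuous_map k (?FP i) X (e0 i) \<and>
        (\<forall>n f t. finite n \<and> f \<in> n \<rightarrow>\<^sub>E Field (P i) \<and> t \<in> Field (F_fin n) \<longrightarrow>
          e0 i (F_act n (P i) f t) = \<theta> n t (compose n (c i) f))" by (elim exE)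
    define e where "e i = restrict (e0 i) (Field (?FP i))" for i
    have e: "e i \<in> hom k (?FP i) X" if i: "i \<in> Field I" for i
      unfolding e_def using e0 i by (intro restrict_hom F_po P(3)) auto
    have e_act: "e i (F_act n (P i) f t) = \<theta> n t (compose n (c i) f)"
      if "i \<in> Field I" "finite n" "f \<in> n \<rightarrow>\<^sub>E Field (P i)" "t \<in> Field (F_fin n)" for i n f t
      using e0[rule_format, OF that(1), THEN conjunct2, rule_format, OF conjI[OF that(2) conjI[OF that(3,4)]]]
        F_act_Field[OF that(2) P(3)[OF that(1)] that(3,4)] by (simp add: e_def)
    have "compose (Field (?FP i)) (e j) (?Fd i j) = e i" if ij: "(i, j) \<in> I" for i j
    proof -
      note i = FieldI1[OF ij] and j = FieldI2[OF ij]
      note Fd = F_hom[OF P(3)[OF i] P(3)[OF j] P(4)[OF ij]]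
      show ?thesis
      proof (rule hom_eqI[OF compose_hom[OF Fd e[OF j] F_po[OF P(3)[OF i]]] e[OF i]])
        fix y assume y: "y \<in> Field (?FP i)"
        have "e j (?Fd i j y) = e i y"
        proof (rule finite_points_eqI[OF coendP[OF i] obj_po[OF X]
              continuous_map_compose[OF hom_continuous[OF Fd] hom_continuous[OF e[OF j]]] hom_continuous[OF e[OF i]] _ y])
          fix n f t assume n: "finite n" and f: "f \<in> n \<rightarrow>\<^sub>E Field (P i)" and t: "t \<in> Field (F_fin n)"
          have f': "f \<in> n \<rightarrow> Field (P i)" using f by auto
          have df: "compose n (d i j) f \<in> n \<rightarrow>\<^sub>E Field (P j)"
            using f hom_Field[OF P(4)[OF ij]] by (auto simp: compose_def)
          have "compose n (c j) (compose n (d i j) f) = compose n (c i) f"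
            using compose_assoc[OF f', of "c j" "d i j"] colimitD(3)[OF col ij] by simp
          then show "e j (?Fd i j (F_act n (P i) f t)) = e i (F_act n (P i) f t)"
            using F_act_compose[OF n P(3)[OF i] P(3)[OF j] f P(4)[OF ij] t] e_act[OF j n df t] e_act[OF i n f t]
            by simp
        qed
        with y show "compose (Field (?FP i)) (e j) (?Fd i j) y = e i y" by (simp add: compose_eq)
      qed
    qed
    then have "cocone k I ?FP ?Fd X e" using X e by (simp add: cocone_def)
    from colimitD(4)[OF Fcol this] obtain h where h: "h \<in> hom k (F_obj D) X"
      "\<And>i. i \<in> Field I \<Longrightarrow> compose (Field (?FP i)) h (?Fc i) = e i" by blast
    have he: "h (?Fc i y) = e i y" if "i \<in> Field I" "y \<in> Field (?FP i)" for i y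
      using fun_cong[OF h(2)[OF that(1)], of y] that(2) by (simp add: compose_eq)
    have "h (F_act n D f t) = \<theta> n t f"
      if n: "finite n" and f: "f \<in> n \<rightarrow>\<^sub>E Field D" and t: "t \<in> Field (F_fin n)" for n f t
    proof (rule continuous_eq_on_generators[OF power_generates[OF obj_complete[OF D] gen n] obj_po[OF X]
          continuous_map_compose[OF F_act_eval_continuous[OF n D t] hom_continuous[OF h(1)]] family_right[OF \<theta> n t]])
      show "f \<in> Field (power_order k n D)" using f by (simp add: Field_power_order[OF obj_po[OF D]])
      fix f assume "f \<in> n \<rightarrow>\<^sub>E \<eta> ` Field C"
      from PiE_image_lift[OF this] obtain g where g: "g \<in> n \<rightarrow>\<^sub>E Field C" "f = compose n \<eta> g" by blast
      \<comment> \<open>A finite tuple of generators lies in a single finite subposet, so its value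
        is computed by one of the maps \<open>e i\<close>.\<close>
      have "finite (g ` n) \<and> g ` n \<subseteq> Field C" using n g by auto
      from cov[rule_format, OF this] obtain i
        where i: "i \<in> Field I" "g ` n \<subseteq> Field (P i)" "\<forall>x\<in>g ` n. c i x = \<eta> x" by blast
      have "g x \<in> Field (P i)" if "x \<in> n" for x using i(2) that by blast
      with g(1) have gP: "g \<in> n \<rightarrow>\<^sub>E Field (P i)" by (simp add: PiE_iff)
      have "f = compose n (c i) g" using i(3) unfolding g(2) compose_def by (intro restrict_ext) simp
      then show "h (F_act n D f t) = \<theta> n t f"
        using F_act_compose[OF n P(3)[OF i(1)] D gP c[OF i(1)] t] he[OF i(1) F_act_Field[OF n P(3)[OF i(1)] gP t]]
          e_act[OF i(1) n gP t] by simp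
    qed
    then show "\<exists>h. continuous_map k (F_obj D) X h \<and> (\<forall>n f t. finite n \<and> f \<in> n \<rightarrow>\<^sub>E Field D \<and>
        t \<in> Field (F_fin n) \<longrightarrow> h (F_act n D f t) = \<theta> n t f)"
      using hom_continuous[OF h(1)] by (intro exI[of _ h]) simp
  qed
  ultimately show ?thesis by (simp add: is_coend_def)
qed

text \<open>The quotient map extends the identity of \<open>C\<close>. A joinable \<open>S\<close>
  lifts to its image under \<open>\<eta>\<close>, whose join in the completion is sent to the join
  of \<open>S\<close> by continuity.\<close>

lemma free_completion_quotient:
  fixes C :: "'u rel"
  assumes dcol: "preserves_directed_colimits k F" and rsc: "preserves_reflexive_surjective_coinserters k F"
    and C: "C \<in> obj k"
  shows "\<exists>A B p0 p1 q. is_coinserter k A B p0 p1 C q \<and> preserves_coinserter k F A B p0 p1 C q \<and>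
    q ` Field B = Field C \<and> is_coend B"
proof -
  note po = obj_po[OF C]
  from free_completion[OF universe C] obtain B :: "'u rel" and \<eta> where B: "B \<in> obj k"
    and mono: "\<forall>x y. (x, y) \<in> C \<longrightarrow> (\<eta> x, \<eta> y) \<in> B" and gen: "generates k B (\<eta> ` Field C)"
    and ext: "\<forall>X\<in>(obj k :: 'u rel set). \<forall>e. (\<forall>x y. (x, y) \<in> C \<longrightarrow> (e x, e y) \<in> X) \<longrightarrow>
      (\<exists>h. continuous_map k B X h \<and> (\<forall>x\<in>Field C. h (\<eta> x) = e x))" by (elim exE conjE)
  have coend: "is_coend B"
    by (rule free_completion_coend[OF dcol rsc C B mono gen ext])
  obtain \<epsilon> where \<epsilon>: "continuous_map k B C \<epsilon>" "\<forall>x\<in>Field C. \<epsilon> (\<eta> x) = x"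
    using ext[rule_format, OF C, of "\<lambda>x. x"] by blast
  define q where "q = restrict \<epsilon> (Field B)"
  have q: "q \<in> hom k B C" unfolding q_def by (rule restrict_hom[OF \<epsilon>(1) obj_po[OF B]])
  have \<eta>: "\<eta> x \<in> Field B" if "x \<in> Field C" for x
    using generates_subset[OF gen] that by auto
  have q\<eta>: "q (\<eta> x) = x" if "x \<in> Field C" for x using that \<epsilon>(2) \<eta> by (simp add: q_def)
  have surj: "q ` Field B = Field C"
  proof
    show "q ` Field B \<subseteq> Field C" using hom_Field[OF q] by auto
    show "Field C \<subseteq> q ` Field B" using q\<eta> \<eta> by (metis imageI subsetI)
  qed
  have "\<exists>S' y. joinable k B S' \<and> is_join B S' y \<and> q ` S' \<subseteq> S \<and> q y = x"
    if S: "joinable k C S" "is_join C S x" for S x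
  proof -
    have jS: "joinable k B (\<eta> ` S)" using mono S(1) by (intro joinable_image[of S C \<eta> B]) auto
    from complete_poset_join[OF obj_complete[OF B] this] obtain y where y: "is_join B (\<eta> ` S) y" by blast
    have qS: "q ` \<eta> ` S = S" using q\<eta> joinable_subset[OF po S(1)] by (force simp: image_image)
    have "q y = x"
      using continuous_map_join[OF hom_continuous[OF q] jS y] S(2) unfolding qS by (rule is_join_unique[OF po])
    with jS y qS show ?thesis by blast
  qed
  from preserved_quotient[OF rsc B C q surj this] coend surj show ?thesis by blast
qed

lemma preserves_imp_coend:
  fixes C :: "'u rel"
  assumes dcol: "preserves_directed_colimits k F" and rsc: "preserves_reflexive_surjective_coinserters k F"
    and C: "C \<in> obj k"
  shows "is_coend C"
proof -
  \<comment> \<open>Established for every object so that it can be applied below to the pair object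
    of the coinserter that presents \<open>C\<close>.\<close>
  have gen: "generates k (F_obj A) (finite_points A)" if A: "A \<in> obj k" for A
  proof -
    from free_completion_quotient[OF dcol rsc A] obtain A' B p0 p1 q
      where q: "is_coinserter k A' B p0 p1 A q" "preserves_coinserter k F A' B p0 p1 A q" "is_coend B"
      by (elim exE conjE)
    show ?thesis by (rule generates_of_coinserter[OF q(1,2) conjunct1[OF q(3)[unfolded is_coend_def]]])
  qed
  from free_completion_quotient[OF dcol rsc C] obtain A B p0 p1 q
    where co: "is_coinserter k A B p0 p1 C q" and q: "preserves_coinserter k F A B p0 p1 C q"
      "q ` Field B = Field C" "is_coend B" by (elim exE conjE)
  show ?thesis by (rule coend_of_surjective_coinserter[OF co q gen[OF coinserterD(1)[OF co]]])
qed

end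

theorem corollary2p30:
  fixes k :: kind and F :: "'u endo"
  assumes "universe TYPE('u)"
    and "enriched_endofunctor k F"
  shows "(strongly_finitary k F \<longleftrightarrow>
            preserves_directed_colimits k F \<and> preserves_reflexive_coinserters k F) \<and>
         (strongly_finitary k F \<longleftrightarrow>
            preserves_directed_colimits k F \<and> preserves_reflexive_surjective_coinserters k F)"
proof -
  interpret endofunctor k F by unfold_locales (rule assms)+
  \<comment> \<open>Three implications in a circle give both equivalences; restricting to surjective
    coinserters only weakens the condition.\<close>
  have "preserves_directed_colimits k F \<and> preserves_reflexive_coinserters k F" if "strongly_finitary k F"
    using strongly_finitary_imp_coend[OF that]
    by (intro conjI coend_preserves_directed_colimits coend_preserves_reflexive_coinserters)
  moreover have "preserves_reflexive_surjective_coinserters k F" if "preserves_reflexive_coinserters k F"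
    unfolding preserves_reflexive_surjective_coinserters_def
    by (intro allI impI that[unfolded preserves_reflexive_coinserters_def, rule_format]) simp
  moreover have "strongly_finitary k F"
    if "preserves_directed_colimits k F" "preserves_reflexive_surjective_coinserters k F"
    by (rule coend_imp_strongly_finitary[OF preserves_imp_coend[OF that]])
  ultimately show ?thesis by blast
qed

end
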